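(* For every $n\geq 1$ and every semi-simple Lie algebra $\mathfrak{g}$ of rank $n$ (equivalently every Cartan matrix of finite type of rank $n$), and for every dominant monomial $m\in B$, there is a unique $F_t(m)\in\mathfrak{K}_t^{\infty}\cap\tilde D_m$ such that $m$ is the unique dominant monomial of $F_t(m)$ (occurring with coefficient $1$).
   Context: Cartan data. $I=\{1,\dots,n\}$, $C=(C_{i,j})$ the Cartan matrix of finite type of $\mathfrak{g}$, $r_i\in\mathbb{N}^*$ with $(r_iC_{i,j})$ symmetric, coprime on each indecomposable component. $z$ is an indeterminate, $[l]_z=\frac{z^l-z^{-l}}{z-z^{-1}}$, $C(z)_{i,i}=z^{r_i}+z^{-r_i}$, $C(z)_{i,j}=[C_{i,j}]_z$ ($i\neq j$), $\tilde C(z)=C(z)^{-1}$; $(\tilde C_{i,j})_r\in\mathbb{Z}$ is the coefficient of $z^r$ in the expansion of $\tilde C_{i,j}(z)$ in $\mathbb{Z}((z^{-1}))$. Monomials. $\mathcal{Y}=\mathbb{Z}[Y_{i,l}^{\pm1}]_{i\in I,l\in\mathbb{Z}}$ (commutative), $A$ is its set of Laurent monomials $m=\prod Y_{i,l}^{u_{i,l}(m)}$, and $$A_{i,l}=Y_{i,l-r_i}Y_{i,l+r_i}\prod_{C_{j,i}=-1}Y_{j,l}^{-1}\prod_{C_{j,i}=-2}Y_{j,l+1}^{-1}Y_{j,l-1}^{-1}\prod_{C_{j,i}=-3}Y_{j,l+2}^{-1}Y_{j,l}^{-1}Y_{j,l-2}^{-1}.$$ $B_i=\{m\in A:u_{i,l}(m)\ge0\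 \forall l\}$, $B_J=\bigcap_{i\in J}B_i$ ($J\subset I$; $J$-dominant monomials), $B=B_I$ (dominant monomials). The algebra $\mathcal{Y}_t$. It is the free $\mathbb{Z}[t^{\pm1}]$-module with basis $\{:\!m\!:\,\mid m\in A\}$ and $\mathbb{Z}[t^{\pm1}]$-bilinear associative product $:\!m_1\!:\,:\!m_2\!:\,=t^{\mathcal{N}(m_1,m_2)}:\!m_1m_2\!:$, where $\mathcal{N}:A\times A\to\mathbb{Z}$ is the bicharacter with $\mathcal{N}(Y_{i,l},Y_{j,k})=(\tilde C_{j,i})_{r_j+l-k}-(\tilde C_{j,i})_{-r_j+l-k}$. Put $\tilde Y_{i,l}=:\!Y_{i,l}\!:$, $\tilde A_{i,l}=:\!A_{i,l}\!:$ (invertible, $\tilde A_{i,l}^{-1}=:\!A_{i,l}^{-1}\!:$). We identify $m$ with $:\!m\!:$; the monomials of an element are the $m$ with nonzero coefficient. $\overset{\rightarrow}{\prod}_{l}$ is the product ordered by increasing $l$. Completions. For $m\in B_i$ put $E_{i,t}(m)=\overset{\rightarrow}{\prod}_{l\in\mathbb{Z}}\bigl((\tilde Y_{i,l}(1+t\tilde A_{i,l+r_i}^{-1}))^{u_{i,l}(m)}\prod_{j\ne i}\tilde Y_{j,l}^{u_{j,l}(m)}\bigr)$. Let $\mathcal{Y}_t^{A,K}$ be the $\mathbb{Z}[t^{\pm1}]$-span of the $:\!a\!:$ with $a$ a product of $K$ elements $A_{j,l}^{-1}$, $\mathcal{Y}_t^{A,\infty}=\prod_{K\ge0}\mathcal{Y}_t^{A,K}$,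 and $\mathcal{Y}_t^\infty=\sum_{M\in A}:\!M\!:\mathcal{Y}_t^{A,\infty}\subset\prod_{m\in A}\mathbb{Z}[t^{\pm1}]:\!m\!:$ (finite sums over $M$); it is an algebra containing $\mathcal{Y}_t$. $\mathfrak{K}_{i,t}^\infty\subset\mathcal{Y}_t^\infty$ is the set of finite sums, over $M\in A$, of elements $\sum_{K\ge0}\sum_a\lambda_a(t)E_{i,t}(Ma)$, where for each $K$ the inner sum is over finitely many products $a$ of $K$ elements $A_{j,l}^{-1}$ with $Ma\in B_i$, $\lambda_a(t)\in\mathbb{Z}[t^{\pm1}]$. $\mathfrak{K}_{J,t}^\infty=\bigcap_{i\in J}\mathfrak{K}_{i,t}^\infty$, $\mathfrak{K}_t^\infty=\mathfrak{K}_{I,t}^\infty$. The sets $D_m$. Let $\mathfrak{K}_i\subset\mathcal{Y}$ be the subring generated by the $Y_{i,l}(1+A_{i,l+r_i}^{-1})$ and $Y_{j,l}^{\pm1}$ ($j\neq i$, $l\in\mathbb{Z}$) and $\mathfrak{K}_J=\bigcap_{i\in J}\mathfrak{K}_i$. For $j\in J$ it is known (Frenkel–Reshetikhin, Frenkel–Mukhin) that there is a unique $E_J(Y_{j,l})\in\mathfrak{K}_J$ whose only $J$-dominant monomial is $Y_{j,l}$, with coefficient 1. For $m\in B_J$ put $E_J(m)=\prod_{i\notin J,l}Y_{i,l}^{u_{i,l}(m)}\prod_{j\in J,l}E_J(Y_{j,l})^{u_{j,l}(m)}$. For $m\in A$, $D_m$ is the set of $m'\in A$ for which there is a finite sequence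 $(m_0=m,m_1,\dots,m_R=m')$ such that for all $1\le r\le R$ there are $r'<r$ and $J\subset I$ with $m_{r'}\in B_J$ and, for all $r'<r''\le r$, $m_{r''}$ is a monomial of $E_J(m_{r'})$ and $m_{r''}m_{r''-1}^{-1}\in\{A_{j,l}^{-1}:l\in\mathbb{Z},j\in J\}$. $\tilde D_m\subset\mathcal{Y}_t^\infty$ is the $\mathbb{Z}[t^{\pm1}]$-submodule of all (possibly infinite) sums $\sum_{m'\in D_m}\lambda_{m'}(t):\!m'\!:$. *)

theory Defs
  imports
    Complex_Main
    "HOL-Library.Poly_Mapping"
    "HOL-Computational_Algebra.Formal_Laurent_Series"
begin

text \<open>
  Laurent monomials in the $Y_{i,l}$ are written additively: a monomial is the finitely supported
  family of its exponents $u_{i,l}$, so that the product of monomials is \<open>+\<close> and the inverse is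
  unary minus. A Laurent polynomial is an element of the group algebra of such a group, the
  multiplication being the convolution product of \<^theory>\<open>HOL-Library.Poly_Mapping\<close>.
\<close>

type_synonym mono = "(nat \<times> int) \<Rightarrow>\<^sub>0 int"

type_synonym tpoly = "int \<Rightarrow>\<^sub>0 int"

definition tpow :: "int \<Rightarrow> tpoly" where
  "tpow k = Poly_Mapping.single k 1"

inductive_set subring_gen :: "'a::ring_1 set \<Rightarrow> 'a set" for G where
  gen: "x \<in> G \<Longrightarrow> x \<in> subring_gen G"
| one: "1 \<in> subring_gen G"
| diff: "x \<in> subring_gen G \<Longrightarrow> y \<in> subring_gen G \<Longrightarrow> x - y \<in> subring_gen G"
| mult: "x \<in> subring_gen G \<Longrightarrow> y \<in> subring_gen G \<Longrightarrow> x * y \<in> subring_gen G"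

text \<open>
  $\mathbb{Z}((z^{-1}))$ is \<^typ>\<open>int fls\<close> with the formal variable standing for $z^{-1}$; the
  coefficient of $z^k$ is the one of index $-k$.
\<close>

definition zpow :: "int \<Rightarrow> int fls" where
  "zpow k = fls_X_intpow (- k)"

definition zcoeff :: "int fls \<Rightarrow> int \<Rightarrow> int" where
  "zcoeff f k = fls_nth f (- k)"

text \<open>
  $[l]_z$ as a Laurent polynomial, i.e. with the division by $z - z^{-1}$ carried out.
\<close>

definition qint :: "int \<Rightarrow> int fls" where
  "qint l = of_int (sgn l) * (\<Sum>k<nat \<bar>l\<bar>. zpow (\<bar>l\<bar> - 1 - 2 * int k))"

lemma qint_mult: "qint l * (zpow 1 - zpow (- 1)) = zpow l - zpow (- l)"
proof -
  have mult: "zpow a * zpow b = zpow (a + b)" for a b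
    unfolding zpow_def by (subst fls_X_intpow_times_fls_X_intpow) (simp add: algebra_simps)
  have nat_case: "(\<Sum>k<m. zpow (int m - 1 - 2 * int k)) * (zpow 1 - zpow (- 1))
      = zpow (int m) - zpow (- int m)" for m
  proof -
    have "(\<Sum>k<m. zpow (int m - 1 - 2 * int k)) * (zpow 1 - zpow (- 1))
        = (\<Sum>k<m. zpow (int m - 2 * int k) - zpow (int m - 2 * int (Suc k)))"
      unfolding sum_distrib_right right_diff_distrib mult by (simp add: algebra_simps sum_subtractf)
    also have "\<dots> = zpow (int m) - zpow (- int m)"
      by (subst sum_lessThan_telescope') simp
    finally show ?thesis .
  qed
  show ?thesis
  proof (cases "l \<ge> 0")
    case True
    then show ?thesis
      using nat_case[of "nat l"] by (cases "l = 0") (simp_all add: qint_def)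
  next
    case False
    then show ?thesis
      using nat_case[of "nat (- l)"] by (simp add: qint_def algebra_simps)
  qed
qed

text \<open>
  The locale without assumptions only collects the parameters, so that the definitions below are
  unconditional.
\<close>

locale cartan_data =
  fixes n :: nat and C :: "nat \<Rightarrow> nat \<Rightarrow> int" and r :: "nat \<Rightarrow> nat"
begin

abbreviation I :: "nat set" where
  "I \<equiv> {1..n}"

definition component :: "nat \<Rightarrow> nat set" where
  "component i = {j. (i, j) \<in> {(a, b). a \<in> I \<and> b \<in> I \<and> C a b \<noteq> 0}\<^sup>*}"

definition Cz :: "nat \<Rightarrow> nat \<Rightarrow> int fls" where
  "Cz i j = (if i = j then zpow (int (r i)) + zpow (- int (r i)) else qint (C i j))"

definition Cz_inv :: "nat \<Rightarrow> nat \<Rightarrow> int fls" where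
  "Cz_inv = (THE X.
      (\<forall>i\<in>I. \<forall>j\<in>I. (\<Sum>k\<in>I. Cz i k * X k j) = of_bool (i = j) \<and>
                     (\<Sum>k\<in>I. X i k * Cz k j) = of_bool (i = j)) \<and>
      (\<forall>i j. i \<notin> I \<or> j \<notin> I \<longrightarrow> X i j = 0))"

definition monomials :: "mono set" where
  "monomials = {m. Poly_Mapping.keys m \<subseteq> I \<times> UNIV}"

definition Ymon :: "nat \<Rightarrow> int \<Rightarrow> mono" where
  "Ymon i l = Poly_Mapping.single (i, l) 1"

definition Amon :: "nat \<Rightarrow> int \<Rightarrow> mono" where
  "Amon i l = Ymon i (l - int (r i)) + Ymon i (l + int (r i))
     - (\<Sum>j\<in>{j\<in>I. C j i = -1}. Ymon j l)
     - (\<Sum>j\<in>{j\<in>I. C j i = -2}. Ymon j (l + 1) + Ymon j (l - 1))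
     - (\<Sum>j\<in>{j\<in>I. C j i = -3}. Ymon j (l + 2) + Ymon j l + Ymon j (l - 2))"

definition B :: "nat set \<Rightarrow> mono set" where
  "B J = {m \<in> monomials. \<forall>i\<in>J. \<forall>l. 0 \<le> Poly_Mapping.lookup m (i, l)}"

definition Nvar :: "nat \<times> int \<Rightarrow> nat \<times> int \<Rightarrow> int" where
  "Nvar = (\<lambda>(i, l) (j, k).
     zcoeff (Cz_inv j i) (int (r j) + l - k) - zcoeff (Cz_inv j i) (- int (r j) + l - k))"

definition N :: "mono \<Rightarrow> mono \<Rightarrow> int" where
  "N m1 m2 = (\<Sum>p\<in>Poly_Mapping.keys m1. \<Sum>q\<in>Poly_Mapping.keys m2.
     Poly_Mapping.lookup m1 p * Poly_Mapping.lookup m2 q * Nvar p q)"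

text \<open>
  Elements of $\mathcal{Y}_t$ are finitely supported families \<^typ>\<open>mono \<Rightarrow>\<^sub>0 tpoly\<close>
  of coefficients in the basis $:\!m\!:$. Their product is the twisted one below, not the
  convolution product \<open>*\<close> of the type.
\<close>

definition nmon :: "mono \<Rightarrow> mono \<Rightarrow>\<^sub>0 tpoly" where
  "nmon m = Poly_Mapping.single m 1"

definition tmult :: "(mono \<Rightarrow>\<^sub>0 tpoly) \<Rightarrow> (mono \<Rightarrow>\<^sub>0 tpoly) \<Rightarrow> (mono \<Rightarrow>\<^sub>0 tpoly)" where
  "tmult x y = (\<Sum>m1\<in>Poly_Mapping.keys x. \<Sum>m2\<in>Poly_Mapping.keys y.
     Poly_Mapping.single (m1 + m2)
       (tpow (N m1 m2) * Poly_Mapping.lookup x m1 * Poly_Mapping.lookup y m2))"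

definition tprod :: "(mono \<Rightarrow>\<^sub>0 tpoly) list \<Rightarrow> (mono \<Rightarrow>\<^sub>0 tpoly)" where
  "tprod xs = foldr tmult xs (nmon 0)"

definition tpower :: "(mono \<Rightarrow>\<^sub>0 tpoly) \<Rightarrow> nat \<Rightarrow> (mono \<Rightarrow>\<^sub>0 tpoly)" where
  "tpower x k = tprod (replicate k x)"

text \<open>
  The inverse of $:\!m\!:$ in $\mathcal{Y}_t$ is $t^{\mathcal{N}(m,m)}:\!m^{-1}\!:$. The power of
  $t$ is trivial for $m = A_{i,l}$, but not for $m = Y_{i,l}$.
\<close>

definition nmon_inv :: "mono \<Rightarrow> mono \<Rightarrow>\<^sub>0 tpoly" where
  "nmon_inv m = Poly_Mapping.single (- m) (tpow (N m m))"

lemma nmon_inv: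
  "tmult (nmon m) (nmon_inv m) = nmon 0" "tmult (nmon_inv m) (nmon m) = nmon 0"
proof -
  have keys_uminus: "Poly_Mapping.keys (- m) = Poly_Mapping.keys m" for m :: mono
    by (auto simp: in_keys_iff)
  have "N m (- m) = - N m m" "N (- m) m = - N m m"
    by (simp_all add: N_def keys_uminus sum_negf)
  moreover have "tpow a * tpow b = tpow (a + b)" for a b
    by (simp add: tpow_def mult_single)
  moreover have "tpow 0 = 1" "tpow a \<noteq> 0" for a
    by (simp_all add: tpow_def flip: single_one)
  ultimately show "tmult (nmon m) (nmon_inv m) = nmon 0" "tmult (nmon_inv m) (nmon m) = nmon 0"
    by (simp_all add: tmult_def nmon_def nmon_inv_def)
qed

definition Ytpow :: "nat \<Rightarrow> int \<Rightarrow> int \<Rightarrow> mono \<Rightarrow>\<^sub>0 tpoly" where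
  "Ytpow j l u = (if 0 \<le> u then tpower (nmon (Ymon j l)) (nat u)
                  else tpower (nmon_inv (Ymon j l)) (nat (- u)))"

text \<open>
  All factors of the product over $l \in \mathbb{Z}$ are $1$ except for the finitely many $l$
  occurring in $m$. For fixed $l$ the $\tilde Y_{j,l}$ commute; they are multiplied by
  increasing $j$.
\<close>

definition Et :: "nat \<Rightarrow> mono \<Rightarrow> mono \<Rightarrow>\<^sub>0 tpoly" where
  "Et i m = tprod (map (\<lambda>l.
      tmult
        (tpower (tmult (nmon (Ymon i l))
                       (nmon 0 + Poly_Mapping.single (- Amon i (l + int (r i))) (tpow 1)))
                (nat (Poly_Mapping.lookup m (i, l))))
        (tprod (map (\<lambda>j. Ytpow j l (Poly_Mapping.lookup m (j, l)))
                    (filter (\<lambda>j. j \<noteq> i) [1..<Suc n]))))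
     (sorted_list_of_set (snd ` Poly_Mapping.keys m)))"

definition Aprods :: "nat \<Rightarrow> mono set" where
  "Aprods K = {a. \<exists>ps. length ps = K \<and> set ps \<subseteq> I \<times> UNIV \<and>
                       a = sum_list (map (\<lambda>(j, l). - Amon j l) ps)}"

text \<open>
  An element of $\prod_{m \in A} \mathbb{Z}[t^{\pm1}]:\!m\!:$ is its coefficient function
  \<^typ>\<open>mono \<Rightarrow> tpoly\<close>. As the $A_{j,l}$ are algebraically independent, the sets \<open>Aprods K\<close> are
  pairwise disjoint, so that a family of finite sums indexed by $K$ is the same as one function
  whose support meets every \<open>Aprods K\<close> in a finite set.
\<close>

definition A_graded :: "(mono \<Rightarrow> tpoly) \<Rightarrow> bool" where
  "A_graded f \<longleftrightarrow> {a. f a \<noteq> 0} \<subseteq> (\<Union>K. Aprods K) \<and> (\<forall>K. finite ({a. f a \<noteq> 0} \<inter> Aprods K))"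

definition YtA_inf :: "(mono \<Rightarrow> tpoly) set" where
  "YtA_inf = {f. A_graded f}"

text \<open>Left multiplication of a possibly infinite sum by $:\!M\!:$.\<close>

definition lmult :: "mono \<Rightarrow> (mono \<Rightarrow> tpoly) \<Rightarrow> (mono \<Rightarrow> tpoly)" where
  "lmult M f = (\<lambda>m. tpow (N M (m - M)) * f (m - M))"

definition Yt_inf :: "(mono \<Rightarrow> tpoly) set" where
  "Yt_inf = {F. \<exists>S f. finite S \<and> S \<subseteq> monomials \<and> (\<forall>M\<in>S. f M \<in> YtA_inf) \<and>
                      F = (\<lambda>m. \<Sum>M\<in>S. lmult M (f M) m)}"

text \<open>
  In the sum over \<open>a\<close> only finitely many terms contribute to the coefficient of a given \<open>m\<close>, since
  the monomials of $E_{i,t}(Ma)$ are products of $Ma$ and elements $A_{i,l}^{-1}$.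
\<close>

definition Kt_inf_at :: "nat \<Rightarrow> (mono \<Rightarrow> tpoly) set" where
  "Kt_inf_at i = {F \<in> Yt_inf. \<exists>S c. finite S \<and> S \<subseteq> monomials \<and>
     (\<forall>M\<in>S. A_graded (c M) \<and> (\<forall>a. c M a \<noteq> 0 \<longrightarrow> M + a \<in> B {i})) \<and>
     F = (\<lambda>m. \<Sum>M\<in>S. Sum_any (\<lambda>a. c M a * Poly_Mapping.lookup (Et i (M + a)) m))}"

definition Kt_inf :: "(mono \<Rightarrow> tpoly) set" where
  "Kt_inf = (\<Inter>i\<in>I. Kt_inf_at i)"

definition lmon :: "mono \<Rightarrow> mono \<Rightarrow>\<^sub>0 int" where
  "lmon m = Poly_Mapping.single m 1"

definition K_at :: "nat \<Rightarrow> (mono \<Rightarrow>\<^sub>0 int) set" where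
  "K_at i = subring_gen
     ({lmon (Ymon i l) * (1 + lmon (- Amon i (l + int (r i)))) | l. True} \<union>
      {lmon (Ymon j l) | j l. j \<in> I - {i}} \<union> {lmon (- Ymon j l) | j l. j \<in> I - {i}})"

definition K_on :: "nat set \<Rightarrow> (mono \<Rightarrow>\<^sub>0 int) set" where
  "K_on J = (\<Inter>i\<in>J. K_at i)"

definition EY :: "nat set \<Rightarrow> nat \<Rightarrow> int \<Rightarrow> mono \<Rightarrow>\<^sub>0 int" where
  "EY J j l = (THE x. x \<in> K_on J \<and> Poly_Mapping.keys x \<inter> B J = {Ymon j l} \<and>
                      Poly_Mapping.lookup x (Ymon j l) = 1)"

definition E :: "nat set \<Rightarrow> mono \<Rightarrow> mono \<Rightarrow>\<^sub>0 int" where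
  "E J m =
     lmon (\<Sum>p\<in>{p\<in>Poly_Mapping.keys m. fst p \<notin> J}.
             Poly_Mapping.single p (Poly_Mapping.lookup m p)) *
     (\<Prod>p\<in>{p\<in>Poly_Mapping.keys m. fst p \<in> J}.
        EY J (fst p) (snd p) ^ nat (Poly_Mapping.lookup m p))"

definition D :: "mono \<Rightarrow> mono set" where
  "D m = {m' \<in> monomials. \<exists>(R :: nat) s. s 0 = m \<and> s R = m' \<and> (\<forall>k\<le>R. s k \<in> monomials) \<and>
     (\<forall>k\<in>{1..R}. \<exists>k'<k. \<exists>J\<subseteq>I. s k' \<in> B J \<and>
        (\<forall>k''. k' < k'' \<and> k'' \<le> k \<longrightarrow>
           s k'' \<in> Poly_Mapping.keys (E J (s k')) \<and>
           s k'' - s (k'' - 1) \<in> {- Amon j l | j l. j \<in> J}))}"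

definition D_tilde :: "mono \<Rightarrow> (mono \<Rightarrow> tpoly) set" where
  "D_tilde m = {F \<in> Yt_inf. {m'. F m' \<noteq> 0} \<subseteq> D m}"

end

text \<open>
  Finite type is expressed by positive definiteness of the symmetrized matrix $(r_i C_{i,j})$.
\<close>

locale finite_cartan_data = cartan_data +
  assumes diag: "i \<in> I \<Longrightarrow> C i i = 2"
    and off_diag: "i \<in> I \<Longrightarrow> j \<in> I \<Longrightarrow> i \<noteq> j \<Longrightarrow> C i j \<le> 0"
    and zero_sym: "i \<in> I \<Longrightarrow> j \<in> I \<Longrightarrow> C i j = 0 \<longleftrightarrow> C j i = 0"
    and r_pos: "i \<in> I \<Longrightarrow> 0 < r i"
    and symmetrized: "i \<in> I \<Longrightarrow> j \<in> I \<Longrightarrow> int (r i) * C i j = int (r j) * C j i"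
    and r_coprime: "i \<in> I \<Longrightarrow> Gcd (r ` component i) = 1"
    and pos_def: "\<And>x :: nat \<Rightarrow> real. \<exists>i\<in>I. x i \<noteq> 0 \<Longrightarrow>
      0 < (\<Sum>i\<in>I. \<Sum>j\<in>I. real (r i) * of_int (C i j) * x i * x j)"

end

theory Submission
  imports Defs "Jordan_Normal_Form.Determinant"
begin

text \<open>
  Existence: the coefficients of $F_t(m)$ are determined height by height, a nondominant monomial
  $m'$ receiving the coefficient dictated by any node $i$ for which $m'$ is not $i$-dominant. The
  point is that two such nodes $i \<noteq> j$ dictate the same coefficient. This holds as soon as every
  $\{i,j\}$-dominant monomial is the leading monomial of some finite element of
  $\mathfrak{K}_{i,t} \<inter> \mathfrak{K}_{j,t}$ with a nonzero leading coefficient: subtracting multiples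
  of such elements removes everything above $m'$, and then both coefficients vanish. By
  multiplicativity it suffices to have such elements for the $Y_{i,l}$ and the $Y_{j,l}$. In the types
  $A_2$, $B_2$, $G_2$ one fundamental element (of 3, 4, 7 monomials) is written down explicitly, and
  the other node is reached by a $t$-commutator of two shifts of it. That $\mathfrak{K}_{i,t}$
  is closed under multiplication is seen by reordering words in its generators.

  Uniqueness: a monomial of maximal height in the difference of two solutions is $i$-dominant for
  all $i$.

  The condition that all monomials lie in $D_m$ only needs the singletons $J = \{i\}$.
\<close>

text \<open>All commutation rules rest on one identity: \<open>N\<close> pairs a monomial with
  A_{i,l} through its exponents at Y_{i,l-r_i} and Y_{i,l+r_i} alone. This needs (z^{r_i} -
  z^{-r_i}) C_{i,j}(z) to be symmetric in i and j. The obstacle is that C_{i,j}(z) is the quantum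
  integer [C_{i,j}] in z and not in z^{r_i}; the two agree because C_{i,j} < -1 forces r_i = 1. That
  follows from coprimality once positive definiteness, applied to explicit test vectors, has
  excluded two multiple bonds in one component. Heights are values of an additive function that is
  constant and positive on the A_{i,l}; the adjugate of C supplies an integral one. The commutator
  in rank two begins with t^{e-1} - t^{e+1}, which is not a unit. Therefore the comparison of two
  nodes multiplies by leading coefficients and cancels them in a domain. The elements E_{i,t}(p), in
  contrast, begin with a power of t, so the coefficients of F_t(m) can be solved for
  exactly.\<close>

abbreviation lookup :: "('a \<Rightarrow>\<^sub>0 'b :: zero) \<Rightarrow> 'a \<Rightarrow> 'b" where
  "lookup \<equiv> Poly_Mapping.lookup"

abbreviation keys :: "('a \<Rightarrow>\<^sub>0 'b :: zero) \<Rightarrow> 'a set" where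
  "keys \<equiv> Poly_Mapping.keys"

section \<open>Cartan data of finite type\<close>

context finite_cartan_data
begin

definition cform :: "(nat \<Rightarrow> real) \<Rightarrow> real" where
  "cform x = (\<Sum>i\<in>I. \<Sum>j\<in>I. real (r i) * of_int (C i j) * x i * x j)"

lemma symmetrized_real:
  "i \<in> I \<Longrightarrow> j \<in> I \<Longrightarrow> real (r i) * of_int (C i j) = real (r j) * of_int (C j i)"
  using symmetrized[of i j] by (metis of_int_mult of_int_of_nat_eq)

text \<open>Test vectors are assembled vertex by vertex: by symmetry the two cross terms coincide,
  and the diagonal entry 2 gives the quadratic term. The resulting polynomial in \<open>c\<close>
  can be minimized by hand.\<close>

lemma cform_upd:
  assumes "w \<in> I" "x w = 0"
  shows "cform (x(w := c)) =
    cform x + 2 * c * (\<Sum>u\<in>I. real (r u) * of_int (C u w) * x u) + 2 * real (r w) * c\<^sup>2"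
proof -
  let ?b = "\<lambda>i j. real (r i) * of_int (C i j)"
  let ?d = "\<lambda>i. if i = w then c else 0"
  have upd: "(x(w := c)) i = x i + ?d i" for i
    using assms(2) by auto
  have fin: "finite I" by simp
  have "cform (x(w := c)) = (\<Sum>i\<in>I. \<Sum>j\<in>I. ?b i j * x i * x j + ?b i j * x i * ?d j
       + ?b i j * ?d i * x j + ?b i j * ?d i * ?d j)"
    unfolding cform_def upd by (simp add: algebra_simps)
  also have "\<dots> = cform x + (\<Sum>i\<in>I. ?b i w * x i * c) + (\<Sum>j\<in>I. ?b w j * c * x j) + ?b w w * c * c"
  proof -
    have "(\<Sum>i\<in>I. \<Sum>j\<in>I. ?b i j * x i * ?d j) = (\<Sum>i\<in>I. ?b i w * x i * c)"
      using assms(1) by (intro sum.cong refl) (simp add: if_distrib[of "\<lambda>z. _ * z"] cong: if_cong)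
    moreover have "(\<Sum>i\<in>I. \<Sum>j\<in>I. ?b i j * ?d i * x j) = (\<Sum>i\<in>I. if i = w then \<Sum>j\<in>I. ?b w j * c * x j else 0)"
      by (intro sum.cong refl) auto
    moreover have "(\<Sum>i\<in>I. \<Sum>j\<in>I. ?b i j * ?d i * ?d j) = (\<Sum>i\<in>I. if i = w then ?b w w * c * c else 0)"
      using assms(1) by (intro sum.cong refl) (auto simp: if_distrib[of "\<lambda>z. _ * z"] cong: if_cong)
    ultimately show ?thesis
      unfolding sum.distrib cform_def using assms(1) by (simp add: algebra_simps)
  qed
  also have "(\<Sum>j\<in>I. ?b w j * c * x j) = (\<Sum>i\<in>I. ?b i w * x i * c)"
    by (intro sum.cong) (use assms(1) symmetrized_real in \<open>auto simp: mult_ac\<close>)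
  also have "?b w w * c * c = 2 * real (r w) * c\<^sup>2"
    using diag[OF assms(1)] by (simp add: power2_eq_square)
  finally show ?thesis
    by (simp add: sum_distrib_left algebra_simps fun_upd_def flip: sum.distrib)
qed

lemma cform_pos: "i \<in> I \<Longrightarrow> x i \<noteq> 0 \<Longrightarrow> 0 < cform x"
  unfolding cform_def using pos_def[of x] by blast

lemma cform_delta: "w \<in> I \<Longrightarrow> cform ((\<lambda>_. 0)(w := c)) = 2 * real (r w) * c\<^sup>2"
  by (subst cform_upd) (auto simp: cform_def)

lemma offdiag_sum_nonpos:
  assumes "w \<in> I" "x w = 0" "A \<subseteq> I" "\<And>u. 0 \<le> x u"
  shows "(\<Sum>u\<in>A. real (r u) * of_int (C u w) * x u) \<le> 0"
proof (rule sum_nonpos)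
  fix u assume "u \<in> A"
  then have "u = w \<or> C u w \<le> 0" using off_diag[of u w] assms by (metis subsetD)
  then show "real (r u) * of_int (C u w) * x u \<le> 0"
  proof
    assume "C u w \<le> 0"
    then have "real (r u) * of_int (C u w) \<le> 0" by (simp add: mult_nonneg_nonpos)
    then show ?thesis using assms(4)[of u] by (rule mult_nonpos_nonneg)
  qed (simp add: assms(2))
qed

lemma C_prod_less_4:
  assumes "i \<in> I" "j \<in> I" "i \<noteq> j"
  shows "C i j * C j i < 4"
proof -
  \<comment> \<open>For the value 2 at \<open>i\<close>, the value -C_{j,i} at \<open>j\<close>
    minimizes the form, because r_i C_{i,j} = r_j C_{j,i}.\<close>
  define x :: "nat \<Rightarrow> real" where "x = ((\<lambda>_. 0)(i := 2))(j := - of_int (C j i))"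
  have "0 < cform x"
    using assms by (intro cform_pos[of i]) (auto simp: x_def)
  also have "cform x = 8 * real (r i) - 2 * of_int (C j i) * (2 * real (r i) * of_int (C i j))
      + 2 * real (r j) * (of_int (C j i))\<^sup>2"
    unfolding x_def using assms
    by (subst cform_upd) (auto simp: cform_delta if_distrib cong: if_cong)
  also have "2 * real (r j) * (of_int (C j i))\<^sup>2 = 2 * of_int (C j i) * (real (r i) * of_int (C i j))"
    by (subst symmetrized_real) (use assms in \<open>auto simp: power2_eq_square\<close>)
  finally have "0 < real (r i) * (8 - 2 * of_int (C j i) * of_int (C i j))"
    by (simp add: algebra_simps)
  then have "0 < 8 - 2 * (of_int (C j i) * of_int (C i j) :: real)"
    using r_pos[OF assms(1)] by (simp add: zero_less_mult_iff)
  then have "of_int (C i j * C j i) < (of_int 4 :: real)"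
    by (simp add: mult_ac)
  then show ?thesis by linarith
qed

lemma C_cases:
  assumes "i \<in> I" "j \<in> I" "i \<noteq> j" "C i j \<noteq> 0"
  shows "C i j = -1 \<and> C j i \<in> {-1, -2, -3} \<or> C j i = -1 \<and> C i j \<in> {-1, -2, -3}"
proof -
  define a b where "a = - C i j" and "b = - C j i"
  have ab: "a > 0" "b > 0" "a * b < 4"
    using assms off_diag[of i j] off_diag[of j i] zero_sym[of i j] C_prod_less_4[of i j]
    by (auto simp: a_def b_def)
  have "a * 1 \<le> a * b" "1 * b \<le> a * b"
    using ab by (intro mult_mono; simp)+
  then have "a = 1 \<or> a = 2 \<or> a = 3" "b = 1 \<or> b = 2 \<or> b = 3"
    using ab by linarith+
  then have "a = 1 \<and> (b = 1 \<or> b = 2 \<or> b = 3) \<or> b = 1 \<and> (a = 1 \<or> a = 2 \<or> a = 3)"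
    using ab(3) by auto
  then show ?thesis
    unfolding a_def b_def by auto
qed

text \<open>One of the two entries of an edge is -1; the common value r_i C_{i,j} = r_j C_{j,i} is
  then minus the r of that end, which is the larger of the two.\<close>

lemma rC_max:
  assumes "i \<in> I" "j \<in> I" "i \<noteq> j" "C i j \<noteq> 0"
  shows "int (r i) * C i j = - int (max (r i) (r j))"
  using C_cases[OF assms] symmetrized[OF assms(1,2)] by auto

lemma rC_max_real:
  assumes "i \<in> I" "j \<in> I" "i \<noteq> j" "C i j \<noteq> 0"
  shows "real (r i) * of_int (C i j) = - real (max (r i) (r j))"
proof -
  have "of_int (int (r i) * C i j) = (of_int (- int (max (r i) (r j))) :: real)"
    by (simp only: rC_max[OF assms])
  then show ?thesis by simp
qed

text \<open>Across an edge, r is constant or changes by a factor of at least 2. This factor is what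
  lets one such bond lower \<open>cform\<close> by at least \<open>\<rho>\<close>, half of the value
  2 \<open>\<rho>\<close> of a single vertex.\<close>

lemma r_edge_ratio:
  assumes "i \<in> I" "j \<in> I" "C i j \<noteq> 0" "r i < r j"
  shows "2 * r i \<le> r j"
proof -
  have ne: "i \<noteq> j" using assms(4) by auto
  have "int (r i) * C i j = - int (r j)"
    using rC_max[OF assms(1,2) ne assms(3)] assms(4) by simp
  moreover from this have "C i j \<noteq> -1" using assms(4) by auto
  then have "C i j \<le> -2"
    using assms(3) off_diag[OF assms(1,2) ne] by linarith
  then have "int (r i) * C i j \<le> int (r i) * (-2)"
    by (intro mult_left_mono) auto
  ultimately show ?thesis by linarith
qed

text \<open>A chain of equal \<open>r\<close> entered through a multiple bond carries a vector on which the form is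
  at most half of what a single vertex would give; leaving through another multiple bond would
  then make the form nonpositive.\<close>

lemma chain_vector:
  assumes "(u, v) \<in> {(a, b). a \<in> I \<and> b \<in> I \<and> C a b \<noteq> 0 \<and> r a = \<rho> \<and> r b = \<rho>}\<^sup>*"
    and "p \<in> I" "u \<in> I" "C p u \<noteq> 0" "r u = \<rho>" "r p \<noteq> \<rho>"
  shows "v \<in> I \<and> r v = \<rho> \<and> (\<exists>x :: nat \<Rightarrow> real. x v = 1 \<and> (\<forall>w. 0 \<le> x w) \<and> (\<forall>w. w \<noteq> p \<longrightarrow> x w \<in> {0, 1}) \<and>
    (\<forall>w. x w \<noteq> 0 \<longrightarrow> w \<in> I \<and> (r w = \<rho> \<or> w = p)) \<and> cform x \<le> real \<rho>)"
  using assms(1)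
proof (induction rule: rtrancl_induct)
  case base
  define M where "M = real (max (r u) (r p))"
  \<comment> \<open>The minimizer of 2 r_p y^2 - 2 M y.\<close>
  define y where "y = M / (2 * real (r p))"
  define x :: "nat \<Rightarrow> real" where "x = ((\<lambda>_. 0)(u := 1))(p := y)"
  have pu: "p \<noteq> u" using assms by auto
  have rp: "0 < real (r p)" using r_pos assms by auto
  have "real (r u) * of_int (C u p) = - M"
    using rC_max_real[of u p] zero_sym[of u p] assms pu
    by (simp add: M_def)
  then have "cform x = 2 * real \<rho> - 2 * y * M + 2 * real (r p) * y\<^sup>2"
    unfolding x_def using assms pu
    by (subst cform_upd) (auto simp: cform_delta if_distrib cong: if_cong)
  also have "\<dots> = 2 * real \<rho> - M\<^sup>2 / (2 * real (r p))"
    using rp by (simp add: y_def field_simps power2_eq_square)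
  finally have eq: "cform x = 2 * real \<rho> - M\<^sup>2 / (2 * real (r p))" .
  have "M\<^sup>2 / (2 * real (r p)) \<ge> real \<rho>"
  proof -
    have "2 * real \<rho> * real (r p) \<le> M\<^sup>2"
    proof (cases "r p < \<rho>")
      case True
      then have "2 * r p \<le> \<rho>" using r_edge_ratio[of p u] assms by auto
      then have "real (2 * r p) * real \<rho> \<le> real \<rho> * real \<rho>"
        by (intro mult_right_mono) linarith+
      with True show ?thesis using assms by (simp add: M_def power2_eq_square mult_ac)
    next
      case False
      then have "2 * \<rho> \<le> r p" using r_edge_ratio[of u p] zero_sym[of u p] assms by auto
      then have "real (2 * \<rho>) * real (r p) \<le> real (r p) * real (r p)"
        by (intro mult_right_mono) linarith+
      with False show ?thesis using assms by (simp add: M_def power2_eq_square mult_ac)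
    qed
    then show ?thesis using rp by (simp add: field_simps)
  qed
  with eq have "cform x \<le> real \<rho>" by simp
  then show ?case
    using assms pu rp
    by (intro conjI exI[of _ x]) (simp_all, auto simp: x_def y_def M_def)
next
  case (step v w)
  then obtain x where x: "x v = 1" "\<forall>w. 0 \<le> x w" "\<forall>w. w \<noteq> p \<longrightarrow> x w \<in> {0, 1}"
    "\<forall>w. x w \<noteq> 0 \<longrightarrow> w \<in> I \<and> (r w = \<rho> \<or> w = p)" "cform x \<le> real \<rho>" "v \<in> I" "r v = \<rho>"
    by auto
  have w: "w \<in> I" "r w = \<rho>" "C v w \<noteq> 0" "w \<noteq> p" using step.hyps assms by auto
  show ?case
  proof (cases "x w = 0")
    case False
    then show ?thesis using w x by (intro conjI exI[of _ x]) auto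
  next
    case True
    have vw: "v \<noteq> w" using True x by auto
    \<comment> \<open>Appending \<open>w\<close> with value 1 costs 2 \<open>\<rho>\<close>, and the
      edge from \<open>v\<close> alone gives this back; all further edges can only lower the
      form.\<close>
    have "(\<Sum>u\<in>I. real (r u) * of_int (C u w) * x u) \<le> (\<Sum>u\<in>{v}. real (r u) * of_int (C u w) * x u)"
    proof -
      have "(\<Sum>u\<in>I - {v}. real (r u) * of_int (C u w) * x u) \<le> 0"
        using x True w by (intro offdiag_sum_nonpos) auto
      then show ?thesis
        using x(6) sum.remove[of I v "\<lambda>u. real (r u) * of_int (C u w) * x u"] by simp
    qed
    also have "\<dots> = - real \<rho>"
      using rC_max_real[of v w] w x vw by simp
    finally have "cform (x(w := 1)) \<le> real \<rho>"
      using x w True by (subst cform_upd) auto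
    then show ?thesis
      using x w vw
      by (intro conjI exI[of _ "x(w := 1)"]) (simp_all only: fun_upd_same fun_upd_other not_False_eq_True, auto)
  qed
qed

text \<open>With the minimizing value at \<open>w\<close>, the vector of \<open>chain_vector\<close>
  loses another \<open>\<rho>\<close>, so the form is at most 0 although the value at
  \<open>v\<close> is 1. The vertex \<open>p\<close> through which the chain was entered has to be
  excluded as exit, since its value is already in use.\<close>

lemma chain_no_exit:
  assumes "(u, v) \<in> {(a, b). a \<in> I \<and> b \<in> I \<and> C a b \<noteq> 0 \<and> r a = \<rho> \<and> r b = \<rho>}\<^sup>*"
    and "p \<in> I" "u \<in> I" "C p u \<noteq> 0" "r u = \<rho>" "r p \<noteq> \<rho>"
    and "w \<in> I" "C v w \<noteq> 0" "r w \<noteq> \<rho>" "w \<noteq> p"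
  shows False
proof -
  obtain x where x: "x v = 1" "\<forall>w. 0 \<le> x w" "\<forall>w. w \<noteq> p \<longrightarrow> x w \<in> {0, 1::real}"
    "\<forall>w. x w \<noteq> 0 \<longrightarrow> w \<in> I \<and> (r w = \<rho> \<or> w = p)" "cform x \<le> real \<rho>" "v \<in> I" "r v = \<rho>"
    using chain_vector[OF assms(1-6)] by auto
  have xw: "x w = 0" using x assms by blast
  have vw: "v \<noteq> w" using x assms by auto
  define M where "M = real (max (r v) (r w))"
  define y where "y = M / (2 * real (r w))"
  have rw: "0 < real (r w)" using r_pos assms by auto
  have y: "y > 0" using rw by (auto simp: y_def M_def)
  have "(\<Sum>u\<in>I - {v}. real (r u) * of_int (C u w) * x u) \<le> 0"
    using x xw assms
    by (intro offdiag_sum_nonpos) auto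
  moreover have "real (r v) * of_int (C v w) = - M"
    using rC_max_real[of v w] assms x vw by (simp add: M_def)
  ultimately have s: "(\<Sum>u\<in>I. real (r u) * of_int (C u w) * x u) \<le> - M"
    using x(1,6) sum.remove[of I v "\<lambda>u. real (r u) * of_int (C u w) * x u"] by simp
  have "cform (x(w := y)) \<le> real \<rho> + 2 * y * (- M) + 2 * real (r w) * y\<^sup>2"
    using x(5) mult_left_mono[OF s, of "2 * y"] y by (subst cform_upd[where x = x and w = w, OF assms(7) xw]) linarith
  also have "\<dots> = real \<rho> - M\<^sup>2 / (2 * real (r w))"
    using rw by (simp add: y_def field_simps power2_eq_square)
  finally have le: "cform (x(w := y)) \<le> real \<rho> - M\<^sup>2 / (2 * real (r w))" .
  have "M\<^sup>2 / (2 * real (r w)) \<ge> real \<rho>"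
  proof -
    have "2 * real \<rho> * real (r w) \<le> M\<^sup>2"
    proof (cases "r w < \<rho>")
      case True
      then have "2 * r w \<le> \<rho>" using r_edge_ratio[of w v] zero_sym[of w v] assms x by auto
      then have "real (2 * r w) * real \<rho> \<le> real \<rho> * real \<rho>"
        by (intro mult_right_mono) linarith+
      with True show ?thesis using x by (simp add: M_def power2_eq_square mult_ac)
    next
      case False
      then have "2 * \<rho> \<le> r w" using r_edge_ratio[of v w] assms x by auto
      then have "real (2 * \<rho>) * real (r w) \<le> real (r w) * real (r w)"
        by (intro mult_right_mono) linarith+
      with False show ?thesis using x by (simp add: M_def power2_eq_square mult_ac)
    qed
    then show ?thesis using rw by (simp add: field_simps)
  qed
  with le have "cform (x(w := y)) \<le> 0" by simp
  moreover have "cform (x(w := y)) > 0"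
    using x vw by (intro cform_pos[of v]) auto
  ultimately show False by simp
qed

text \<open>At the given bond r_i divides r_j. Walking from \<open>i\<close> through its component,
  every stretch of constant r has been entered from a vertex \<open>p\<close> whose r is a multiple
  of r_i, and by \<open>chain_no_exit\<close> it can only be left through \<open>p\<close>. Hence
  r_i divides every r of the component, and coprimality gives 1.\<close>

lemma r_eq_1_if_multiple:
  assumes "i \<in> I" "j \<in> I" "C i j < -1"
  shows "r i = 1"
proof -
  define \<rho> where "\<rho> = r i"
  have ij: "i \<noteq> j" using assms diag by auto
  have C: "C j i = -1" "C i j \<in> {-2, -3}"
    using C_cases[of i j] assms ij by auto
  then have rj: "int (r j) = - C i j * int (r i)"
    using symmetrized[OF assms(1,2)] by (simp add: algebra_simps)
  have "int (r i) dvd int (r j)"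
    unfolding rj by simp
  then have dvdj: "\<rho> dvd r j"
    by (simp add: \<rho>_def)
  have "int (r j) \<noteq> int (r i)"
    using rj C(2) r_pos[OF assms(1)] by auto
  then have nej: "r j \<noteq> r i" by simp
  let ?R = "\<lambda>\<rho>. {(a, b). a \<in> I \<and> b \<in> I \<and> C a b \<noteq> 0 \<and> r a = \<rho> \<and> r b = \<rho>}"
  \<comment> \<open>The invariant remembers the current stretch: its entrance \<open>p\<close>, its
    first vertex \<open>u\<close> and a path of constant r from \<open>u\<close> to
    \<open>v\<close>. The initial stretch is \<open>i\<close>, entered from
    \<open>j\<close>.\<close>
  have step: "\<rho> dvd r v \<and> (\<exists>p u. p \<in> I \<and> u \<in> I \<and> C p u \<noteq> 0 \<and> r p \<noteq> r u \<and> \<rho> dvd r p \<and> r u = r v \<and>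
      (u, v) \<in> (?R (r v))\<^sup>*)"
    if "(i, v) \<in> {(a, b). a \<in> I \<and> b \<in> I \<and> C a b \<noteq> 0}\<^sup>*" for v
    using that
  proof (induction rule: rtrancl_induct)
    case base
    show ?case using assms C nej dvdj
      by (intro conjI exI[of _ j] exI[of _ i]) (auto simp: \<rho>_def)
  next
    case (step v w)
    then have vw: "v \<in> I" "w \<in> I" "C v w \<noteq> 0" by auto
    obtain p u where pu: "p \<in> I" "u \<in> I" "C p u \<noteq> 0" "r p \<noteq> r u" "\<rho> dvd r p" "r u = r v"
      "(u, v) \<in> (?R (r v))\<^sup>*" and dv: "\<rho> dvd r v"
      using step.IH by auto
    show ?case
    proof (cases "r w = r v")
      case True
      then have "(v, w) \<in> ?R (r v)" using vw by auto
      then have "(u, w) \<in> (?R (r v))\<^sup>*" using pu(7) by (rule rtrancl_into_rtrancl[rotated])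
      then show ?thesis using True pu dv by (intro conjI exI[of _ p] exI[of _ u]) simp_all
    next
      case False
      have "\<rho> dvd r w"
      proof (rule ccontr)
        assume n: "\<not> \<rho> dvd r w"
        show False
          by (rule chain_no_exit[OF pu(7) pu(1,2,3,6) _ vw(2,3) False])
            (use pu n in auto)
      qed
      then show ?thesis
        using vw False dv by (intro conjI exI[of _ v] exI[of _ w]) auto
    qed
  qed
  have "\<rho> dvd Gcd (r ` component i)"
    by (rule Gcd_greatest) (use step in \<open>auto simp: component_def\<close>)
  then show ?thesis
    using r_coprime[OF assms(1)] by (simp add: \<rho>_def)
qed

end

section \<open>The inverse of the quantized Cartan matrix\<close>

lemma zpow_mult: "zpow a * zpow b = zpow (a + b)"
  unfolding zpow_def by (subst fls_X_intpow_times_fls_X_intpow) (simp add: algebra_simps)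

lemma zpow_0: "zpow 0 = 1"
  by (simp add: zpow_def)

lemma zcoeff_zpow: "zcoeff (zpow a) s = of_bool (s = a)"
  by (auto simp: zcoeff_def zpow_def)

lemma zcoeff_zpow_mult: "zcoeff (zpow a * f) s = zcoeff f (s - a)"
  unfolding zcoeff_def zpow_def fls_X_intpow_times_conv_shift by (simp add: algebra_simps)

lemma zcoeff_add: "zcoeff (f + g) s = zcoeff f s + zcoeff g s"
  and zcoeff_diff: "zcoeff (f - g) s = zcoeff f s - zcoeff g s"
  and zcoeff_uminus: "zcoeff (- f) s = - zcoeff f s"
  and zcoeff_0: "zcoeff 0 s = 0"
  and zcoeff_1: "zcoeff 1 s = of_bool (s = 0)"
  by (auto simp: zcoeff_def)

lemma zcoeff_eqI:
  assumes "\<And>s. zcoeff f s = zcoeff g s" shows "f = g"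
proof (rule fls_eqI)
  show "fls_nth f k = fls_nth g k" for k using assms[of "- k"] by (simp add: zcoeff_def)
qed

lemma zcoeff_sum: "zcoeff (\<Sum>x\<in>A. f x) s = (\<Sum>x\<in>A. zcoeff (f x) s)"
  by (induction A rule: infinite_finite_induct) (auto simp: zcoeff_add zcoeff_0)

text \<open>A first factor with finitely many coefficients is a finite sum of multiples of powers of
  z, each of which shifts \<open>g\<close>; the second factor may be infinite in the direction of
  z^{-1}.\<close>

lemma zcoeff_mult:
  assumes "finite T" "\<And>s. s \<notin> T \<Longrightarrow> zcoeff f s = 0"
  shows "zcoeff (f * g) t = (\<Sum>s\<in>T. zcoeff f s * zcoeff g (t - s))"
proof -
  have "zcoeff f s = zcoeff (\<Sum>x\<in>T. fls_const (zcoeff f x) * zpow x) s" for s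
  proof -
    have "zcoeff (fls_const (zcoeff f x) * zpow x) s = (if x = s then zcoeff f x else 0)" for x
      using zcoeff_zpow[of x s] by (auto simp: zcoeff_def)
    then show ?thesis using assms by (auto simp: zcoeff_sum)
  qed
  then have "f = (\<Sum>x\<in>T. fls_const (zcoeff f x) * zpow x)"
    by (rule zcoeff_eqI)
  then have "f * g = (\<Sum>x\<in>T. fls_const (zcoeff f x) * (zpow x * g))"
    by (metis (no_types, lifting) mult.assoc sum.cong sum_distrib_right)
  then have "zcoeff (f * g) t = (\<Sum>x\<in>T. zcoeff (fls_const (zcoeff f x) * (zpow x * g)) t)"
    by (simp only: zcoeff_sum)
  also have "\<dots> = (\<Sum>x\<in>T. zcoeff f x * zcoeff (zpow x * g) t)"
    by (simp add: zcoeff_def)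
  finally show ?thesis by (simp add: zcoeff_zpow_mult)
qed

lemma unit_fps_if_nth_0_eq_1:
  fixes f :: "'a :: comm_ring_1 fps"
  assumes "fps_nth f 0 = 1"
  shows "\<exists>g. f * g = 1"
  using fps_right_inverse[of f 1] assms by auto

lemma det_fps_nth_0:
  fixes M :: "'a :: comm_ring_1 fps mat"
  shows "fps_nth (det M) 0 = det (map_mat (\<lambda>f. fps_nth f 0) M)"
proof -
  interpret comm_ring_hom "\<lambda>f :: 'a fps. fps_nth f 0"
    by unfold_locales auto
  show ?thesis by (rule hom_det[symmetric])
qed

context finite_cartan_data
begin

lemma C_values:
  assumes "i \<in> I" "j \<in> I"
  shows "i = j \<and> C i j = 2 \<or> i \<noteq> j \<and> C i j \<in> {0, -1, -2, -3}"
  using C_cases[OF assms] diag[of i] assms by auto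

lemma zcoeff_Cz:
  assumes "i \<in> I" "j \<in> I"
  shows "zcoeff (Cz i j) s = (if i = j then of_bool (s = int (r i)) + of_bool (s = - int (r i))
    else if C i j = -1 then - of_bool (s = 0)
    else if C i j = -2 then - (of_bool (s = 1) + of_bool (s = -1))
    else if C i j = -3 then - (of_bool (s = 2) + of_bool (s = 0) + of_bool (s = -2)) else 0)"
  using C_values[OF assms]
  by (auto simp: Cz_def qint_def zcoeff_add zcoeff_diff zcoeff_zpow zcoeff_uminus zcoeff_0 zcoeff_1 zpow_0
      numeral_2_eq_2 numeral_3_eq_3 lessThan_Suc)

lemma zcoeff_Cz_minus:
  assumes "i \<in> I" "j \<in> I"
  shows "zcoeff (Cz i j) (- s) = zcoeff (Cz i j) s"
  unfolding zcoeff_Cz[OF assms] by (auto simp: of_bool_def)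

text \<open>A range of exponents common to all entries: the sum of the r dominates the diagonal, the
  summand 2 dominates [-3]_z = -(z^2 + 1 + z^{-2}).\<close>

definition Cz_bound :: int where
  "Cz_bound = int (\<Sum>i\<in>I. r i) + 2"

lemma zcoeff_Cz_eq_0:
  assumes "i \<in> I" "j \<in> I" "s \<notin> {- Cz_bound..Cz_bound}"
  shows "zcoeff (Cz i j) s = 0"
proof -
  have "r i \<le> (\<Sum>i\<in>I. r i)" using assms by (intro member_le_sum) auto
  then have "int (r i) + 2 \<le> Cz_bound"
    unfolding Cz_bound_def by linarith
  then show ?thesis
    using assms(3) unfolding zcoeff_Cz[OF assms(1,2)] by auto
qed

definition zdiff :: "int \<Rightarrow> int fls" where
  "zdiff a = zpow a - zpow (- a)"

lemma zdiff_nonzero: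
  assumes "a \<noteq> 0" shows "zdiff a \<noteq> 0"
proof
  assume "zdiff a = 0"
  then have "zcoeff (zdiff a) a = 0" by (simp add: zcoeff_0)
  then show False using assms by (simp add: zdiff_def zcoeff_diff zcoeff_zpow)
qed

text \<open>The off-diagonal entries are quantum integers in z, whereas the factor is adapted to
  z^{r_i}. For the entries 0 and -1 this makes no difference, and for smaller entries
  \<open>r_eq_1_if_multiple\<close> gives z^{r_i} = z.\<close>

lemma zdiff_mult_Cz:
  assumes "i \<in> I" "j \<in> I"
  shows "zdiff (int (r i)) * Cz i j = zdiff (int (r i) * C i j)"
proof -
  consider "i = j" | "i \<noteq> j" "C i j = 0" | "i \<noteq> j" "C i j = -1" | "i \<noteq> j" "C i j < -1"
    using C_values[OF assms] by auto
  then show ?thesis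
  proof cases
    case 1
    then show ?thesis
      using diag[OF assms(1)]
      by (simp add: Cz_def zdiff_def algebra_simps zpow_mult)
  next
    case 4
    then have "r i = 1" using r_eq_1_if_multiple assms by auto
    with 4 show ?thesis using qint_mult[of "C i j"] by (simp add: Cz_def zdiff_def mult_ac)
  qed (auto simp: Cz_def zdiff_def qint_def zpow_0)
qed

lemma zdiff_Cz_sym:
  assumes "i \<in> I" "j \<in> I"
  shows "zdiff (int (r i)) * Cz i j = zdiff (int (r j)) * Cz j i"
  using symmetrized[OF assms] assms by (simp add: zdiff_mult_Cz)

text \<open>The symmetrized matrix, rescaled on both sides so that it becomes the identity modulo
  $z^{-1}$.\<close>

definition Cfps :: "nat \<Rightarrow> nat \<Rightarrow> int fps" where
  "Cfps i j = (if i = j then 1 - fps_X ^ (4 * r i) else if C i j = 0 then 0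
     else fps_X ^ (max (r i) (r j) + r i + r j) - fps_X ^ (min (r i) (r j)))"

lemma fps_to_fls_X_power: "fps_to_fls (fps_X ^ k) = zpow (- int k)"
  by (simp add: zpow_def fps_to_fls_power fls_X_power_conv_shift_1)

lemma Cfps:
  assumes "i \<in> I" "j \<in> I"
  shows "fps_to_fls (Cfps i j) = zpow (- int (r i)) * (zdiff (int (r i)) * Cz i j) * zpow (- int (r j))"
proof -
  let ?a = "int (r i)" and ?b = "int (r j)"
  have eq: "zpow (- ?a) * (zdiff (?a) * Cz i j) * zpow (- ?b)
      = zpow (?a * C i j - ?a - ?b) - zpow (- (?a * C i j) - ?a - ?b)"
    unfolding zdiff_mult_Cz[OF assms]
  proof -
    have "- ?a + ?a * C i j + - ?b = ?a * C i j - ?a - ?b"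
      "- ?a + - (?a * C i j) + - ?b = - (?a * C i j) - ?a - ?b" by simp_all
    then show "zpow (- ?a) * zdiff (?a * C i j) * zpow (- ?b)
      = zpow (?a * C i j - ?a - ?b) - zpow (- (?a * C i j) - ?a - ?b)"
      by (simp only: zdiff_def left_diff_distrib right_diff_distrib zpow_mult)
  qed
  consider "i = j" | "i \<noteq> j" "C i j = 0" | "i \<noteq> j" "C i j \<noteq> 0" by blast
  then show ?thesis
  proof cases
    case 1
    then show ?thesis
      unfolding eq using diag[OF assms(1)] by (simp add: Cfps_def fps_to_fls_X_power zpow_0)
  next
    case 2
    then show ?thesis unfolding eq by (simp add: Cfps_def)
  next
    case 3
    have "?a * C i j - ?a - ?b = - int (max (r i) (r j) + r i + r j)"
      "- (?a * C i j) - ?a - ?b = - int (min (r i) (r j))"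
      using rC_max[OF assms 3] by auto
    then show ?thesis
      unfolding eq using 3 by (simp only: Cfps_def fps_to_fls_X_power fps_to_fls_minus if_False)
  qed
qed

lemma Cfps_nth_0:
  assumes "i \<in> I" "j \<in> I"
  shows "fps_nth (Cfps i j) 0 = of_bool (i = j)"
  using r_pos[OF assms(1)] r_pos[OF assms(2)] by (auto simp: Cfps_def)

text \<open>Modulo the variable the matrix is the identity, so its determinant has constant
  coefficient 1 and is a unit among the power series over the integers. The adjugate divided by it
  is an integral inverse.\<close>

lemma Cfps_inverse:
  "\<exists>Q. (\<forall>i\<in>I. \<forall>j\<in>I. (\<Sum>k\<in>I. Cfps i k * Q k j) = of_bool (i = j) \<and>
                     (\<Sum>k\<in>I. Q i k * Cfps k j) = of_bool (i = j))"
proof -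
  define M where "M = mat n n (\<lambda>(i, j). Cfps (Suc i) (Suc j))"
  have M: "M \<in> carrier_mat n n" by (simp add: M_def)
  have "map_mat (\<lambda>f. fps_nth f 0) M = 1\<^sub>m n"
    by (intro eq_matI) (auto simp: M_def Cfps_nth_0)
  then have "fps_nth (det M) 0 = 1"
    by (simp add: det_fps_nth_0)
  then obtain u where u: "det M * u = 1"
    using unit_fps_if_nth_0_eq_1 by blast
  define A where "A = adj_mat M"
  have A: "A \<in> carrier_mat n n" "M * A = det M \<cdot>\<^sub>m 1\<^sub>m n" "A * M = det M \<cdot>\<^sub>m 1\<^sub>m n"
    unfolding A_def using adj_mat[OF M] by auto
  define Q where "Q i j = u * A $$ (i - 1, j - 1)" for i j
  have sumI: "(\<Sum>k\<in>I. f k) = (\<Sum>k = 0..<n. f (Suc k))" for f :: "nat \<Rightarrow> int fps"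
    using sum.atLeast1_atMost_eq[of f n] by (simp add: atLeast0LessThan)
  have "(\<Sum>k\<in>I. Cfps i k * Q k j) = of_bool (i = j) \<and> (\<Sum>k\<in>I. Q i k * Cfps k j) = of_bool (i = j)"
    if "i \<in> I" "j \<in> I" for i j
  proof
    define i' j' where "i' = i - 1" and "j' = j - 1"
    then have i: "i = Suc i'" "i' < n" and j: "j = Suc j'" "j' < n" using that by auto
    have "(\<Sum>k\<in>I. Cfps i k * Q k j) = u * (\<Sum>k = 0..<n. M $$ (i', k) * A $$ (k, j'))"
      unfolding sumI sum_distrib_left by (intro sum.cong) (auto simp: Q_def M_def i j mult_ac)
    also have "(\<Sum>k = 0..<n. M $$ (i', k) * A $$ (k, j')) = (M * A) $$ (i', j')"
      using M A(1) i j by (simp add: scalar_prod_def)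
    finally show "(\<Sum>k\<in>I. Cfps i k * Q k j) = of_bool (i = j)"
      using i j u by (auto simp: A(2) mult_ac)
    have "(\<Sum>k\<in>I. Q i k * Cfps k j) = u * (\<Sum>k = 0..<n. A $$ (i', k) * M $$ (k, j'))"
      unfolding sumI sum_distrib_left by (intro sum.cong) (auto simp: Q_def M_def i j mult_ac)
    also have "(\<Sum>k = 0..<n. A $$ (i', k) * M $$ (k, j')) = (A * M) $$ (i', j')"
      using M A(1) i j by (simp add: scalar_prod_def)
    finally show "(\<Sum>k\<in>I. Q i k * Cfps k j) = of_bool (i = j)"
      using i j u by (auto simp: A(3) mult_ac)
  qed
  then show ?thesis by blast
qed

lemma fps_to_fls_sum: "fps_to_fls (\<Sum>x\<in>A. f x) = (\<Sum>x\<in>A. fps_to_fls (f x))"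
  by (induction A rule: infinite_finite_induct) auto

lemma Cz_inv_exists:
  "\<exists>X. (\<forall>i\<in>I. \<forall>j\<in>I. (\<Sum>k\<in>I. Cz i k * X k j) = of_bool (i = j) \<and>
                     (\<Sum>k\<in>I. X i k * Cz k j) = of_bool (i = j)) \<and>
      (\<forall>i j. i \<notin> I \<or> j \<notin> I \<longrightarrow> X i j = 0)"
proof -
  obtain Q where Q: "\<And>i j. i \<in> I \<Longrightarrow> j \<in> I \<Longrightarrow> (\<Sum>k\<in>I. Cfps i k * Q k j) = of_bool (i = j)"
    "\<And>i j. i \<in> I \<Longrightarrow> j \<in> I \<Longrightarrow> (\<Sum>k\<in>I. Q i k * Cfps k j) = of_bool (i = j)"
    using Cfps_inverse by blast
  define z where "z i = zpow (int (r i))" for i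
  define y where "y i = zpow (- int (r i))" for i
  define a where "a i = zdiff (int (r i))" for i
  \<comment> \<open>Obtained by inverting a_i C_{i,j} = z_i P_{i,j} z_j, where P is
    \<open>Cfps\<close> with inverse Q. The factor a is never inverted: in the check of C X = 1 it
    is cancelled as a nonzero element of a domain.\<close>
  define X where "X i j = (if i \<in> I \<and> j \<in> I then y i * fps_to_fls (Q i j) * y j * a j else 0)" for i j
  have zy: "y i * z i = 1" "z i * y i = 1" for i
    by (simp_all add: z_def y_def zpow_mult zpow_0)
  have C: "a i * Cz i j = z i * fps_to_fls (Cfps i j) * z j" if "i \<in> I" "j \<in> I" for i j
  proof -
    have "z i * fps_to_fls (Cfps i j) * z j = (z i * y i) * (a i * Cz i j) * (y j * z j)"
      unfolding Cfps[OF that] by (simp add: y_def a_def mult_ac)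
    then show ?thesis by (simp add: zy)
  qed
  have "(\<Sum>k\<in>I. Cz i k * X k j) = of_bool (i = j)" if ij: "i \<in> I" "j \<in> I" for i j
  proof -
    have "a i * (\<Sum>k\<in>I. Cz i k * X k j) = (\<Sum>k\<in>I. z i * fps_to_fls (Cfps i k * Q k j) * y j * a j)"
      unfolding sum_distrib_left
    proof (intro sum.cong refl)
      fix k assume k: "k \<in> I"
      have "a i * (Cz i k * X k j) = (a i * Cz i k) * (y k * fps_to_fls (Q k j) * y j * a j)"
        using k ij by (simp add: X_def mult_ac)
      also have "\<dots> = z i * fps_to_fls (Cfps i k) * (z k * y k) * fps_to_fls (Q k j) * y j * a j"
        unfolding C[OF ij(1) k] by (simp only: mult_ac)
      finally show "a i * (Cz i k * X k j) = z i * fps_to_fls (Cfps i k * Q k j) * y j * a j"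
        by (simp add: zy fls_times_fps_to_fls mult_ac)
    qed
    also have "\<dots> = z i * fps_to_fls (\<Sum>k\<in>I. Cfps i k * Q k j) * y j * a j"
      unfolding fps_to_fls_sum sum_distrib_left sum_distrib_right ..
    also have "\<dots> = a i * of_bool (i = j)"
      unfolding Q(1)[OF ij] by (auto simp: zy)
    finally show ?thesis
      using r_pos[OF ij(1)] zdiff_nonzero[of "int (r i)"] by (auto simp: a_def)
  qed
  moreover have "(\<Sum>k\<in>I. X i k * Cz k j) = of_bool (i = j)" if ij: "i \<in> I" "j \<in> I" for i j
  proof -
    have "(\<Sum>k\<in>I. X i k * Cz k j) = (\<Sum>k\<in>I. y i * fps_to_fls (Q i k * Cfps k j) * z j)"
    proof (intro sum.cong refl)
      fix k assume k: "k \<in> I"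
      have "X i k * Cz k j = y i * fps_to_fls (Q i k) * y k * (a k * Cz k j)"
        using k ij by (simp add: X_def mult_ac)
      also have "\<dots> = y i * fps_to_fls (Q i k) * (y k * z k) * fps_to_fls (Cfps k j) * z j"
        unfolding C[OF k ij(2)] by (simp only: mult_ac)
      finally show "X i k * Cz k j = y i * fps_to_fls (Q i k * Cfps k j) * z j"
        by (simp add: zy fls_times_fps_to_fls mult_ac)
    qed
    also have "\<dots> = y i * fps_to_fls (\<Sum>k\<in>I. Q i k * Cfps k j) * z j"
      unfolding fps_to_fls_sum sum_distrib_left sum_distrib_right ..
    also have "\<dots> = of_bool (i = j)"
      unfolding Q(2)[OF ij] by (auto simp: zy)
    finally show ?thesis .
  qed
  ultimately show ?thesis
    by (intro exI[of _ X]) (auto simp: X_def)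
qed

text \<open>The definite description is justified as usual: a left inverse agrees with every right
  inverse, and the values outside the index set are prescribed.\<close>

lemma Cz_inv:
  "(\<forall>i\<in>I. \<forall>j\<in>I. (\<Sum>k\<in>I. Cz i k * Cz_inv k j) = of_bool (i = j) \<and>
                     (\<Sum>k\<in>I. Cz_inv i k * Cz k j) = of_bool (i = j)) \<and>
      (\<forall>i j. i \<notin> I \<or> j \<notin> I \<longrightarrow> Cz_inv i j = 0)"
proof -
  obtain X where X: "\<And>i j. i \<in> I \<Longrightarrow> j \<in> I \<Longrightarrow> (\<Sum>k\<in>I. Cz i k * X k j) = of_bool (i = j)"
    "\<And>i j. i \<in> I \<Longrightarrow> j \<in> I \<Longrightarrow> (\<Sum>k\<in>I. X i k * Cz k j) = of_bool (i = j)"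
    "\<And>i j. i \<notin> I \<or> j \<notin> I \<Longrightarrow> X i j = 0"
    using Cz_inv_exists by blast
  have uniq: "Z = X" if Z: "\<forall>i\<in>I. \<forall>j\<in>I. (\<Sum>k\<in>I. Cz i k * Z k j) = of_bool (i = j)"
    "\<forall>i j. i \<notin> I \<or> j \<notin> I \<longrightarrow> Z i j = 0" for Z
  proof (intro ext)
    fix i j
    show "Z i j = X i j"
    proof (cases "i \<in> I \<and> j \<in> I")
      case True
      have "X i j = (\<Sum>k\<in>I. X i k * of_bool (k = j))"
        using True by (simp add: of_bool_def if_distrib[of "\<lambda>x. _ * x"] cong: if_cong)
      also have "\<dots> = (\<Sum>k\<in>I. X i k * (\<Sum>l\<in>I. Cz k l * Z l j))"
        using Z(1) True by (intro sum.cong) auto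
      also have "\<dots> = (\<Sum>l\<in>I. (\<Sum>k\<in>I. X i k * Cz k l) * Z l j)"
        unfolding sum_distrib_left sum_distrib_right by (subst sum.swap) (simp only: mult.assoc)
      also have "\<dots> = (\<Sum>l\<in>I. of_bool (i = l) * Z l j)"
        using X(2) True by (intro sum.cong) auto
      also have "\<dots> = Z i j"
        using True by (simp add: of_bool_def if_distrib[of "\<lambda>x. x * _"] cong: if_cong)
      finally show ?thesis by simp
    next
      case False
      then show ?thesis using Z(2) X(3) by auto
    qed
  qed
  show ?thesis
    unfolding Cz_inv_def
  proof (rule theI[where a = X], goal_cases)
    case 1 show ?case using X by blast
  next
    case (2 Z) then show ?case by (intro uniq) blast+
  qed
qed

end

section \<open>The form N and the height\<close>

lemma sum_keys_eq:
  fixes f :: "'a \<Rightarrow> int \<Rightarrow> 'b :: comm_monoid_add"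
  assumes "finite S" "keys m \<subseteq> S" "\<And>p. f p 0 = 0"
  shows "(\<Sum>p\<in>keys m. f p (lookup m p)) =
    (\<Sum>p\<in>S. f p (lookup m p))"
  using assms by (intro sum.mono_neutral_left) (auto simp: in_keys_iff)

lemma keys_diff_subset:
  "keys (a - b) \<subseteq> keys a \<union> keys (b :: 'a \<Rightarrow>\<^sub>0 'b :: ab_group_add)"
  by (auto simp: in_keys_iff lookup_minus)

context cartan_data
begin

lemma N_superset:
  assumes "finite S" "finite T" "keys a \<subseteq> S" "keys b \<subseteq> T"
  shows "N a b = (\<Sum>p\<in>S. \<Sum>q\<in>T. lookup a p * lookup b q * Nvar p q)"
proof -
  have "N a b = (\<Sum>p\<in>keys a. \<Sum>q\<in>T. lookup a p * lookup b q * Nvar p q)"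
    unfolding N_def using assms by (intro sum.cong refl sum.mono_neutral_left) (auto simp: in_keys_iff)
  also have "\<dots> = (\<Sum>p\<in>S. \<Sum>q\<in>T. lookup a p * lookup b q * Nvar p q)"
    using assms by (intro sum.mono_neutral_left) (auto simp: in_keys_iff)
  finally show ?thesis .
qed

lemma N_add_left: "N (a + b) c = N a c + N b c"
  using Poly_Mapping.keys_add[of a b]
  by (subst (1 2 3) N_superset[of "keys a \<union> keys b" "keys c"])
    (auto simp: lookup_add algebra_simps sum.distrib)

lemma N_add_right: "N a (b + c) = N a b + N a c"
  using Poly_Mapping.keys_add[of b c]
  by (subst (1 2 3) N_superset[of "keys a" "keys b \<union> keys c"])
    (auto simp: lookup_add algebra_simps sum.distrib)

lemma N_0: "N 0 a = 0" "N a 0 = 0"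
  by (auto simp: N_def)

lemma N_uminus: "N (- a) b = - N a b" "N a (- b) = - N a b"
  using N_add_left[of a "- a" b] N_add_right[of a b "- b"] by (auto simp: N_0)

lemma N_diff: "N (a - b) c = N a c - N b c" "N a (b - c) = N a b - N a c"
  using N_add_left[of a "- b" c] N_add_right[of a b "- c"] by (auto simp: N_uminus)

lemmas N_simps = N_add_left N_add_right N_0 N_uminus N_diff

lemma monomials_0: "0 \<in> monomials"
  by (simp add: monomials_def)

lemma monomials_add: "a \<in> monomials \<Longrightarrow> b \<in> monomials \<Longrightarrow> a + b \<in> monomials"
  unfolding monomials_def using Poly_Mapping.keys_add[of a b] by blast

lemma monomials_diff: "a \<in> monomials \<Longrightarrow> b \<in> monomials \<Longrightarrow> a - b \<in> monomials"
  unfolding monomials_def using keys_diff_subset[of a b] by blast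

lemma monomials_uminus: "a \<in> monomials \<Longrightarrow> - a \<in> monomials"
  using monomials_diff[OF monomials_0] by auto

lemma monomials_sum: "(\<And>x. x \<in> S \<Longrightarrow> f x \<in> monomials) \<Longrightarrow> (\<Sum>x\<in>S. f x) \<in> monomials"
  by (induction S rule: infinite_finite_induct) (auto simp: monomials_0 monomials_add)

lemma monomials_Ymon: "i \<in> I \<Longrightarrow> Ymon i l \<in> monomials"
  by (auto simp: monomials_def Ymon_def)

lemma monomials_Amon: "i \<in> I \<Longrightarrow> Amon i l \<in> monomials"
  unfolding Amon_def
  by (intro monomials_diff monomials_add monomials_sum monomials_Ymon) auto

lemma lookup_Ymon: "lookup (Ymon i l) (j, k) = of_bool (i = j \<and> l = k)"
  by (auto simp: Ymon_def lookup_single when_def)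

lemma lookup_notin_monomials: "m \<in> monomials \<Longrightarrow> i \<notin> I \<Longrightarrow> lookup m (i, l) = 0"
  unfolding monomials_def by (auto simp: in_keys_iff)

end

context finite_cartan_data
begin

text \<open>The three products in \<open>Amon\<close> are the expansions of -[C_{j,i}]_z for C_{j,i}
  = -1, -2, -3. So A_{i,l} is column i of C(z), shifted by l, and pairing with it under
  \<open>N\<close> becomes a product of C(z) with its inverse.\<close>

lemma lookup_Amon:
  assumes "i \<in> I" "j \<in> I"
  shows "lookup (Amon i l) (j, k) = zcoeff (Cz j i) (k - l)"
proof -
  have S: "lookup (\<Sum>j\<in>{j \<in> I. C j i = c}. f j) (j, k)
      = (if C j i = c then lookup (f j) (j, k) else 0)"
    if "\<And>j'. j' \<noteq> j \<Longrightarrow> lookup (f j') (j, k) = 0" for f :: "nat \<Rightarrow> mono" and c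
  proof -
    have "lookup (\<Sum>j\<in>{j \<in> I. C j i = c}. f j) (j, k)
      = (\<Sum>j'\<in>{j \<in> I. C j i = c}. if j' = j then lookup (f j) (j, k) else 0)"
      unfolding lookup_sum using that by (intro sum.cong) auto
    then show ?thesis using assms by auto
  qed
  have "lookup (Amon i l) (j, k) =
      of_bool (i = j \<and> l - int (r i) = k) + of_bool (i = j \<and> l + int (r i) = k)
      - (if C j i = -1 then of_bool (l = k) else 0)
      - (if C j i = -2 then of_bool (l + 1 = k) + of_bool (l - 1 = k) else 0)
      - (if C j i = -3 then of_bool (l + 2 = k) + of_bool (l = k) + of_bool (l - 2 = k) else 0)"
    unfolding Amon_def lookup_minus
    by (subst (1 2 3) S) (simp_all add: lookup_add lookup_Ymon)
  moreover have "(l - int (r i) = k) = (k - l = - int (r i))" "(l + int (r i) = k) = (k - l = int (r i))"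
    "(l = k) = (k - l = 0)" "(l + 1 = k) = (k - l = 1)" "(l - 1 = k) = (k - l = -1)"
    "(l + 2 = k) = (k - l = 2)" "(l - 2 = k) = (k - l = -2)" by linarith+
  ultimately have eq: "lookup (Amon i l) (j, k) =
      of_bool (i = j \<and> k - l = - int (r i)) + of_bool (i = j \<and> k - l = int (r i))
      - (if C j i = -1 then of_bool (k - l = 0) else 0)
      - (if C j i = -2 then of_bool (k - l = 1) + of_bool (k - l = -1) else 0)
      - (if C j i = -3 then of_bool (k - l = 2) + of_bool (k - l = 0) + of_bool (k - l = -2) else 0)"
    by (simp only:)
  consider "j = i" "C j i = 2" | "j \<noteq> i" "C j i = 0" | "j \<noteq> i" "C j i = -1"
    | "j \<noteq> i" "C j i = -2" | "j \<noteq> i" "C j i = -3"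
    using C_values[OF assms(2,1)] by auto
  then show ?thesis
    unfolding zcoeff_Cz[OF assms(2,1)] eq by cases simp_all
qed

lemma lookup_Amon_diag:
  assumes "i \<in> I"
  shows "lookup (Amon i l) (i, k) = of_bool (k = l + int (r i)) + of_bool (k = l - int (r i))"
  unfolding lookup_Amon[OF assms assms] zcoeff_Cz[OF assms assms] by (auto simp: algebra_simps)

lemma N_Amon_sum:
  assumes "i \<in> I" "j \<in> I"
  shows "N (Ymon j k) (Amon i l) =
      (\<Sum>p\<in>I. \<Sum>s\<in>{- Cz_bound..Cz_bound}. zcoeff (Cz p i) s * Nvar (j, k) (p, l + s))"
    "N (Amon i l) (Ymon j k) =
      (\<Sum>p\<in>I. \<Sum>s\<in>{- Cz_bound..Cz_bound}. zcoeff (Cz p i) s * Nvar (p, l + s) (j, k))"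
proof -
  let ?T = "{l - Cz_bound..l + Cz_bound}"
  have keys: "keys (Amon i l) \<subseteq> I \<times> ?T"
  proof
    fix q assume q: "q \<in> keys (Amon i l)"
    obtain p s where ps: "q = (p, s)" by (cases q)
    have p: "p \<in> I" using q monomials_Amon[OF assms(1), of l] by (auto simp: monomials_def ps)
    have "zcoeff (Cz p i) (s - l) \<noteq> 0"
      using q by (simp add: in_keys_iff ps lookup_Amon[OF assms(1) p])
    then have "s - l \<in> {- Cz_bound..Cz_bound}"
      using zcoeff_Cz_eq_0[OF p assms(1)] by blast
    then show "q \<in> I \<times> ?T" using p by (auto simp: ps)
  qed
  have shift: "(\<Sum>s\<in>?T. f s) = (\<Sum>s\<in>{- Cz_bound..Cz_bound}. f (l + s))" for f :: "int \<Rightarrow> int"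
    by (rule sum.reindex_bij_witness[of _ "\<lambda>s. l + s" "\<lambda>s. s - l"]) auto
  have "N (Ymon j k) (Amon i l) = (\<Sum>(p, s)\<in>I \<times> ?T. zcoeff (Cz p i) (s - l) * Nvar (j, k) (p, s))"
    by (subst N_superset[OF _ _ order_refl keys])
      (auto simp: Ymon_def lookup_Amon[OF assms(1)] intro!: sum.cong)
  then show "N (Ymon j k) (Amon i l) =
      (\<Sum>p\<in>I. \<Sum>s\<in>{- Cz_bound..Cz_bound}. zcoeff (Cz p i) s * Nvar (j, k) (p, l + s))"
    by (simp add: sum.cartesian_product[symmetric] shift)
  have "N (Amon i l) (Ymon j k) = (\<Sum>(p, s)\<in>I \<times> ?T. zcoeff (Cz p i) (s - l) * Nvar (p, s) (j, k))"
    by (subst N_superset[OF _ _ keys order_refl])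
      (auto simp: Ymon_def lookup_Amon[OF assms(1)] intro!: sum.cong)
  then show "N (Amon i l) (Ymon j k) =
      (\<Sum>p\<in>I. \<Sum>s\<in>{- Cz_bound..Cz_bound}. zcoeff (Cz p i) s * Nvar (p, l + s) (j, k))"
    by (simp add: sum.cartesian_product[symmetric] shift)
qed

lemma zcoeff_Cz_mult:
  assumes "i \<in> I" "p \<in> I"
  shows "zcoeff (Cz p i * g) t = (\<Sum>s\<in>{- Cz_bound..Cz_bound}. zcoeff (Cz p i) s * zcoeff g (t - s))"
  by (intro zcoeff_mult zcoeff_Cz_eq_0) (use assms in auto)

text \<open>The pairing is a coefficient of minus the sum over p of (z^{r_p} - z^{-r_p}) C_{p,i}(z)
  times the (p,j) entry of the inverse. Symmetry turns the first two factors into (z^{r_i} -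
  z^{-r_i}) C_{i,p}(z), and the sum collapses.\<close>

lemma N_Ymon_Amon:
  assumes "i \<in> I" "j \<in> I"
  shows "N (Ymon j k) (Amon i l) = of_bool (j = i) * (of_bool (k = l - int (r i)) - of_bool (k = l + int (r i)))"
proof -
  have "N (Ymon j k) (Amon i l) = (\<Sum>p\<in>I. zcoeff (- (zdiff (int (r p)) * Cz p i * Cz_inv p j)) (k - l))"
    unfolding N_Amon_sum(1)[OF assms]
  proof (intro sum.cong refl)
    fix p assume p: "p \<in> I"
    have "- (zdiff (int (r p)) * Cz p i * Cz_inv p j) =
      zpow (- int (r p)) * (Cz p i * Cz_inv p j) - zpow (int (r p)) * (Cz p i * Cz_inv p j)"
      by (simp add: zdiff_def algebra_simps)
    then have "zcoeff (- (zdiff (int (r p)) * Cz p i * Cz_inv p j)) (k - l) =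
       zcoeff (Cz p i * Cz_inv p j) (k - l + int (r p)) - zcoeff (Cz p i * Cz_inv p j) (k - l - int (r p))"
      by (simp add: zcoeff_diff zcoeff_zpow_mult)
    also have "\<dots> = (\<Sum>s\<in>{- Cz_bound..Cz_bound}. zcoeff (Cz p i) s *
       (zcoeff (Cz_inv p j) (k - l + int (r p) - s) - zcoeff (Cz_inv p j) (k - l - int (r p) - s)))"
      by (simp add: zcoeff_Cz_mult[OF assms(1) p] right_diff_distrib sum_subtractf)
    also have "\<dots> = (\<Sum>s\<in>{- Cz_bound..Cz_bound}. zcoeff (Cz p i) s * Nvar (j, k) (p, l + s))"
      by (intro sum.cong refl) (simp add: Nvar_def algebra_simps)
    finally show "(\<Sum>s\<in>{- Cz_bound..Cz_bound}. zcoeff (Cz p i) s * Nvar (j, k) (p, l + s)) =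
       zcoeff (- (zdiff (int (r p)) * Cz p i * Cz_inv p j)) (k - l)" ..
  qed
  also have "\<dots> = - zcoeff (\<Sum>p\<in>I. zdiff (int (r p)) * Cz p i * Cz_inv p j) (k - l)"
    by (simp add: zcoeff_sum zcoeff_uminus sum_negf)
  also have "(\<Sum>p\<in>I. zdiff (int (r p)) * Cz p i * Cz_inv p j) = zdiff (int (r i)) * (\<Sum>p\<in>I. Cz i p * Cz_inv p j)"
    unfolding sum_distrib_left
    by (intro sum.cong refl) (metis assms(1) zdiff_Cz_sym mult.assoc)
  also have "(\<Sum>p\<in>I. Cz i p * Cz_inv p j) = of_bool (i = j)"
    using Cz_inv assms by blast
  finally show ?thesis
    by (auto simp: zdiff_def zcoeff_diff zcoeff_zpow zcoeff_0)
qed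

text \<open>\<open>N\<close> is not antisymmetric in general, so the other order is a separate
  computation. Here rows of the inverse meet columns of C(z), and the invariance of C(z) under
  exchange of z and z^{-1} turns the sum over t + s into a product of series.\<close>

lemma N_Amon_Ymon:
  assumes "i \<in> I" "j \<in> I"
  shows "N (Amon i l) (Ymon j k) = - N (Ymon j k) (Amon i l)"
proof -
  have "N (Amon i l) (Ymon j k) = (\<Sum>p\<in>I. zcoeff (Cz_inv j p * Cz p i) (int (r j) + l - k)
      - zcoeff (Cz_inv j p * Cz p i) (- int (r j) + l - k))"
    unfolding N_Amon_sum(2)[OF assms]
  proof (intro sum.cong refl)
    fix p assume p: "p \<in> I"
    have sym: "zcoeff (Cz_inv j p * Cz p i) t
      = (\<Sum>s\<in>{- Cz_bound..Cz_bound}. zcoeff (Cz p i) s * zcoeff (Cz_inv j p) (t + s))" for t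
    proof -
      have "zcoeff (Cz_inv j p * Cz p i) t
          = (\<Sum>s\<in>{- Cz_bound..Cz_bound}. zcoeff (Cz p i) s * zcoeff (Cz_inv j p) (t - s))"
        by (simp add: mult.commute[of "Cz_inv j p"] zcoeff_Cz_mult[OF assms(1) p])
      also have "\<dots> = (\<Sum>s\<in>{- Cz_bound..Cz_bound}. zcoeff (Cz p i) (- s) * zcoeff (Cz_inv j p) (t + s))"
        by (rule sum.reindex_bij_witness[of _ uminus uminus]) auto
      finally show ?thesis
        by (simp add: zcoeff_Cz_minus[OF p assms(1)])
    qed
    show "(\<Sum>s\<in>{- Cz_bound..Cz_bound}. zcoeff (Cz p i) s * Nvar (p, l + s) (j, k)) =
      zcoeff (Cz_inv j p * Cz p i) (int (r j) + l - k) - zcoeff (Cz_inv j p * Cz p i) (- int (r j) + l - k)"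
      unfolding sym sum_subtractf[symmetric] right_diff_distrib[symmetric]
      by (intro sum.cong refl) (simp add: Nvar_def algebra_simps)
  qed
  also have "\<dots> = zcoeff (\<Sum>p\<in>I. Cz_inv j p * Cz p i) (int (r j) + l - k)
      - zcoeff (\<Sum>p\<in>I. Cz_inv j p * Cz p i) (- int (r j) + l - k)"
    by (simp add: zcoeff_sum sum_subtractf)
  also have "(\<Sum>p\<in>I. Cz_inv j p * Cz p i) = of_bool (j = i)"
    using Cz_inv assms by blast
  finally show ?thesis
    using assms by (auto simp: N_Ymon_Amon zcoeff_1 zcoeff_0)
qed

section \<open>The form N against arbitrary monomials, and the existence of a height\<close>

lemma mono_as_sum:
  fixes m :: mono
  shows "m = (\<Sum>p\<in>keys m. Poly_Mapping.single p (lookup m p))"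
  by (intro poly_mapping_eqI) (auto simp: lookup_sum lookup_single when_def in_keys_iff)

lemma keys_single_monomials: "i \<in> I \<Longrightarrow> Poly_Mapping.single (i, l) a \<in> monomials"
  by (auto simp: monomials_def)

lemma monomials_induct [consumes 1, case_names zero add diff]:
  assumes "m \<in> monomials" "P 0"
    "\<And>m i l. m \<in> monomials \<Longrightarrow> i \<in> I \<Longrightarrow> P m \<Longrightarrow> P (m + Ymon i l)"
    "\<And>m i l. m \<in> monomials \<Longrightarrow> i \<in> I \<Longrightarrow> P m \<Longrightarrow> P (m - Ymon i l)"
  shows "P m"
proof -
  have single: "\<forall>m\<in>monomials. P m \<longrightarrow> P (m + Poly_Mapping.single (i, l) a)" if i: "i \<in> I" for i l a
  proof (induction a rule: int_induct[where k = 0])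
    case (step1 a)
    show ?case
    proof (intro ballI impI)
      fix m assume m: "m \<in> monomials" "P m"
      have "m + Poly_Mapping.single (i, l) a \<in> monomials"
        using m i by (intro monomials_add) (auto simp: monomials_def)
      from assms(3)[OF this i, of l] step1 m show "P (m + Poly_Mapping.single (i, l) (a + 1))"
        by (simp add: Ymon_def single_add add.assoc)
    qed
  next
    case (step2 a)
    show ?case
    proof (intro ballI impI)
      fix m assume m: "m \<in> monomials" "P m"
      have "m + Poly_Mapping.single (i, l) a \<in> monomials"
        using m i by (intro monomials_add) (auto simp: monomials_def)
      from assms(4)[OF this i, of l] step2 m show "P (m + Poly_Mapping.single (i, l) (a - 1))"
        by (simp add: Ymon_def single_diff add_diff_eq)
    qed
  qed simp
  have "finite S \<Longrightarrow> S \<subseteq> I \<times> UNIV \<Longrightarrow>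
      (\<Sum>p\<in>S. Poly_Mapping.single p (f p)) \<in> monomials \<and> P (\<Sum>p\<in>S. Poly_Mapping.single p (f p))"
    for S f
  proof (induction S rule: finite_induct)
    case (insert p S)
    moreover obtain i l where "p = (i, l)" by (cases p)
    ultimately show ?case
      using single[of i l "f p"]
      by (auto simp: add.commute[of "Poly_Mapping.single _ _"] keys_single_monomials
          intro!: monomials_add)
  qed (auto simp: assms monomials_0)
  from this[of "keys m" "lookup m"] show ?thesis
    using assms(1) by (simp only: mono_as_sum[of m, symmetric] finite_keys) (simp add: monomials_def)
qed

lemma N_Amon_right:
  assumes "m \<in> monomials" "i \<in> I"
  shows "N m (Amon i l) = lookup m (i, l - int (r i)) - lookup m (i, l + int (r i))"
  using assms(1)
  by (induction rule: monomials_induct)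
    (auto simp: N_simps N_Ymon_Amon[OF assms(2)] lookup_add lookup_minus lookup_Ymon)

lemma N_Amon_left:
  assumes "m \<in> monomials" "i \<in> I"
  shows "N (Amon i l) m = - N m (Amon i l)"
  using assms(1)
  by (induction rule: monomials_induct)
    (auto simp: N_simps N_Amon_Ymon[OF assms(2)])

text \<open>The total exponent of node j in A_{i,l} is C_{j,i}. Weighting node j by the j-th column
  sum of the adjugate of C, with the sign of the determinant, therefore gives every A_{i,l} the
  value of the determinant up to sign. Using the adjugate keeps heights integral, so that they can
  be inducted on.\<close>

lemma ht_exists:
  "\<exists>(h :: mono \<Rightarrow> int) c. (\<forall>a b. h (a + b) = h a + h b) \<and> 0 < c \<and> (\<forall>i\<in>I. \<forall>l. h (Amon i l) = c)"
proof -
  define M where "M = mat n n (\<lambda>(i, j). C (Suc i) (Suc j))"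
  have M: "M \<in> carrier_mat n n" by (simp add: M_def)
  have sumI: "(\<Sum>k\<in>I. f k) = (\<Sum>k = 0..<n. f (Suc k))" for f :: "nat \<Rightarrow> 'a :: comm_monoid_add"
    using sum.atLeast1_atMost_eq[of f n] by (simp add: atLeast0LessThan)
  have "det M \<noteq> 0"
  proof
    assume "det M = 0"
    then obtain v where v: "v \<in> carrier_vec n" "v \<noteq> 0\<^sub>v n" "M *\<^sub>v v = 0\<^sub>v n"
      using det_0_iff_vec_prod_zero[OF M] by blast
    \<comment> \<open>A kernel vector of C is isotropic for the symmetrized form: weight row i of C
      x = 0 by r_i x_i and add.\<close>
    define x where "x i = real_of_int (v $ (i - 1))" for i
    from v(1,2) obtain i where i: "i < n" "v $ i \<noteq> 0" by (auto simp: vec_eq_iff)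
    have "(\<Sum>j\<in>I. real_of_int (C i j) * x j) = 0" if "i \<in> I" for i
    proof -
      have "(\<Sum>j = 0..<n. C i (Suc j) * v $ j) = (M *\<^sub>v v) $ (i - 1)"
        using that v(1) M by (auto simp: M_def scalar_prod_def)
      also have "\<dots> = 0" using v(3) that by auto
      finally have "real_of_int (\<Sum>j = 0..<n. C i (Suc j) * v $ j) = 0" by simp
      then show ?thesis unfolding sumI by (simp add: x_def)
    qed
    then have "(\<Sum>i\<in>I. (real (r i) * x i) * (\<Sum>j\<in>I. real_of_int (C i j) * x j)) = 0"
      by (intro sum.neutral) auto
    then have "(\<Sum>i\<in>I. \<Sum>j\<in>I. real (r i) * of_int (C i j) * x i * x j) = 0"
      by (simp add: sum_distrib_left mult_ac)
    moreover have "\<exists>i\<in>I. x i \<noteq> 0"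
      using i by (intro bexI[of _ "Suc i"]) (auto simp: x_def)
    ultimately show False using pos_def[of x] by simp
  qed
  define A where "A = adj_mat M"
  have A: "A \<in> carrier_mat n n" "A * M = det M \<cdot>\<^sub>m 1\<^sub>m n"
    unfolding A_def using adj_mat[OF M] by auto
  define w where "w j = sgn (det M) * (\<Sum>k = 0..<n. A $$ (k, j - 1))" for j
  define h where "h m = (\<Sum>p\<in>keys m. lookup m p * w (fst p))" for m :: mono
  have h: "h m = (\<Sum>p\<in>S. lookup m p * w (fst p))" if "finite S" "keys m \<subseteq> S" for m S
    unfolding h_def by (rule sum_keys_eq) (use that in auto)
  have h_add: "h (a + b) = h a + h b" for a b
    using Poly_Mapping.keys_add[of a b]
    by (subst (1 2 3) h[of "keys a \<union> keys b"])
      (auto simp: lookup_add algebra_simps sum.distrib)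
  have h_0: "h 0 = 0" by (simp add: h_def)
  have h_diff: "h (a - b) = h a - h b" for a b
    using h_add[of "a - b" b] by simp
  have h_sum: "h (\<Sum>x\<in>S. f x) = (\<Sum>x\<in>S. h (f x))" for f and S :: "nat set"
    by (induction S rule: infinite_finite_induct) (auto simp: h_add h_0)
  have h_Y: "h (Ymon j l) = w j" for j l by (simp add: h_def Ymon_def)
  have "h (Amon i l) = \<bar>det M\<bar>" if i: "i \<in> I" for i l
  proof -
    have "h (Amon i l) = 2 * w i - (\<Sum>j\<in>{j\<in>I. C j i = -1}. w j) - (\<Sum>j\<in>{j\<in>I. C j i = -2}. 2 * w j)
       - (\<Sum>j\<in>{j\<in>I. C j i = -3}. 3 * w j)"
      by (simp add: Amon_def h_diff h_add h_sum h_Y)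
    also have "\<dots> = (\<Sum>j\<in>I. if j = i then 2 * w i else 0) - (\<Sum>j\<in>I. if C j i = -1 then w j else 0)
      - (\<Sum>j\<in>I. if C j i = -2 then 2 * w j else 0) - (\<Sum>j\<in>I. if C j i = -3 then 3 * w j else 0)"
      using i by (simp add: sum.If_cases Int_def)
    also have "\<dots> = (\<Sum>j\<in>I. C j i * w j)"
      unfolding sum_subtractf[symmetric]
    proof (intro sum.cong refl)
      fix j assume "j \<in> I"
      from C_values[OF this i] show "(if j = i then 2 * w i else 0) - (if C j i = -1 then w j else 0)
        - (if C j i = -2 then 2 * w j else 0) - (if C j i = -3 then 3 * w j else 0) = C j i * w j" by auto
    qed
    also have "\<dots> = sgn (det M) * (\<Sum>k = 0..<n. \<Sum>j = 0..<n. A $$ (k, j) * C (Suc j) i)"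
      unfolding sumI w_def by (subst sum.swap) (simp add: sum_distrib_left sum_distrib_right mult_ac)
    also have "(\<Sum>k = 0..<n. \<Sum>j = 0..<n. A $$ (k, j) * C (Suc j) i) = (\<Sum>k = 0..<n. (A * M) $$ (k, i - 1))"
      by (intro sum.cong refl) (use A(1) M i in \<open>auto simp: scalar_prod_def M_def\<close>)
    also have "\<dots> = (\<Sum>k = 0..<n. if k = i - 1 then det M else 0)"
      unfolding A(2) using i by (intro sum.cong refl) auto
    also have "\<dots> = det M" using i by auto
    finally show ?thesis by (simp add: abs_sgn mult.commute)
  qed
  then show ?thesis
    using \<open>det M \<noteq> 0\<close> h_add by (intro exI[of _ h] exI[of _ "\<bar>det M\<bar>"]) auto
qed

end

section \<open>The quantum torus\<close>

lemma poly_mapping_single_induct [case_names zero single add]: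
  assumes "P 0" "\<And>m c. P (Poly_Mapping.single m c)" "\<And>x y. P x \<Longrightarrow> P y \<Longrightarrow> P (x + y)"
  shows "P (x :: 'a \<Rightarrow>\<^sub>0 'b :: comm_monoid_add)"
proof -
  have "P (\<Sum>p\<in>S. Poly_Mapping.single p (lookup x p))" if "finite S" for S
    using that by (induction S rule: finite_induct) (auto intro: assms)
  moreover have "x = (\<Sum>p\<in>keys x. Poly_Mapping.single p (lookup x p))"
    by (intro poly_mapping_eqI) (auto simp: lookup_sum lookup_single when_def in_keys_iff)
  ultimately show ?thesis by (metis finite_keys)
qed

lemma tpow_add: "tpow a * tpow b = tpow (a + b)"
  by (simp add: tpow_def mult_single)

lemma tpow_add_left: "tpow a * (tpow b * c) = tpow (a + b) * c"
  by (simp add: tpow_add flip: mult.assoc)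

lemma tpow_0: "tpow 0 = 1"
  by (simp add: tpow_def flip: single_one)

lemma tpow_nonzero: "tpow a \<noteq> 0"
  by (simp add: tpow_def flip: single_zero)

lemma tpow_inverse: "tpow a * (tpow (- a) * c) = c" "tpow (- a) * (tpow a * c) = c"
  by (simp_all add: tpow_add_left tpow_0)

lemma tpow_inj: "tpow a = tpow b \<longleftrightarrow> a = b"
proof
  assume "tpow a = tpow b"
  then have "keys (tpow a) = keys (tpow b)" by simp
  then show "a = b" by (simp add: tpow_def)
qed simp

definition scal :: "'a \<Rightarrow> ('b \<Rightarrow>\<^sub>0 'a) \<Rightarrow> ('b \<Rightarrow>\<^sub>0 'a :: comm_semiring_1)" where
  "scal c x = Poly_Mapping.map ((*) c) x"

lemma lookup_scal [simp]: "lookup (scal c x) m = c * lookup x m"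
  by (simp add: scal_def Poly_Mapping.map.rep_eq when_def)

lemma scal_simps [simp]:
  "scal c 0 = 0" "scal 0 x = 0" "scal 1 x = x"
  "scal c (scal d x) = scal (c * d) x"
  "scal c (Poly_Mapping.single m d) = Poly_Mapping.single m (c * d)"
  by (auto intro!: poly_mapping_eqI simp: lookup_single when_def mult.assoc)

lemma scal_add_right: "scal c (x + y) = scal c x + scal c y"
  and scal_add_left: "scal (c + d) x = scal c x + scal d x"
  by (auto intro!: poly_mapping_eqI simp: lookup_add algebra_simps)

lemma scal_minus_1: "scal (-1) x = - (x :: 'b \<Rightarrow>\<^sub>0 'a :: comm_ring_1)"
  by (auto intro!: poly_mapping_eqI)

lemma scal_sum: "scal c (\<Sum>x\<in>S. f x) = (\<Sum>x\<in>S. scal c (f x))"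
  by (induction S rule: infinite_finite_induct) (auto simp: scal_add_right)

lemma keys_scal: "keys (scal c x) \<subseteq> keys x"
  by (auto simp: in_keys_iff)

context cartan_data
begin

lemma tmult_superset:
  assumes "finite S" "finite T" "keys x \<subseteq> S" "keys y \<subseteq> T"
  shows "tmult x y = (\<Sum>m1\<in>S. \<Sum>m2\<in>T. Poly_Mapping.single (m1 + m2)
       (tpow (N m1 m2) * lookup x m1 * lookup y m2))"
proof -
  have "tmult x y = (\<Sum>m1\<in>keys x. \<Sum>m2\<in>T. Poly_Mapping.single (m1 + m2)
       (tpow (N m1 m2) * lookup x m1 * lookup y m2))"
    unfolding tmult_def using assms by (intro sum.cong refl sum.mono_neutral_left) (auto simp: in_keys_iff)
  also have "\<dots> = (\<Sum>m1\<in>S. \<Sum>m2\<in>T. Poly_Mapping.single (m1 + m2)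
       (tpow (N m1 m2) * lookup x m1 * lookup y m2))"
    using assms by (intro sum.mono_neutral_left) (auto simp: in_keys_iff)
  finally show ?thesis .
qed

lemma tmult_add_left: "tmult (x + y) z = tmult x z + tmult y z"
  using Poly_Mapping.keys_add[of x y]
  by (subst (1 2 3) tmult_superset[of "keys x \<union> keys y" "keys z"])
    (auto simp: lookup_add algebra_simps sum.distrib single_add)

lemma tmult_add_right: "tmult z (x + y) = tmult z x + tmult z y"
  using Poly_Mapping.keys_add[of x y]
  by (subst (1 2 3) tmult_superset[of "keys z" "keys x \<union> keys y"])
    (auto simp: lookup_add algebra_simps sum.distrib single_add)

lemma tmult_0 [simp]: "tmult 0 x = 0" "tmult x 0 = 0"
  by (auto simp: tmult_def)

lemma tmult_single: "tmult (Poly_Mapping.single a c) (Poly_Mapping.single b d) =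
    Poly_Mapping.single (a + b) (tpow (N a b) * c * d)"
  by (subst tmult_superset[of "{a}" "{b}"]) auto

lemma tmult_scal: "tmult (scal c x) y = scal c (tmult x y)" "tmult x (scal c y) = scal c (tmult x y)"
proof -
  have "tmult (scal c x) y = scal c (tmult x y) \<and> tmult x (scal c y) = scal c (tmult x y)"
  proof (induction x rule: poly_mapping_single_induct)
    case (single m d)
    show ?case
      by (induction y rule: poly_mapping_single_induct)
        (auto simp: tmult_single tmult_add_right scal_add_right mult_ac)
  qed (auto simp: tmult_add_left tmult_add_right scal_add_right)
  then show "tmult (scal c x) y = scal c (tmult x y)" "tmult x (scal c y) = scal c (tmult x y)" by auto
qed

lemma tmult_nmon_single: "tmult (nmon a) (Poly_Mapping.single b d) = Poly_Mapping.single (a + b) (tpow (N a b) * d)"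
  and tmult_single_nmon: "tmult (Poly_Mapping.single b d) (nmon a) = Poly_Mapping.single (b + a) (tpow (N b a) * d)"
  unfolding nmon_def tmult_single by simp_all

lemma tmult_nmon_0 [simp]: "tmult (nmon 0) x = x" "tmult x (nmon 0) = x"
proof -
  have "tmult (nmon 0) x = x \<and> tmult x (nmon 0) = x"
    by (induction x rule: poly_mapping_single_induct)
      (auto simp: tmult_add_left tmult_add_right tmult_nmon_single tmult_single_nmon N_0 tpow_0)
  then show "tmult (nmon 0) x = x" "tmult x (nmon 0) = x" by auto
qed

lemma tmult_assoc: "tmult (tmult x y) z = tmult x (tmult y z)"
proof (induction x rule: poly_mapping_single_induct)
  case (single a c)
  show ?case
  proof (induction y rule: poly_mapping_single_induct)
    case (single b d)
    show ?case
    proof (induction z rule: poly_mapping_single_induct)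
      case (single e f)
      have "tpow (N (a + b) e) * (tpow (N a b) * c * d) * f = (tpow (N (a + b) e) * tpow (N a b)) * (c * d * f)"
        by (simp only: mult_ac)
      also have "tpow (N (a + b) e) * tpow (N a b) = tpow (N a (b + e)) * tpow (N b e)"
        by (simp add: tpow_add N_add_left N_add_right add_ac)
      also have "\<dots> * (c * d * f) = tpow (N a (b + e)) * c * (tpow (N b e) * d * f)"
        by (simp only: mult_ac)
      finally show ?case by (simp only: tmult_single add.assoc)
    qed (auto simp: tmult_add_right)
  qed (auto simp: tmult_add_left tmult_add_right)
qed (auto simp: tmult_add_left)

lemma nmon_mult: "tmult (nmon a) (nmon b) = scal (tpow (N a b)) (nmon (a + b))"
  unfolding nmon_def tmult_single by simp

lemma tprod_simps [simp]: "tprod [] = nmon 0" "tprod (x # xs) = tmult x (tprod xs)"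
  by (simp_all add: tprod_def)

lemma tprod_append: "tprod (xs @ ys) = tmult (tprod xs) (tprod ys)"
  by (induction xs) (auto simp: tmult_assoc)

lemma lookup_tmult: "lookup (tmult x y) q =
   (\<Sum>a\<in>keys x. \<Sum>b\<in>keys y.
      (tpow (N a b) * lookup x a * lookup y b) when a + b = q)"
  by (simp add: tmult_def lookup_sum lookup_single)

lemma keys_tmult:
  assumes "q \<in> keys (tmult x y)"
  obtains a b where "a \<in> keys x" "b \<in> keys y" "q = a + b"
proof -
  have "\<exists>a\<in>keys x. \<exists>b\<in>keys y. q = a + b"
  proof (rule ccontr)
    assume "\<not> ?thesis"
    then have "lookup (tmult x y) q = 0"
      unfolding lookup_tmult by (intro sum.neutral ballI) (auto simp: when_def)
    then show False using assms by (simp add: in_keys_iff)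
  qed
  then show ?thesis using that by blast
qed

end

context finite_cartan_data
begin

definition ht_data :: "(mono \<Rightarrow> int) \<times> int" where
  "ht_data = (SOME (h, c). (\<forall>a b. h (a + b) = h a + h b) \<and> 0 < c \<and> (\<forall>i\<in>I. \<forall>l. h (Amon i l) = c))"

definition ht :: "mono \<Rightarrow> int" where "ht = fst ht_data"
definition hA :: int where "hA = snd ht_data"

lemma ht_props: "(\<forall>a b. ht (a + b) = ht a + ht b) \<and> 0 < hA \<and> (\<forall>i\<in>I. \<forall>l. ht (Amon i l) = hA)"
proof -
  have "\<exists>p. case p of (h, c) \<Rightarrow> (\<forall>a b :: mono. h (a + b) = h a + h b) \<and> (0 :: int) < c \<and> (\<forall>i\<in>I. \<forall>l. h (Amon i l) = c)"
    using ht_exists by auto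
  from someI_ex[OF this] show ?thesis
    unfolding ht_def hA_def ht_data_def by (simp add: case_prod_unfold)
qed

lemma ht_add: "ht (a + b) = ht a + ht b"
  and hA_pos: "0 < hA"
  and ht_Amon: "i \<in> I \<Longrightarrow> ht (Amon i l) = hA"
  using ht_props by blast+

lemma ht_0: "ht 0 = 0"
  using ht_add[of 0 0] by simp

lemma ht_uminus: "ht (- a) = - ht a"
  using ht_add[of a "- a"] ht_0 by simp

lemma ht_diff: "ht (a - b) = ht a - ht b"
  using ht_add[of a "- b"] ht_uminus[of b] by simp

lemmas ht_simps = ht_add ht_0 ht_uminus ht_diff

text \<open>The coefficient \<open>c\<close> may be 0, and then everything lies strictly below
  \<open>ht m\<close>. The coefficient type is left open because the notion serves both the quantum
  torus and Laurent polynomials over the integers.\<close>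

definition leads :: "(mono \<Rightarrow>\<^sub>0 'a :: zero) \<Rightarrow> mono \<Rightarrow> 'a \<Rightarrow> bool" where
  "leads x m c \<longleftrightarrow> lookup x m = c \<and> (\<forall>m'\<in>keys x. m' = m \<or> ht m' < ht m)"

lemma leads_nmon: "leads (nmon m) m 1"
  by (simp add: leads_def nmon_def)

lemma leads_scal: "leads x m c \<Longrightarrow> leads (scal d x) m (d * c)"
  using keys_scal[of d x] unfolding leads_def by auto

text \<open>By additivity of the height, \<open>m + m'\<close> arises only from the pair of leading
  monomials, so nothing can cancel there.\<close>

lemma leads_tmult:
  assumes "leads x m c" "leads y m' c'"
  shows "leads (tmult x y) (m + m') (tpow (N m m') * c * c')"
  unfolding leads_def
proof (intro conjI ballI)
  fix q assume "q \<in> keys (tmult x y)"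
  then obtain a b where ab: "a \<in> keys x" "b \<in> keys y" "q = a + b"
    by (rule keys_tmult)
  then have "a = m \<or> ht a < ht m" "b = m' \<or> ht b < ht m'"
    using assms by (auto simp: leads_def)
  then show "q = m + m' \<or> ht q < ht (m + m')"
    unfolding ab(3) ht_add by auto
next
  let ?x = "lookup x" and ?y = "lookup y"
  have le: "a = m \<and> b = m'" if "a \<in> keys x" "b \<in> keys y" "a + b = m + m'" for a b
  proof -
    have "a = m \<or> ht a < ht m" "b = m' \<or> ht b < ht m'"
      using assms that by (auto simp: leads_def)
    moreover have "ht a + ht b = ht m + ht m'"
      using that(3) by (metis ht_add)
    ultimately show ?thesis using that(3) by auto
  qed
  have "lookup (tmult x y) (m + m') =
      (\<Sum>a\<in>keys x. \<Sum>b\<in>keys y. if b = m' then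
        (if a = m then tpow (N m m') * ?x m * ?y m' else 0) else 0)"
    unfolding lookup_tmult by (intro sum.cong refl) (use le in \<open>auto simp: when_def\<close>)
  also have "\<dots> = tpow (N m m') * ?x m * ?y m'"
    by (cases "?x m = 0"; cases "?y m' = 0") (auto simp: in_keys_iff)
  finally show "lookup (tmult x y) (m + m') = tpow (N m m') * c * c'"
    using assms by (simp add: leads_def)
qed

end

section \<open>Subalgebras of a single node\<close>

inductive_set tspan :: "('b \<Rightarrow>\<^sub>0 'a :: comm_ring_1) set \<Rightarrow> ('b \<Rightarrow>\<^sub>0 'a) set" for G where
  zero: "0 \<in> tspan G"
| add: "x \<in> tspan G \<Longrightarrow> g \<in> G \<Longrightarrow> x + scal c g \<in> tspan G"

lemma tspan_gen: "g \<in> G \<Longrightarrow> scal c g \<in> tspan G"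
  using tspan.add[OF tspan.zero, of g G c] by simp

lemma tspan_add: "y \<in> tspan G \<Longrightarrow> x \<in> tspan G \<Longrightarrow> x + y \<in> tspan G"
  by (induction rule: tspan.induct) (auto simp: tspan.add simp flip: add.assoc)

lemma tspan_scal: "x \<in> tspan G \<Longrightarrow> scal c x \<in> tspan G"
  by (induction rule: tspan.induct) (auto simp: scal_add_right intro: tspan.intros)

lemma tspan_diff: "x \<in> tspan G \<Longrightarrow> y \<in> tspan G \<Longrightarrow> x - y \<in> tspan G"
  using tspan_add[OF tspan_scal[of y G "-1"], of x] by (simp add: scal_minus_1)

lemma tspan_sum: "(\<And>x. x \<in> S \<Longrightarrow> f x \<in> tspan G) \<Longrightarrow> (\<Sum>x\<in>S. f x) \<in> tspan G"
  by (induction S rule: infinite_finite_induct) (auto intro: tspan.zero tspan_add)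

lemma tspan_scal_unit: "scal (tpow c) x \<in> tspan G \<longleftrightarrow> x \<in> tspan G"
  using tspan_scal[of "scal (tpow c) x" G "tpow (- c)"] tspan_scal[of x G "tpow c"]
  by (auto simp: tpow_add tpow_0)

text \<open>The inductive definition adds generators one by one, possibly with repetition;
  \<open>?c\<close> merges repetitions into one coefficient per index.\<close>

lemma tspan_image_sum:
  assumes "x \<in> tspan (e ` M)"
  shows "\<exists>S c. finite S \<and> S \<subseteq> M \<and> x = (\<Sum>m\<in>S. scal (c m) (e m))"
  using assms
proof (induction rule: tspan.induct)
  case zero
  show ?case by (intro exI[of _ "{}"]) auto
next
  case (add x g d)
  then obtain S c m where S: "finite S" "S \<subseteq> M" "x = (\<Sum>m\<in>S. scal (c m) (e m))" "m \<in> M" "g = e m"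
    by blast
  let ?c = "\<lambda>m'. (if m' \<in> S then c m' else 0) + (if m' = m then d else 0)"
  have "(\<Sum>m'\<in>insert m S. scal (?c m') (e m')) =
      (\<Sum>m'\<in>insert m S. scal (if m' \<in> S then c m' else 0) (e m')) +
      (\<Sum>m'\<in>insert m S. if m' = m then scal d (e m) else 0)"
    unfolding scal_add_left sum.distrib by (intro arg_cong2[of _ _ _ _ "(+)"] sum.cong) auto
  also have "(\<Sum>m'\<in>insert m S. scal (if m' \<in> S then c m' else 0) (e m')) = x"
    unfolding S(3) using S(1) by (intro sum.mono_neutral_cong_right) auto
  also have "(\<Sum>m'\<in>insert m S. if m' = m then scal d (e m) else 0) = scal d (e m)"
    using S(1) by simp
  finally show ?case
    using S by (intro exI[of _ "insert m S"] exI[of _ ?c]) auto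
qed

context finite_cartan_data
begin

text \<open>The factor Y_{i,l}(1 + t A_{i,l+r_i}^{-1}) of \<open>Et\<close> in normal order: the t
  cancels the twist t^{-1} that comes from N(Y_{i,l}, A_{i,l+r_i}) = 1.\<close>

definition xgen :: "nat \<Rightarrow> int \<Rightarrow> mono \<Rightarrow>\<^sub>0 tpoly" where
  "xgen i l = nmon (Ymon i l) + nmon (Ymon i l - Amon i (l + int (r i)))"

text \<open>The monomials in the Y_{j,l} with j \<noteq> i. They pass the generators of node i up to
  powers of t and play the role of invertible scalars in words.\<close>

definition trivial_at :: "nat \<Rightarrow> mono \<Rightarrow> bool" where
  "trivial_at i z \<longleftrightarrow> z \<in> monomials \<and> (\<forall>l. lookup z (i, l) = 0)"

definition word :: "nat \<Rightarrow> mono \<Rightarrow> int list \<Rightarrow> mono \<Rightarrow>\<^sub>0 tpoly" where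
  "word i z ls = tmult (nmon z) (tprod (map (xgen i) ls))"

definition Ksub :: "nat \<Rightarrow> (mono \<Rightarrow>\<^sub>0 tpoly) set" where
  "Ksub i = tspan (Et i ` B {i})"

lemma trivial_at_0: "trivial_at i 0"
  by (simp add: trivial_at_def monomials_0)

lemma trivial_at_add: "trivial_at i a \<Longrightarrow> trivial_at i b \<Longrightarrow> trivial_at i (a + b)"
  by (auto simp: trivial_at_def monomials_add lookup_add)

lemma trivial_at_uminus: "trivial_at i a \<Longrightarrow> trivial_at i (- a)"
  by (auto simp: trivial_at_def monomials_uminus)

section \<open>Commutation relations at one node and the reordering of words\<close>

lemma N_trivial_Amon:
  assumes "trivial_at i z" "i \<in> I"
  shows "N z (Amon i l) = 0" "N (Amon i l) z = 0"
  using assms by (auto simp: trivial_at_def N_Amon_right N_Amon_left)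

lemma N_Y_A:
  assumes "i \<in> I"
  shows "N (Ymon i l) (Amon i (k + int (r i))) = of_bool (l = k) - of_bool (l = k + 2 * int (r i))"
  using assms by (auto simp: N_Amon_right monomials_Ymon lookup_Ymon)

lemma N_A_A:
  assumes "i \<in> I"
  shows "N (Amon i (l + int (r i))) (Amon i (k + int (r i))) =
    of_bool (k = l + 2 * int (r i)) - of_bool (l = k + 2 * int (r i))"
  using assms r_pos[OF assms] by (auto simp: N_Amon_right monomials_Amon lookup_Amon_diag)

lemma N_A_Y:
  assumes "i \<in> I"
  shows "N (Amon i (k + int (r i))) (Ymon i l) = of_bool (l = k + 2 * int (r i)) - of_bool (l = k)"
  using assms by (simp add: N_Amon_left N_Y_A monomials_Ymon)

lemma xgen_eq:
  assumes "i \<in> I"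
  shows "tmult (nmon (Ymon i l)) (nmon 0 + Poly_Mapping.single (- Amon i (l + int (r i))) (tpow 1)) = xgen i l"
  using assms r_pos[OF assms]
  by (simp add: xgen_def nmon_def[of "_ - _"] tmult_add_right tmult_nmon_single N_uminus N_Y_A tpow_add tpow_0)

lemma xgen_nmon:
  assumes "i \<in> I" "trivial_at i z"
  shows "tmult (xgen i l) (nmon z) = scal (tpow (N (Ymon i l) z - N z (Ymon i l))) (tmult (nmon z) (xgen i l))"
  by (simp add: xgen_def tmult_add_left tmult_add_right nmon_def tmult_single scal_add_right
      tpow_add N_simps N_trivial_Amon[OF assms(2,1)] algebra_simps)

text \<open>Both products have the same four monomials, and for three of them the coefficients
  differ by t^{e-f}. Only Y_{i,l} Y_{i,k} A_{i,l+r_i}^{-1} has t^{e-1} against t^{e+1} after this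
  rescaling. It is free of node i because A_{i,l+r_i} contains precisely Y_{i,l} and Y_{i,k} from
  that node.\<close>

lemma xgen_comm_step:
  assumes "i \<in> I" "k = l + 2 * int (r i)"
  defines "z \<equiv> Ymon i l + Ymon i k - Amon i (l + int (r i))"
  defines "e \<equiv> N (Ymon i l) (Ymon i k)" and "f \<equiv> N (Ymon i k) (Ymon i l)"
  shows "trivial_at i z"
    "tmult (xgen i l) (xgen i k) = scal (tpow (e - f)) (tmult (xgen i k) (xgen i l)) +
       scal (tpow (e - 1) - tpow (e + 1)) (nmon z)"
proof -
  show "trivial_at i z"
    using assms(1) unfolding trivial_at_def z_def
    by (auto intro!: monomials_diff monomials_add monomials_Ymon monomials_Amon
        simp: lookup_minus lookup_add lookup_Ymon lookup_Amon_diag assms(2) algebra_simps)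
  have r: "r i > 0" using r_pos assms by auto
  let ?a = "Amon i (l + int (r i))" and ?b = "Amon i (k + int (r i))"
  have N: "N (Ymon i l) ?a = 1" "N (Ymon i l) ?b = 0" "N (Ymon i k) ?a = -1" "N (Ymon i k) ?b = 1"
    "N ?a (Ymon i l) = -1" "N ?b (Ymon i l) = 0" "N ?a (Ymon i k) = 1" "N ?b (Ymon i k) = -1"
    "N ?a ?b = 1" "N ?b ?a = -1"
    unfolding N_Y_A[OF assms(1)] N_A_A[OF assms(1)] N_A_Y[OF assms(1)] using assms(2) r by simp_all
  have L: "tmult (xgen i l) (xgen i k) = Poly_Mapping.single (Ymon i l + Ymon i k) (tpow e)
      + Poly_Mapping.single (Ymon i l + Ymon i k - ?b) (tpow e)
      + Poly_Mapping.single z (tpow (e - 1)) + Poly_Mapping.single (z - ?b) (tpow e)"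
    by (simp add: xgen_def tmult_add_left tmult_add_right nmon_def tmult_single N_simps N z_def
        e_def algebra_simps)
  have R: "tmult (xgen i k) (xgen i l) = Poly_Mapping.single (Ymon i l + Ymon i k) (tpow f)
      + Poly_Mapping.single (Ymon i l + Ymon i k - ?b) (tpow f)
      + Poly_Mapping.single z (tpow (f + 1)) + Poly_Mapping.single (z - ?b) (tpow f)"
    by (simp add: xgen_def tmult_add_left tmult_add_right nmon_def tmult_single N_simps N z_def
        f_def algebra_simps)
  show "tmult (xgen i l) (xgen i k) = scal (tpow (e - f)) (tmult (xgen i k) (xgen i l)) +
       scal (tpow (e - 1) - tpow (e + 1)) (nmon z)"
    unfolding L R by (simp add: scal_add_right nmon_def tpow_add single_diff)
qed

lemma xgen_comm:
  assumes "i \<in> I"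
  shows "\<exists>c d z. trivial_at i z \<and>
    tmult (xgen i l) (xgen i k) = scal (tpow c) (tmult (xgen i k) (xgen i l)) + scal d (nmon z)"
proof -
  consider "k = l" | "k = l + 2 * int (r i)" | "l = k + 2 * int (r i)"
    | "k \<noteq> l" "k \<noteq> l + 2 * int (r i)" "l \<noteq> k + 2 * int (r i)" by blast
  then show ?thesis
  proof cases
    case 1
    then show ?thesis
      using trivial_at_0 by (intro exI[of _ 0]) (auto simp: tpow_0)
  next
    case 2
    show ?thesis using xgen_comm_step[OF assms 2] by blast
  next
    case 3
    \<comment> \<open>The relation with \<open>l\<close> and \<open>k\<close> exchanged, to be
      solved for the other product.\<close>
    obtain z c d where z: "trivial_at i z"
      "tmult (xgen i k) (xgen i l) = scal (tpow c) (tmult (xgen i l) (xgen i k)) + scal d (nmon z)"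
      using xgen_comm_step[OF assms 3] by blast
    have "tmult (xgen i l) (xgen i k) = scal (tpow (- c)) (tmult (xgen i k) (xgen i l))
        + scal (- tpow (- c) * d) (nmon z)"
      unfolding z(2) by (simp add: scal_add_right tpow_add tpow_0 add.assoc flip: scal_add_left)
    with z(1) show ?thesis by blast
  next
    case 4
    let ?a = "Amon i (l + int (r i))" and ?b = "Amon i (k + int (r i))"
    have N: "N (Ymon i l) ?b = 0" "N (Ymon i k) ?a = 0" "N ?b (Ymon i l) = 0" "N ?a (Ymon i k) = 0"
      "N ?a ?b = 0" "N ?b ?a = 0"
      using assms 4 by (auto simp: N_Y_A N_A_A N_Amon_left monomials_Ymon)
    have "tmult (xgen i l) (xgen i k) =
        scal (tpow (N (Ymon i l) (Ymon i k) - N (Ymon i k) (Ymon i l))) (tmult (xgen i k) (xgen i l))"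
      by (simp add: xgen_def tmult_add_left tmult_add_right nmon_def tmult_single N_simps N
        scal_add_right tpow_add algebra_simps)
    then show ?thesis
      using trivial_at_0 by (intro exI[of _ "_ - _"] exI[of _ 0]) auto
  qed
qed

lemma xgens_nmon:
  assumes "i \<in> I" "trivial_at i z"
  shows "\<exists>c. tmult (tprod (map (xgen i) ls)) (nmon z) = scal (tpow c) (tmult (nmon z) (tprod (map (xgen i) ls)))"
proof (induction ls)
  case Nil
  show ?case by (intro exI[of _ 0]) (simp add: tpow_0)
next
  case (Cons l ls)
  then obtain c where c: "tmult (tprod (map (xgen i) ls)) (nmon z) = scal (tpow c) (tmult (nmon z) (tprod (map (xgen i) ls)))"
    by blast
  have "tmult (tprod (map (xgen i) (l # ls))) (nmon z) =
      scal (tpow c) (tmult (tmult (xgen i l) (nmon z)) (tprod (map (xgen i) ls)))"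
    by (simp add: tmult_assoc c tmult_scal)
  also have "\<dots> = scal (tpow (c + (N (Ymon i l) z - N z (Ymon i l)))) (tmult (nmon z) (tprod (map (xgen i) (l # ls))))"
    by (simp add: xgen_nmon[OF assms] tmult_scal tmult_assoc tpow_add)
  finally show ?case by blast
qed

lemma word_mult:
  assumes "i \<in> I" "trivial_at i z'"
  shows "\<exists>c. tmult (word i z ls) (word i z' ls') = scal (tpow c) (word i (z + z') (ls @ ls'))"
proof -
  obtain c where c: "tmult (tprod (map (xgen i) ls)) (nmon z') = scal (tpow c) (tmult (nmon z') (tprod (map (xgen i) ls)))"
    using xgens_nmon[OF assms] by blast
  have "tmult (word i z ls) (word i z' ls') =
     tmult (nmon z) (tmult (tmult (tprod (map (xgen i) ls)) (nmon z')) (tprod (map (xgen i) ls')))"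
    by (simp add: word_def tmult_assoc)
  also have "\<dots> = scal (tpow c) (tmult (tmult (nmon z) (nmon z')) (tprod (map (xgen i) (ls @ ls'))))"
    by (simp add: c tmult_scal tmult_assoc tprod_append)
  also have "\<dots> = scal (tpow (c + N z z')) (word i (z + z') (ls @ ls'))"
    by (simp add: nmon_mult tmult_scal word_def tpow_add)
  finally show ?thesis by blast
qed

text \<open>The error in \<open>xgen_comm\<close> is a multiple of a trivial monomial, which moves
  to the front; it leaves a word with two letters fewer.\<close>

lemma word_swap:
  assumes "i \<in> I"
  shows "\<exists>c d z'. trivial_at i z' \<and> word i z (as @ l # k # bs) =
    scal (tpow c) (word i z (as @ k # l # bs)) + scal d (word i (z + z') (as @ bs))"
proof -
  let ?p = "\<lambda>ls. tprod (map (xgen i) ls)"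
  obtain c d z' where z': "trivial_at i z'"
    "tmult (xgen i l) (xgen i k) = scal (tpow c) (tmult (xgen i k) (xgen i l)) + scal d (nmon z')"
    using xgen_comm[OF assms] by blast
  obtain e where e: "tmult (?p as) (nmon z') = scal (tpow e) (tmult (nmon z') (?p as))"
    using xgens_nmon[OF assms z'(1)] by blast
  have "word i z (as @ l # k # bs) = tmult (nmon z) (tmult (?p as) (tmult (tmult (xgen i l) (xgen i k)) (?p bs)))"
    by (simp add: word_def tprod_append tmult_assoc)
  also have "\<dots> = scal (tpow c) (word i z (as @ k # l # bs)) +
      scal d (tmult (nmon z) (tmult (tmult (?p as) (nmon z')) (?p bs)))"
    unfolding z'(2) by (simp add: word_def tprod_append tmult_assoc tmult_add_left tmult_add_right tmult_scal)
  also have "tmult (nmon z) (tmult (tmult (?p as) (nmon z')) (?p bs)) =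
     scal (tpow (e + N z z')) (word i (z + z') (as @ bs))"
    unfolding e tmult_scal tmult_assoc
    by (simp only: flip: tmult_assoc) (simp add: nmon_mult tmult_scal word_def tprod_append tmult_assoc tpow_add)
  finally show ?thesis using z'(1) by auto
qed

text \<open>Sorting by adjacent swaps: every error term is a multiple of a shorter word, which
  \<open>less\<close> already places in \<open>Ksub i\<close>. The prefix \<open>pre\<close> holds
  the letters that have reached their final place.\<close>

lemma word_perm:
  assumes i: "i \<in> I" and "mset ls = mset ls'"
    and less: "\<And>z ks. trivial_at i z \<Longrightarrow> length ks < length (pre @ ls) \<Longrightarrow> word i z ks \<in> Ksub i"
    and "trivial_at i z" "word i z (pre @ ls') \<in> Ksub i"
  shows "word i z (pre @ ls) \<in> Ksub i"
  using assms(2-)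
proof (induction ls arbitrary: ls' pre)
  case (Cons a ls)
  then have "a \<in> set ls'" by (metis list.set_intros(1) set_mset_mset)
  then obtain xs ys where ls': "ls' = xs @ a # ys" by (meson split_list)
  \<comment> \<open>The letter \<open>a\<close> travels to the left through \<open>xs\<close>,
    passing the last letter of \<open>xs\<close> first.\<close>
  have move: "word i z (pre @ xs @ a # ys) \<in> Ksub i \<Longrightarrow> length (pre @ xs @ a # ys) = length (pre @ a # ls) \<Longrightarrow>
      word i z (pre @ a # xs @ ys) \<in> Ksub i" for xs ys
  proof (induction xs arbitrary: ys rule: rev_induct)
    case (snoc x xs)
    obtain c d z' where z': "trivial_at i z'" "word i z ((pre @ xs) @ a # x # ys) =
        scal (tpow c) (word i z ((pre @ xs) @ x # a # ys)) + scal d (word i (z + z') ((pre @ xs) @ ys))"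
      using word_swap[OF i] by blast
    have "word i (z + z') ((pre @ xs) @ ys) \<in> Ksub i"
      using snoc.prems(2) by (intro Cons.prems(2) trivial_at_add Cons.prems(3) z'(1)) auto
    then have "word i z (pre @ xs @ a # x # ys) \<in> Ksub i"
      using z'(2) snoc.prems(1) unfolding Ksub_def by (auto intro: tspan_add tspan_scal)
    from snoc.IH[OF this] show ?case using snoc.prems(2) by simp
  qed simp
  have len: "length ls' = length (a # ls)" using Cons.prems(1) by (metis size_mset)
  have "word i z ((pre @ [a]) @ ls) \<in> Ksub i"
  proof (rule Cons.IH)
    show "mset ls = mset (xs @ ys)" using Cons.prems(1) ls' by simp
    show "word i z ((pre @ [a]) @ xs @ ys) \<in> Ksub i"
      using move[of xs ys] Cons.prems(4) len ls' by simp
  qed (use Cons.prems in auto)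
  then show ?case by simp
qed simp

end

section \<open>The elements E_{i,t}(m) as words, and closure of their span under products\<close>

lemma lookup_sum_list:
  "lookup (sum_list (map f xs)) p = sum_list (map (\<lambda>x. lookup (f x) p) xs)"
  by (induction xs) (auto simp: lookup_add)

lemma count_concat_replicate:
  "distinct xs \<Longrightarrow> count (mset (concat (map (\<lambda>l. replicate (k l) l) xs))) a = (if a \<in> set xs then k a else 0)"
  by (induction xs) auto

context cartan_data
begin

lemma tpower_single:
  "\<exists>e'. tpower (Poly_Mapping.single (Poly_Mapping.single p u) (tpow e)) k =
     Poly_Mapping.single (Poly_Mapping.single p (int k * u)) (tpow e')"
proof (induction k)
  case 0
  show ?case by (intro exI[of _ 0]) (simp add: tpower_def nmon_def tpow_0)
next
  case (Suc k)
  then obtain e' where "tpower (Poly_Mapping.single (Poly_Mapping.single p u) (tpow e)) k =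
     Poly_Mapping.single (Poly_Mapping.single p (int k * u)) (tpow e')" by blast
  then show ?case
    by (auto simp: tpower_def tmult_single tpow_add tpow_add_left algebra_simps simp flip: single_add)
qed

lemma Ytpow_single: "\<exists>e. Ytpow j l u = Poly_Mapping.single (Poly_Mapping.single (j, l) u) (tpow e)"
proof (cases "0 \<le> u")
  case True
  then show ?thesis
    using tpower_single[of "(j, l)" 1 0 "nat u"] by (simp add: Ytpow_def nmon_def Ymon_def tpow_0)
next
  case False
  then show ?thesis
    using tpower_single[of "(j, l)" "-1" "N (Ymon j l) (Ymon j l)" "nat (- u)"]
    by (simp add: Ytpow_def nmon_inv_def Ymon_def single_uminus)
qed

lemma tprod_Ytpow:
  "\<exists>e. tprod (map (\<lambda>j. Ytpow j l (u j)) js) =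
     Poly_Mapping.single (\<Sum>j\<leftarrow>js. Poly_Mapping.single (j, l) (u j)) (tpow e)"
proof (induction js)
  case Nil
  show ?case by (intro exI[of _ 0]) (simp add: nmon_def tpow_0)
next
  case (Cons j js)
  then show ?case
    using Ytpow_single[of j l "u j"] by (auto simp: tmult_single tpow_add)
qed

end

context finite_cartan_data
begin

definition wtop :: "nat \<Rightarrow> mono \<Rightarrow> int list \<Rightarrow> mono" where
  "wtop i z ls = z + sum_list (map (Ymon i) ls)"

text \<open>For i-dominant \<open>m\<close> the box contains all monomials of \<open>Et i m\<close>
  and is contained in the monomials of \<open>E {i} m\<close>. It thereby links the quantum
  construction to the sets D_m, which are defined at t = 1.\<close>

definition box :: "nat \<Rightarrow> mono \<Rightarrow> mono set" where
  "box i m = {m - (\<Sum>l\<in>#M. Amon i (l + int (r i))) | M. \<forall>l. int (count M l) \<le> lookup m (i, l)}"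

lemma lookup_sum_Ymon: "lookup (sum_list (map (Ymon i) ls)) (j, l) = (if i = j then int (count (mset ls) l) else 0)"
  by (induction ls) (auto simp: lookup_add lookup_Ymon)

lemma lookup_wtop: "trivial_at i z \<Longrightarrow> lookup (wtop i z ls) (i, l) = int (count (mset ls) l)"
  by (simp add: wtop_def lookup_add lookup_sum_Ymon trivial_at_def)

lemma wtop_monomials: "i \<in> I \<Longrightarrow> trivial_at i z \<Longrightarrow> wtop i z ls \<in> monomials"
  unfolding wtop_def by (induction ls)
    (auto simp: trivial_at_def add.left_commute[of z] intro!: monomials_add[OF monomials_Ymon])

lemma wtop_in_B: "i \<in> I \<Longrightarrow> trivial_at i z \<Longrightarrow> wtop i z ls \<in> B {i}"
  by (simp add: B_def wtop_monomials lookup_wtop)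

text \<open>The factors from nodes j \<noteq> i are pulled to the left, within each l and then
  across the different l; each passage costs only a power of t.\<close>

lemma Et_product_word:
  assumes i: "i \<in> I" and js: "set js \<subseteq> I - {i}"
  shows "\<exists>c. tprod (map (\<lambda>l. tmult (tpower (xgen i l) (k l)) (tprod (map (\<lambda>j. Ytpow j l (u j l)) js))) Ls) =
    scal (tpow c) (word i (\<Sum>l\<leftarrow>Ls. \<Sum>j\<leftarrow>js. Poly_Mapping.single (j, l) (u j l))
      (concat (map (\<lambda>l. replicate (k l) l) Ls)))"
proof (induction Ls)
  case Nil
  show ?case by (intro exI[of _ 0]) (simp add: word_def tpow_0)
next
  case (Cons l Ls)
  let ?z = "\<lambda>l. \<Sum>j\<leftarrow>js. Poly_Mapping.single (j, l) (u j l)"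
  let ?w = "\<lambda>Ls. concat (map (\<lambda>l. replicate (k l) l) Ls)"
  have triv: "trivial_at i (?z l)" for l
    using js
  proof (induction js)
    case (Cons j js)
    then have "trivial_at i (Poly_Mapping.single (j, l) (u j l))"
      by (auto simp: trivial_at_def lookup_single keys_single_monomials)
    with Cons show ?case by (auto intro: trivial_at_add)
  qed (simp add: trivial_at_0)
  then have triv': "trivial_at i (\<Sum>l\<leftarrow>Ls. ?z l)"
    by (induction Ls) (auto intro: trivial_at_add trivial_at_0)
  obtain c where c: "tprod (map (\<lambda>l. tmult (tpower (xgen i l) (k l)) (tprod (map (\<lambda>j. Ytpow j l (u j l)) js))) Ls)
      = scal (tpow c) (word i (\<Sum>l\<leftarrow>Ls. ?z l) (?w Ls))" using Cons by blast
  obtain e where e: "tprod (map (\<lambda>j. Ytpow j l (u j l)) js) = Poly_Mapping.single (?z l) (tpow e)"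
    using tprod_Ytpow[of l "\<lambda>j. u j l" js] by blast
  have e': "Poly_Mapping.single (?z l) (tpow e) = scal (tpow e) (nmon (?z l))"
    by (simp add: nmon_def)
  obtain f where f: "tmult (tprod (map (xgen i) (replicate (k l) l))) (nmon (?z l)) =
      scal (tpow f) (tmult (nmon (?z l)) (tprod (map (xgen i) (replicate (k l) l))))"
    using xgens_nmon[OF i triv] by blast
  have *: "tmult (tpower (xgen i l) (k l)) (tprod (map (\<lambda>j. Ytpow j l (u j l)) js)) =
      scal (tpow (e + f)) (word i (?z l) (replicate (k l) l))"
    unfolding e e' tmult_scal tpower_def using f by (simp add: word_def tpow_add map_replicate)
  obtain g where g: "tmult (word i (?z l) (replicate (k l) l)) (word i (\<Sum>l\<leftarrow>Ls. ?z l) (?w Ls)) =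
      scal (tpow g) (word i (?z l + (\<Sum>l\<leftarrow>Ls. ?z l)) (replicate (k l) l @ ?w Ls))"
    using word_mult[OF i triv'] by blast
  show ?case
    by (simp add: * c g tmult_scal tpow_add tpow_add_left) blast
qed

lemma Et_word:
  assumes i: "i \<in> I" and m: "m \<in> B {i}"
  shows "\<exists>c z ls. trivial_at i z \<and> Et i m = scal (tpow c) (word i z ls) \<and> m = wtop i z ls"
proof -
  define Ls where "Ls = sorted_list_of_set (snd ` keys m)"
  define js where "js = filter (\<lambda>j. j \<noteq> i) [1..<Suc n]"
  define z where "z = (\<Sum>l\<leftarrow>Ls. \<Sum>j\<leftarrow>js. Poly_Mapping.single (j, l) (lookup m (j, l)))"
  define ls where "ls = concat (map (\<lambda>l. replicate (nat (lookup m (i, l))) l) Ls)"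
  have Ls: "distinct Ls" "set Ls = snd ` keys m" by (simp_all add: Ls_def)
  have js: "distinct js" "set js = I - {i}" by (auto simp: js_def)
  have LsD: "lookup m (j, l) = 0" if l: "l \<notin> set Ls" for j l
  proof (rule ccontr)
    assume "lookup m (j, l) \<noteq> 0"
    then have "(j, l) \<in> keys m" by (simp add: in_keys_iff)
    then have "l \<in> snd ` keys m" by (metis image_eqI snd_conv)
    then show False using l Ls(2) by simp
  qed
  have "Et i m = tprod (map (\<lambda>l. tmult (tpower (xgen i l) (nat (lookup m (i, l))))
      (tprod (map (\<lambda>j. Ytpow j l (lookup m (j, l))) js))) Ls)"
    by (simp add: Et_def Ls_def js_def xgen_eq[OF i])
  also obtain c where "\<dots> = scal (tpow c) (word i z ls)"
    using Et_product_word[OF i, of js "\<lambda>l. nat (lookup m (i, l))" "\<lambda>j l. lookup m (j, l)" Ls] js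
    unfolding z_def ls_def by auto
  finally have Et: "Et i m = scal (tpow c) (word i z ls)" .
  have lz: "lookup z (j, l) = (if j \<in> I - {i} then lookup m (j, l) else 0)" for j l
  proof -
    have "lookup z (j, l) = (\<Sum>l'\<in>set Ls. \<Sum>j'\<in>set js. if j' = j then if l' = l then lookup m (j, l) else 0 else 0)"
      unfolding z_def lookup_sum_list using Ls(1) js(1)
      by (simp add: sum_list_distinct_conv_sum_set lookup_sum_list lookup_single when_def)
        (intro sum.cong refl, auto)
    also have "\<dots> = (if j \<in> I - {i} then if l \<in> set Ls then lookup m (j, l) else 0 else 0)"
      unfolding js(2) by (cases "j \<in> I - {i}") (auto intro!: sum.neutral)
    finally show ?thesis using LsD[of l j] by auto
  qed
  have mI: "lookup m (j, l) = 0" if "j \<notin> I" for j l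
    using m that by (intro lookup_notin_monomials) (auto simp: B_def)
  have z: "trivial_at i z"
    by (auto simp: trivial_at_def lz monomials_def in_keys_iff split: if_splits)
  have "lookup m (j, l) = lookup (wtop i z ls) (j, l)" for j l
  proof (cases "j = i")
    case True
    have "lookup (wtop i z ls) (i, l) = (if l \<in> set Ls then int (nat (lookup m (i, l))) else 0)"
      unfolding lookup_wtop[OF z] ls_def using count_concat_replicate[OF Ls(1)] by auto
    also have "\<dots> = lookup m (i, l)"
      using m LsD[of l i] by (auto simp: B_def)
    finally show ?thesis using True by simp
  next
    case False
    then show ?thesis
      using mI by (auto simp: wtop_def lookup_add lookup_sum_Ymon lz)
  qed
  then have "m = wtop i z ls" by (intro poly_mapping_eqI) auto
  with Et z show ?thesis by blast
qed

lemma wtop_inj: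
  assumes "trivial_at i z" "trivial_at i z'" "wtop i z ls = wtop i z' ls'"
  shows "mset ls = mset ls'" "z = z'"
proof -
  have "count (mset ls) l = count (mset ls') l" for l
    using lookup_wtop[OF assms(1), of ls l] lookup_wtop[OF assms(2), of ls' l] assms(3) by simp
  then show eq: "mset ls = mset ls'" by (rule multiset_eqI)
  have "sum_list (map (Ymon i) ls) = sum_list (map (Ymon i) ls')"
    by (metis eq mset_map sum_mset_sum_list)
  then show "z = z'" using assms(3) by (simp add: wtop_def)
qed

text \<open>For the leading monomial of the word, \<open>Et\<close> is up to a power of t a word
  with the same trivial factor and the same letters in another order. \<open>word_perm\<close>
  changes the order, with induction on the length for the error terms.\<close>

lemma word_in_Ksub:
  assumes "i \<in> I" "trivial_at i z"
  shows "word i z ls \<in> Ksub i"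
  using assms(2)
proof (induction "length ls" arbitrary: z ls rule: less_induct)
  case less
  let ?m = "wtop i z ls"
  have B: "?m \<in> B {i}" using wtop_in_B assms(1) less.prems by blast
  obtain c z' ls' where w: "trivial_at i z'" "Et i ?m = scal (tpow c) (word i z' ls')" "?m = wtop i z' ls'"
    using Et_word[OF assms(1) B] by blast
  have eq: "mset ls = mset ls'" "z = z'" using wtop_inj[OF less.prems w(1,3)] by auto
  have "scal 1 (Et i ?m) \<in> Ksub i" unfolding Ksub_def by (rule tspan_gen) (use B in auto)
  then have "scal (tpow c) (word i z' ls') \<in> Ksub i"
    by (simp only: w(2) scal_simps(3))
  then have "word i z ([] @ ls') \<in> Ksub i"
    unfolding eq(2) Ksub_def by (simp add: tspan_scal_unit)
  from word_perm[OF assms(1) eq(1) _ less.prems this] less.hyps show ?case by simp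
qed

text \<open>Up to powers of t the generators are words, and words multiply by concatenation. The
  letters of the result need not be sorted, which is why \<open>word_in_Ksub\<close> admits every
  order.\<close>

lemma Ksub_mult:
  assumes "i \<in> I" "x \<in> Ksub i" "y \<in> Ksub i"
  shows "tmult x y \<in> Ksub i"
proof -
  have gen: "tmult (Et i m) (Et i m') \<in> Ksub i" if m: "m \<in> B {i}" and m': "m' \<in> B {i}" for m m'
  proof -
    obtain c z ls where w: "trivial_at i z" "Et i m = scal (tpow c) (word i z ls)"
      using Et_word[OF assms(1) m] by blast
    obtain c' z' ls' where w': "trivial_at i z'" "Et i m' = scal (tpow c') (word i z' ls')"
      using Et_word[OF assms(1) m'] by blast
    obtain e where "tmult (word i z ls) (word i z' ls') = scal (tpow e) (word i (z + z') (ls @ ls'))"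
      using word_mult[OF assms(1) w'(1)] by blast
    then show ?thesis
      using word_in_Ksub[OF assms(1) trivial_at_add[OF w(1) w'(1)], of "ls @ ls'"]
      unfolding w(2) w'(2) tmult_scal by (simp add: Ksub_def tspan_scal)
  qed
  have left: "tmult x (Et i m') \<in> Ksub i" if "m' \<in> B {i}" for m'
    using assms(2) unfolding Ksub_def
    by (induction rule: tspan.induct)
      (use gen that in \<open>auto simp: tmult_add_left tmult_scal Ksub_def intro: tspan.zero tspan_add tspan_scal\<close>)
  show ?thesis
    using assms(3) unfolding Ksub_def
    by (induction rule: tspan.induct)
      (use left in \<open>auto simp: tmult_add_right tmult_scal Ksub_def intro: tspan.zero tspan_add tspan_scal\<close>)
qed

lemma Amon_nonzero: "i \<in> I \<Longrightarrow> Amon i l \<noteq> 0"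
  using ht_Amon[of i l] hA_pos ht_0 by auto

lemma leads_xgen:
  assumes "i \<in> I" shows "leads (xgen i l) (Ymon i l) 1"
  using Poly_Mapping.keys_add[of "nmon (Ymon i l)" "nmon (Ymon i l - Amon i (l + int (r i)))"] hA_pos
    ht_Amon[OF assms, of "l + int (r i)"] Amon_nonzero[OF assms, of "l + int (r i)"]
  unfolding leads_def xgen_def
  by (auto simp: lookup_add nmon_def lookup_single when_def ht_diff)

lemma leads_word:
  assumes "i \<in> I"
  shows "\<exists>c. leads (word i z ls) (wtop i z ls) (tpow c)"
proof -
  have "\<exists>c. leads (tprod (map (xgen i) ls)) (sum_list (map (Ymon i) ls)) (tpow c)"
  proof (induction ls)
    case Nil
    show ?case using leads_nmon[of 0] by (intro exI[of _ 0]) (simp add: tpow_0)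
  next
    case (Cons l ls)
    then show ?case
      using leads_tmult[OF leads_xgen[OF assms]] by (force simp: tpow_add)
  qed
  then show ?thesis
    unfolding word_def wtop_def using leads_tmult[OF leads_nmon] by (force simp: tpow_add)
qed

lemma keys_word:
  assumes "i \<in> I" "trivial_at i z"
  shows "keys (word i z ls) \<subseteq> box i (wtop i z ls)"
proof -
  have xs: "\<exists>M. M \<subseteq># mset ls \<and> q = sum_list (map (Ymon i) ls) - (\<Sum>l\<in>#M. Amon i (l + int (r i)))"
    if "q \<in> keys (tprod (map (xgen i) ls))" for q
    using that
  proof (induction ls arbitrary: q)
    case (Cons l ls)
    then obtain a b where ab: "a \<in> keys (xgen i l)"
      "b \<in> keys (tprod (map (xgen i) ls))" "q = a + b"
      by (auto elim: keys_tmult)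
    obtain M where M: "M \<subseteq># mset ls" "b = sum_list (map (Ymon i) ls) - (\<Sum>l\<in>#M. Amon i (l + int (r i)))"
      using Cons.IH[OF ab(2)] by blast
    have "a = Ymon i l \<or> a = Ymon i l - Amon i (l + int (r i))"
      using ab(1) Poly_Mapping.keys_add[of "nmon (Ymon i l)" "nmon (Ymon i l - Amon i (l + int (r i)))"]
      by (auto simp: xgen_def nmon_def)
    then show ?case
    proof
      assume "a = Ymon i l"
      moreover have "M \<subseteq># mset (l # ls)" using M(1) by (auto simp: subseteq_mset_def le_SucI)
      ultimately show ?thesis using M ab(3) by (intro exI[of _ M]) (auto simp: algebra_simps)
    next
      assume a: "a = Ymon i l - Amon i (l + int (r i))"
      show ?thesis
        unfolding ab(3) M(2) a using M(1)
        by (intro exI[of _ "add_mset l M"]) (simp add: algebra_simps)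
    qed
  qed (auto simp: nmon_def)
  show ?thesis
  proof
    fix q assume "q \<in> keys (word i z ls)"
    then obtain b where b: "b \<in> keys (tprod (map (xgen i) ls))" "q = z + b"
      unfolding word_def by (rule keys_tmult) (auto simp: nmon_def)
    obtain M where "M \<subseteq># mset ls" "b = sum_list (map (Ymon i) ls) - (\<Sum>l\<in>#M. Amon i (l + int (r i)))"
      using xs[OF b(1)] by blast
    then show "q \<in> box i (wtop i z ls)"
      unfolding box_def lookup_wtop[OF assms(2)] b(2)
      by (auto simp: wtop_def subseteq_mset_def algebra_simps intro!: exI[of _ M])
  qed
qed

lemma leads_Et:
  assumes "i \<in> I" "m \<in> B {i}"
  shows "\<exists>c. leads (Et i m) m (tpow c)"
proof -
  obtain c z ls where w: "Et i m = scal (tpow c) (word i z ls)" "m = wtop i z ls"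
    using Et_word[OF assms] by blast
  then show ?thesis
    using leads_word[OF assms(1), of z ls] leads_scal[of "word i z ls" m _ "tpow c"] by (force simp: tpow_add)
qed

lemma keys_Et:
  assumes "i \<in> I" "m \<in> B {i}"
  shows "keys (Et i m) \<subseteq> box i m"
proof -
  obtain c z ls where "trivial_at i z" "Et i m = scal (tpow c) (word i z ls)" "m = wtop i z ls"
    using Et_word[OF assms] by blast
  then show ?thesis using keys_word[OF assms(1), of z ls] keys_scal[of "tpow c" "word i z ls"] by auto
qed

text \<open>The highest monomials of an element of the span are $i$-dominant.\<close>

lemma Ksub_top_in_B:
  assumes i: "i \<in> I" and x: "x \<in> Ksub i" and m: "lookup x m \<noteq> 0"
    and top: "\<And>m'. ht m < ht m' \<Longrightarrow> lookup x m' = 0"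
  shows "m \<in> B {i}"
proof -
  obtain S c where S: "finite S" "S \<subseteq> B {i}" "x = (\<Sum>m\<in>S. scal (c m) (Et i m))"
    using tspan_image_sum[OF x[unfolded Ksub_def]] by blast
  define S' where "S' = {m \<in> S. c m \<noteq> 0}"
  have S': "finite S'" "S' \<subseteq> B {i}" using S by (auto simp: S'_def)
  have x': "lookup x q = (\<Sum>p\<in>S'. c p * lookup (Et i p) q)" for q
    unfolding S(3) lookup_sum lookup_scal using S(1) by (intro sum.mono_neutral_right) (auto simp: S'_def)
  have lead: "q = p \<or> ht q < ht p" if "p \<in> S'" "lookup (Et i p) q \<noteq> 0" for p q
    using leads_Et[OF i subsetD[OF S'(2) that(1)]] that(2) by (auto simp: leads_def in_keys_iff)
  obtain q where q: "q \<in> S'" "lookup (Et i q) m \<noteq> 0"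
  proof -
    have "\<exists>q\<in>S'. c q * lookup (Et i q) m \<noteq> 0"
      using m unfolding x' by (meson sum.neutral)
    then show ?thesis using that by auto
  qed
  have "finite (ht ` S')" "ht ` S' \<noteq> {}" using S'(1) q by auto
  \<comment> \<open>A highest index is visible in \<open>x\<close>: all other summands have a
    different leading monomial, at most as high, and their remaining monomials are lower.\<close>
  then obtain p where p: "p \<in> S'" "ht p = Max (ht ` S')" by (metis (no_types, lifting) Max_in imageE)
  have max: "ht p' \<le> ht p" if "p' \<in> S'" for p' using that p(2) S'(1) by auto
  have "lookup x p = (\<Sum>p'\<in>S'. if p' = p then c p * lookup (Et i p) p else 0)"
    unfolding x'
  proof (intro sum.cong refl)
    fix p' assume p': "p' \<in> S'"
    then have "p' \<noteq> p \<Longrightarrow> lookup (Et i p') p = 0"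
      using lead[of p' p] max[of p'] by force
    then show "c p' * lookup (Et i p') p = (if p' = p then c p * lookup (Et i p) p else 0)"
      by auto
  qed
  also have "\<dots> = c p * lookup (Et i p) p" using S'(1) p(1) by simp
  also have "\<dots> \<noteq> 0"
    using leads_Et[OF i subsetD[OF S'(2) p(1)]] p(1) tpow_nonzero by (auto simp: S'_def leads_def)
  finally have "ht p \<le> ht m" using top[of p] by (meson not_le)
  then have "m = q" using lead[OF q] max[OF q(1)] by linarith
  then show ?thesis using q(1) S'(2) by auto
qed

end

section \<open>Rank two\<close>

context finite_cartan_data
begin

lemma Ksub_add: "x \<in> Ksub i \<Longrightarrow> y \<in> Ksub i \<Longrightarrow> x + y \<in> Ksub i"
  unfolding Ksub_def by (rule tspan_add)

lemma nmon_in_Ksub: "i \<in> I \<Longrightarrow> trivial_at i z \<Longrightarrow> nmon z \<in> Ksub i"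
  using word_in_Ksub[of i z "[]"] by (simp add: word_def)

text \<open>A word with one letter. Its trivial factor commutes with A, so both terms carry the same
  power of t, which can be removed.\<close>

lemma pair_in_Ksub:
  assumes i: "i \<in> I" and m: "m \<in> monomials" "\<And>k. lookup m (i, k) = of_bool (k = l)"
  shows "nmon m + nmon (m - Amon i (l + int (r i))) \<in> Ksub i"
proof -
  define z where "z = m - Ymon i l"
  have z: "trivial_at i z"
    using m i by (auto simp: trivial_at_def z_def lookup_minus lookup_Ymon intro!: monomials_diff monomials_Ymon)
  have m_eq: "m = z + Ymon i l" by (simp add: z_def)
  have "word i z [l] = scal (tpow (N z (Ymon i l))) (nmon m + nmon (m - Amon i (l + int (r i))))"
    by (simp add: word_def xgen_def tmult_add_right nmon_mult scal_add_right N_diff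
        N_trivial_Amon[OF z i] m_eq add_diff_eq)
  then show ?thesis
    using word_in_Ksub[OF i z, of "[l]"] by (simp add: Ksub_def tspan_scal_unit)
qed

text \<open>The two-letter word with the larger index in front has four terms. One of them, m
  A_{i,l+r_i}^{-1}, is free of node i and lies in \<open>Ksub i\<close> by itself; subtracting it
  leaves a string of length three with equal powers of t.\<close>

lemma triple_in_Ksub:
  assumes i: "i \<in> I" and m: "m \<in> monomials"
    "\<And>k. lookup m (i, k) = of_bool (k = l) + of_bool (k = l + 2 * int (r i))"
  shows "nmon m + nmon (m - Amon i (l + 3 * int (r i)))
    + nmon (m - Amon i (l + 3 * int (r i)) - Amon i (l + int (r i))) \<in> Ksub i"
proof -
  define k where "k = l + 2 * int (r i)"
  define y0 y1 a b where "y0 = Ymon i l" and "y1 = Ymon i k" and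
    "a = Amon i (l + int (r i))" and "b = Amon i (k + int (r i))"
  note defs = y0_def y1_def a_def b_def
  have r: "r i > 0" using r_pos i by auto
  have b_eq: "Amon i (l + 3 * int (r i)) = b" by (simp add: b_def k_def algebra_simps)
  define z where "z = m - y0 - y1"
  have z: "trivial_at i z"
    using m i by (auto simp: trivial_at_def z_def defs k_def lookup_minus lookup_Ymon
        intro!: monomials_diff monomials_Ymon)
  have m_eq: "m = z + y0 + y1" by (simp add: z_def)
  have triv: "trivial_at i (m - a)"
    using m i by (auto simp: trivial_at_def a_def lookup_minus lookup_Amon_diag algebra_simps
        intro!: monomials_diff monomials_Amon)
  have N: "N y0 a = 1" "N y0 b = 0" "N y1 a = -1" "N y1 b = 1"
    "N a y0 = -1" "N b y0 = 0" "N a y1 = 1" "N b y1 = -1" "N a b = 1" "N b a = -1"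
    unfolding defs N_Y_A[OF i] N_A_A[OF i] N_A_Y[OF i] using r by (simp_all add: k_def)
  have Nz: "N z a = 0" "N z b = 0" unfolding defs using N_trivial_Amon[OF z i] by auto
  define f where "f = N z y0 + N z y1 + N y1 y0"
  have x: "xgen i k = nmon y1 + nmon (y1 - b)" "xgen i l = nmon y0 + nmon (y0 - a)"
    unfolding xgen_def defs by simp_all
  have "word i z [k, l] = scal (tpow f) (nmon m + nmon (m - b) + nmon (m - b - a))
      + scal (tpow (f + 1)) (nmon (m - a))"
    by (simp add: word_def x tmult_add_right tmult_add_left nmon_mult tmult_scal
        scal_add_right N_simps N Nz tpow_add m_eq f_def algebra_simps)
  moreover have "word i z [k, l] \<in> Ksub i" "nmon (m - a) \<in> Ksub i"
    using word_in_Ksub[OF i z] nmon_in_Ksub[OF i triv] by auto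
  ultimately have "scal (tpow f) (nmon m + nmon (m - b) + nmon (m - b - a)) \<in> Ksub i"
    unfolding Ksub_def by (metis (no_types, lifting) add_diff_cancel_right' tspan_diff tspan_scal)
  then show ?thesis unfolding b_eq by (simp add: Ksub_def tspan_scal_unit a_def)
qed

definition reach :: "nat set \<Rightarrow> mono \<Rightarrow> bool" where
  "reach J m \<longleftrightarrow> (\<exists>x c. (\<forall>i\<in>J. x \<in> Ksub i) \<and> leads x m c \<and> c \<noteq> 0)"

lemma reachI: "(\<And>i. i \<in> J \<Longrightarrow> x \<in> Ksub i) \<Longrightarrow> leads x m c \<Longrightarrow> c \<noteq> 0 \<Longrightarrow> reach J m"
  unfolding reach_def by blast

lemma reach_add:
  assumes "J \<subseteq> I" "reach J m" "reach J m'"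
  shows "reach J (m + m')"
proof -
  obtain x c y d where "\<forall>i\<in>J. x \<in> Ksub i" "leads x m c" "c \<noteq> 0"
    "\<forall>i\<in>J. y \<in> Ksub i" "leads y m' d" "d \<noteq> 0"
    using assms(2,3) unfolding reach_def by blast
  then show ?thesis
    using assms(1) tpow_nonzero
    by (intro reachI[where x = "tmult x y" and c = "tpow (N m m') * c * d"] leads_tmult Ksub_mult) auto
qed

lemma reach_trivial:
  assumes "J \<subseteq> I" "\<And>i. i \<in> J \<Longrightarrow> trivial_at i z"
  shows "reach J z"
  using assms leads_nmon[of z] by (intro reachI[where x = "nmon z"] nmon_in_Ksub) auto

lemma reach_sum:
  assumes "J \<subseteq> I" "\<And>x. x \<in> S \<Longrightarrow> reach J (f x)"
  shows "reach J (\<Sum>x\<in>S. f x)"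
  using assms(2)
  by (induction S rule: infinite_finite_induct)
    (auto intro: reach_add[OF assms(1)] reach_trivial[OF assms(1)] trivial_at_0)

lemma reach_dominant:
  assumes J: "J \<subseteq> I" and Y: "\<And>j l. j \<in> J \<Longrightarrow> reach J (Ymon j l)" and m: "m \<in> B J"
  shows "reach J m"
proof -
  have *: "reach J (Poly_Mapping.single (j, l) (int k))" if "j \<in> J" for j l k
  proof (induction k)
    case 0
    show ?case using reach_trivial[OF J trivial_at_0] by simp
  next
    case (Suc k)
    then show ?case
      using reach_add[OF J Y[OF that, of l] Suc] by (simp add: Ymon_def flip: single_add)
  qed
  have "reach J (Poly_Mapping.single p (lookup m p))" if "p \<in> keys m" for p
  proof (cases "fst p \<in> J")
    case True
    then have "0 \<le> lookup m p" using m by (cases p) (auto simp: B_def)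
    then show ?thesis using *[of "fst p" "snd p" "nat (lookup m p)"] True by simp
  next
    case False
    have "p \<in> I \<times> UNIV" using m that by (auto simp: B_def monomials_def)
    with False show ?thesis
      by (intro reach_trivial[OF J]) (auto simp: trivial_at_def monomials_def lookup_single when_def)
  qed
  then have "reach J (\<Sum>p\<in>keys m. Poly_Mapping.single p (lookup m p))"
    by (rule reach_sum[OF J])
  then show ?thesis by (simp only: mono_as_sum[of m, symmetric])
qed

lemma leads_diff: "leads x m (c :: tpoly) \<Longrightarrow> leads y m d \<Longrightarrow> leads (x - y) m (c - d)"
  using keys_diff_subset[of x y] unfolding leads_def by (auto simp: lookup_minus)

lemma leads_add_lower:
  assumes "leads x m (c :: tpoly)" "\<And>q. q \<in> keys y \<Longrightarrow> ht q < ht m"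
  shows "leads (x + y) m c"
  using assms(1) assms(2)[of m] assms(2) Poly_Mapping.keys_add[of x y] unfolding leads_def
  by (auto simp: lookup_add in_keys_iff)

lemma tmult_nmon_comm:
  assumes "\<And>q. q \<in> keys x \<Longrightarrow> N a q = e" "\<And>q. q \<in> keys x \<Longrightarrow> N q a = f"
  shows "tmult (nmon a) x = scal (tpow (e - f)) (tmult x (nmon a))"
proof -
  have "tmult (nmon a) x = (\<Sum>q\<in>keys x. Poly_Mapping.single (a + q) (tpow e * lookup x q))"
    using assms(1) by (subst tmult_superset[of "{a}" "keys x"])
      (auto simp: nmon_def lookup_single split: if_splits intro!: sum.cong)
  moreover have "tmult x (nmon a) = (\<Sum>q\<in>keys x. Poly_Mapping.single (a + q) (tpow f * lookup x q))"
    using assms(2) by (subst tmult_superset[of "keys x" "{a}"])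
      (auto simp: nmon_def lookup_single add.commute split: if_splits intro!: sum.cong)
  ultimately show ?thesis
    by (simp add: scal_sum tpow_add_left)
qed

text \<open>The leading terms of two fundamental elements of the same node commute up to a power of $t$;
  the corresponding commutator starts with the fundamental monomial of the adjacent node.\<close>

lemma reach_adjacent:
  assumes sL: "s \<in> I" "L \<in> I" "s \<noteq> L" "C L s = -1"
    and R: "\<And>l. leads (R l) (Ymon s l - Amon s (l + int (r s))) 1"
    and mem: "\<And>l i. i \<in> {s, L} \<Longrightarrow> nmon (Ymon s l) + R l \<in> Ksub i"
    and N: "\<And>l q. q \<in> keys (R l) \<Longrightarrow>
      N (Ymon s (l - 2 * int (r s))) q = N (Ymon s (l - 2 * int (r s))) (Ymon s l) \<and>
      N q (Ymon s (l - 2 * int (r s))) = N (Ymon s l) (Ymon s (l - 2 * int (r s)))"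
  shows "reach {s, L} (Ymon s l)" "reach {s, L} (Ymon L l)"
proof -
  have rs: "r s > 0" using r_pos sL by auto
  have J: "{s, L} \<subseteq> I" using sL by auto
  define X where "X l = nmon (Ymon s l) + R l" for l
  have X: "leads (X l) (Ymon s l) 1" for l
    unfolding X_def using R[of l] hA_pos ht_Amon[OF sL(1), of "l + int (r s)"]
    by (intro leads_add_lower[OF leads_nmon]) (auto simp: leads_def ht_diff)
  show "reach {s, L} (Ymon s l)"
    using X[of l] mem[of _ l] by (intro reachI[of "{s, L}" "X l"]) (auto simp: X_def)
  \<comment> \<open>The two shifts are centered at \<open>l\<close>, so that \<open>a\<close> is
    A_{s,l}: it contains Y_{s,k} and Y_{s,k'}, and the inverse of Y_{L,l} exactly once because
    C_{L,s} = -1.\<close>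
  define k where "k = l - int (r s)"
  define k' where "k' = k + 2 * int (r s)"
  define a where "a = Amon s (k + int (r s))"
  define e f where "e = N (Ymon s k) (Ymon s k')" and "f = N (Ymon s k') (Ymon s k)"
  define Z where "Z = tmult (X k) (X k') - scal (tpow (e - f)) (tmult (X k') (X k))"
  have Na: "N a (Ymon s k') = 1" "N (Ymon s k') a = -1"
    unfolding a_def N_Y_A[OF sL(1)] N_A_Y[OF sL(1)] using rs by (auto simp: k'_def)
  \<comment> \<open>By the hypothesis on \<open>N\<close>, all monomials of \<open>X k'\<close> pair
    with Y_{s,k} as the leading one does. So the contribution of the leading term of
    \<open>X k\<close> drops out of the commutator exactly, and \<open>R k\<close> decides its
    leading term.\<close>
  have "tmult (nmon (Ymon s k)) (X k') = scal (tpow (e - f)) (tmult (X k') (nmon (Ymon s k)))"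
  proof (rule tmult_nmon_comm)
    fix q assume "q \<in> keys (X k')"
    then have "q = Ymon s k' \<or> q \<in> keys (R k')"
      unfolding X_def using Poly_Mapping.keys_add[of "nmon (Ymon s k')" "R k'"] by (auto simp: nmon_def)
    then show "N (Ymon s k) q = e" "N q (Ymon s k) = f"
      using N[of q k'] by (auto simp: e_def f_def k'_def)
  qed
  then have "Z = tmult (R k) (X k') - scal (tpow (e - f)) (tmult (X k') (R k))"
    unfolding Z_def X_def[of k] by (simp add: tmult_add_left tmult_add_right scal_add_right)
  moreover have "leads (tmult (R k) (X k')) (Ymon s k - a + Ymon s k') (tpow (e - 1))"
    using leads_tmult[OF R[of k] X[of k']] by (simp add: N_diff Na e_def flip: a_def)
  moreover have "leads (tmult (X k') (R k)) (Ymon s k - a + Ymon s k') (tpow (f + 1))"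
    using leads_tmult[OF X[of k'] R[of k]] by (simp add: N_diff Na f_def add.commute flip: a_def)
  moreover from leads_scal[OF this, of "tpow (e - f)"]
  have "leads (scal (tpow (e - f)) (tmult (X k') (R k))) (Ymon s k - a + Ymon s k') (tpow (e + 1))"
    by (simp add: tpow_add)
  ultimately have "leads Z (Ymon s k - a + Ymon s k') (tpow (e - 1) - tpow (e + 1))"
    by (simp only: leads_diff)
  moreover have "tpow (e - 1) - tpow (e + 1) \<noteq> 0"
    by (simp add: tpow_inj)
  moreover have "Z \<in> Ksub i" if "i \<in> {s, L}" for i
    using mem[OF that] that J unfolding Z_def X_def Ksub_def
    by (intro tspan_diff tspan_scal Ksub_mult[unfolded Ksub_def]) (auto simp: Ksub_def)
  ultimately have 1: "reach {s, L} (Ymon s k - a + Ymon s k')"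
    by (intro reachI) auto
  \<comment> \<open>The correction collects the other neighbours of \<open>s\<close>, with inverse
    sign; it is trivial at both \<open>s\<close> and \<open>L\<close>.\<close>
  define z where "z = Ymon L l - (Ymon s k - a + Ymon s k')"
  have "trivial_at i z" if "i \<in> {s, L}" for i
    unfolding trivial_at_def
  proof (intro conjI allI)
    show "z \<in> monomials"
      unfolding z_def a_def using sL by (intro monomials_diff monomials_add monomials_Ymon monomials_Amon)
    fix l'
    have z: "z = Ymon L l - (Ymon s (l - int (r s)) - Amon s l + Ymon s (l + int (r s)))"
      by (simp add: z_def a_def k'_def k_def add.commute)
    show "lookup z (i, l') = 0"
    proof (cases "i = s")
      case True
      then show ?thesis
        using sL by (simp add: z lookup_minus lookup_add lookup_Ymon lookup_Amon_diag eq_commute[of l'])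
    next
      case False
      then show ?thesis
        using that sL by (simp add: z lookup_minus lookup_add lookup_Ymon lookup_Amon zcoeff_Cz eq_commute[of l'])
    qed
  qed
  then have "reach {s, L} ((Ymon s k - a + Ymon s k') + z)"
    by (intro reach_add[OF J 1] reach_trivial[OF J])
  then show "reach {s, L} (Ymon L l)" by (simp add: z_def)
qed

lemma keys_nmon [simp]: "keys (nmon m) = {m}"
  by (simp add: nmon_def)

text \<open>For unconnected nodes both terms of the generator at \<open>s\<close> are free of node
  \<open>L\<close>.\<close>

lemma reach_A1_A1:
  assumes "s \<in> I" "L \<in> I" "s \<noteq> L" "C L s = 0"
  shows "reach {s, L} (Ymon s l)"
proof -
  let ?m = "Ymon s l - Amon s (l + int (r s))"
  have "trivial_at L (Ymon s l)" "trivial_at L ?m"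
    using assms by (auto simp: trivial_at_def lookup_minus lookup_Ymon lookup_Amon zcoeff_Cz
        intro!: monomials_diff monomials_Ymon monomials_Amon)
  then have "xgen s l \<in> Ksub L"
    unfolding xgen_def using nmon_in_Ksub[OF assms(2)] by (auto simp: Ksub_def intro: tspan_add)
  moreover have "xgen s l \<in> Ksub s"
    unfolding xgen_def using assms by (intro pair_in_Ksub) (auto simp: monomials_Ymon lookup_Ymon)
  ultimately show ?thesis
    using leads_xgen[OF assms(1)] by (intro reachI[where x = "xgen s l"]) auto
qed

lemmas fund_simps = lookup_minus lookup_Ymon lookup_Amon zcoeff_Cz N_simps N_Ymon_Amon N_Amon_Ymon
  ht_simps ht_Amon

text \<open>The fundamental representation of dimension 3: node \<open>s\<close> sees the strings
  {Y, m1}, {m2}, and node \<open>L\<close> sees {Y}, {m1, m2}.\<close>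

lemma reach_A2:
  assumes sL: "s \<in> I" "L \<in> I" "s \<noteq> L" "C L s = -1" "C s L = -1"
  shows "reach {s, L} (Ymon s l)" "reach {s, L} (Ymon L l)"
proof -
  have rr: "r L = r s" using symmetrized[OF sL(1,2)] sL by auto
  have rs: "r s > 0" using r_pos sL by auto
  define m1 where "m1 l = Ymon s l - Amon s (l + int (r s))" for l
  define m2 where "m2 l = m1 l - Amon L (l + 2 * int (r s))" for l
  define R where "R l = nmon (m1 l) + nmon (m2 l)" for l
  have mon: "Ymon s l \<in> monomials" "m1 l \<in> monomials" "m2 l \<in> monomials" for l
    unfolding m2_def m1_def using sL by (intro monomials_diff monomials_Ymon monomials_Amon; simp)+
  have s: "lookup (m2 l) (s, k) = 0" for k l
    using sL by (simp add: m1_def m2_def fund_simps)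
  have L: "lookup (m1 l) (L, k) = of_bool (k = l + int (r s))" for k l
    using sL by (simp add: m1_def m2_def fund_simps)
  have "nmon (Ymon s l) + nmon (m1 l) \<in> Ksub s" "nmon (m2 l) \<in> Ksub s"
    "nmon (Ymon s l) \<in> Ksub L" "nmon (m1 l) + nmon (m2 l) \<in> Ksub L" for l
  proof -
    show "nmon (Ymon s l) + nmon (m1 l) \<in> Ksub s"
      unfolding m1_def using mon sL by (intro pair_in_Ksub) (auto simp: lookup_Ymon)
    show "nmon (m2 l) \<in> Ksub s"
      using mon s sL by (intro nmon_in_Ksub) (auto simp: trivial_at_def)
    show "nmon (Ymon s l) \<in> Ksub L"
      using mon sL by (intro nmon_in_Ksub) (auto simp: trivial_at_def lookup_Ymon)
    show "nmon (m1 l) + nmon (m2 l) \<in> Ksub L"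
      using pair_in_Ksub[OF sL(2) mon(2) L, of l] by (simp add: m2_def rr algebra_simps)
  qed
  then have mem: "nmon (Ymon s l) + R l \<in> Ksub i" if "i \<in> {s, L}" for i l
    using that unfolding R_def Ksub_def by (auto intro: tspan_add simp: add.assoc[symmetric])
      (auto intro: tspan_add simp: add.assoc)
  have lead: "leads (R l) (Ymon s l - Amon s (l + int (r s))) 1" for l
    unfolding R_def m1_def[symmetric] using sL hA_pos
    by (intro leads_add_lower[OF leads_nmon]) (auto simp: m2_def fund_simps)
  have N: "N (Ymon s (l - 2 * int (r s))) q = N (Ymon s (l - 2 * int (r s))) (Ymon s l) \<and>
      N q (Ymon s (l - 2 * int (r s))) = N (Ymon s l) (Ymon s (l - 2 * int (r s)))"
    if "q \<in> keys (R l)" for l q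
  proof -
    have "q \<in> {m1 l, m2 l}"
      using that Poly_Mapping.keys_add[of "nmon (m1 l)" "nmon (m2 l)"] by (auto simp: R_def)
    then show ?thesis using sL rs by (auto simp: m1_def m2_def fund_simps)
  qed
  show "reach {s, L} (Ymon s l)" "reach {s, L} (Ymon L l)"
    by (rule reach_adjacent[OF sL(1-4) lead mem N]; assumption)+
qed


text \<open>The fold is a sum bracketed to the right without a final 0, the shape into which
  \<open>add.assoc\<close> brings the explicit sums below.\<close>

lemma keys_sum_nmon: "xs \<noteq> [] \<Longrightarrow> keys (foldr (\<lambda>m x. nmon m + x) (butlast xs) (nmon (last xs))) \<subseteq> set xs"
proof (induction xs)
  case (Cons m xs)
  show ?case
  proof (cases "xs = []")
    case False
    then show ?thesis
      using Cons.IH Poly_Mapping.keys_add[of "nmon m" "foldr (\<lambda>m x. nmon m + x) (butlast xs) (nmon (last xs))"]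
      by auto
  qed simp
qed simp

text \<open>\<open>s\<close> is the short node, with fundamental representation of dimension 4. The
  strings are {Y, m1}, {m2, m3} at \<open>s\<close> and {Y}, {m1, m2}, {m3} at \<open>L\<close>. The
  shifts are forced: m1 contains Y_{L,l+1}, which calls for A_{L,l+3} as r_L = 2, and m2 contains
  Y_{s,l+4}, which calls for A_{s,l+5}.\<close>

lemma reach_B2:
  assumes sL: "s \<in> I" "L \<in> I" "s \<noteq> L" "C L s = -1" "C s L = -2"
  shows "reach {s, L} (Ymon s l)" "reach {s, L} (Ymon L l)"
proof -
  have rs: "r s = 1" using r_eq_1_if_multiple[OF sL(1,2)] sL by auto
  have rL: "r L = 2" using symmetrized[OF sL(1,2)] sL rs by auto
  define m1 where "m1 l = Ymon s l - Amon s (l + 1)" for l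
  define m2 where "m2 l = m1 l - Amon L (3 + l)" for l
  define m3 where "m3 l = m2 l - Amon s (5 + l)" for l
  define R where "R l = nmon (m1 l) + nmon (m2 l) + nmon (m3 l)" for l
  have mon: "Ymon s l \<in> monomials" "m1 l \<in> monomials" "m2 l \<in> monomials" "m3 l \<in> monomials" for l
    unfolding m3_def m2_def m1_def using sL
    by (intro monomials_diff monomials_Ymon monomials_Amon; simp)+
  have s: "lookup (m2 l) (s, k) = of_bool (k = l + 4)" for k l
    using sL by (simp_all add: m1_def m2_def m3_def fund_simps rs rL)
  have L: "lookup (m1 l) (L, k) = of_bool (k = l + 1)"
    "lookup (m3 l) (L, k) = 0" for k l
    using sL by (simp_all add: m1_def m2_def m3_def fund_simps rs rL)
  have P0s: "nmon (Ymon s l) + nmon (m1 l) \<in> Ksub s" for l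
    using pair_in_Ksub[of s "Ymon s l" l] mon sL by (simp add: m1_def rs lookup_Ymon)
  have T0L: "nmon (Ymon s l) \<in> Ksub L" for l
    using mon sL by (intro nmon_in_Ksub) (auto simp: trivial_at_def lookup_Ymon)
  have P2s: "nmon (m2 l) + nmon (m3 l) \<in> Ksub s" for l
    using pair_in_Ksub[of s "m2 l" "l + 4"] mon s sL by (simp add: m3_def rs rL)
  have P1L: "nmon (m1 l) + nmon (m2 l) \<in> Ksub L" for l
    using pair_in_Ksub[of L "m1 l" "l + 1"] mon L sL by (simp add: m2_def rs rL)
  have T3L: "nmon (m3 l) \<in> Ksub L" for l
    using mon L sL by (intro nmon_in_Ksub) (auto simp: trivial_at_def)
  have mem: "nmon (Ymon s l) + R l \<in> Ksub i" if "i \<in> {s, L}" for i l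
  proof -
    have "(nmon (Ymon s l) + nmon (m1 l)) + (nmon (m2 l) + nmon (m3 l)) \<in> Ksub s"
      "nmon (Ymon s l) + (nmon (m1 l) + nmon (m2 l)) + nmon (m3 l) \<in> Ksub L"
      by (simp_all only: Ksub_add P0s P2s T0L P1L T3L)
    then show ?thesis using that by (auto simp: R_def add.assoc)
  qed
  have lead: "leads (R l) (Ymon s l - Amon s (l + int (r s))) 1" for l
  proof -
    have "ht q < ht (m1 l)" if "q \<in> keys (nmon (m2 l) + nmon (m3 l))" for q
    proof -
      have "q \<in> {m2 l, m3 l}"
        using that keys_sum_nmon[of "[m2 l, m3 l]"] by (auto simp: add.assoc)
      then show ?thesis using sL hA_pos by (auto simp: m1_def m2_def m3_def fund_simps)
    qed
    then have "leads (nmon (m1 l) + (nmon (m2 l) + nmon (m3 l))) (m1 l) 1"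
      by (intro leads_add_lower[OF leads_nmon])
    then show ?thesis by (simp add: R_def m1_def rs add.assoc)
  qed
  have N: "N (Ymon s (l - 2 * int (r s))) q = N (Ymon s (l - 2 * int (r s))) (Ymon s l) \<and>
      N q (Ymon s (l - 2 * int (r s))) = N (Ymon s l) (Ymon s (l - 2 * int (r s)))"
    if "q \<in> keys (R l)" for l q
  proof -
    have "q \<in> {m1 l, m2 l, m3 l}"
      using that keys_sum_nmon[of "[m1 l, m2 l, m3 l]"] by (auto simp: R_def add.assoc)
    then show ?thesis using sL by (auto simp: m1_def m2_def m3_def fund_simps rs rL)
  qed
  show "reach {s, L} (Ymon s l)" "reach {s, L} (Ymon L l)"
    by (rule reach_adjacent[OF sL(1-4) lead mem N]; assumption)+
qed

text \<open>\<open>s\<close> is the short node, with fundamental representation of dimension 7. The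
  strings are {Y, m1}, {m2, m3, m4}, {m5, m6} at \<open>s\<close> and {Y}, {m1, m2}, {m3}, {m4, m5},
  {m6} at \<open>L\<close>. The string of length three arises because division by A_{L,l+4} puts
  Y_{s,l+4} Y_{s,l+6} into m2.\<close>

lemma reach_G2:
  assumes sL: "s \<in> I" "L \<in> I" "s \<noteq> L" "C L s = -1" "C s L = -3"
  shows "reach {s, L} (Ymon s l)" "reach {s, L} (Ymon L l)"
proof -
  have rs: "r s = 1" using r_eq_1_if_multiple[OF sL(1,2)] sL by auto
  have rL: "r L = 3" using symmetrized[OF sL(1,2)] sL rs by auto
  define m1 where "m1 l = Ymon s l - Amon s (l + 1)" for l
  define m2 where "m2 l = m1 l - Amon L (4 + l)" for l
  define m3 where "m3 l = m2 l - Amon s (7 + l)" for l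
  define m4 where "m4 l = m3 l - Amon s (5 + l)" for l
  define m5 where "m5 l = m4 l - Amon L (8 + l)" for l
  define m6 where "m6 l = m5 l - Amon s (11 + l)" for l
  define R where "R l = nmon (m1 l) + nmon (m2 l) + nmon (m3 l) + nmon (m4 l) + nmon (m5 l) + nmon (m6 l)" for l
  have mon: "Ymon s l \<in> monomials" "m1 l \<in> monomials" "m2 l \<in> monomials" "m3 l \<in> monomials" "m4 l \<in> monomials" "m5 l \<in> monomials" "m6 l \<in> monomials" for l
    unfolding m6_def m5_def m4_def m3_def m2_def m1_def using sL
    by (intro monomials_diff monomials_Ymon monomials_Amon; simp)+
  have s: "lookup (m2 l) (s, k) = of_bool (k = l + 4) + of_bool (k = 6 + l)"
    "lookup (m5 l) (s, k) = of_bool (k = l + 10)" for k l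
    using sL by (simp_all add: m1_def m2_def m3_def m4_def m5_def m6_def fund_simps rs rL)
  have L: "lookup (m1 l) (L, k) = of_bool (k = l + 1)"
    "lookup (m3 l) (L, k) = 0"
    "lookup (m4 l) (L, k) = of_bool (k = l + 5)"
    "lookup (m6 l) (L, k) = 0" for k l
    using sL by (simp_all add: m1_def m2_def m3_def m4_def m5_def m6_def fund_simps rs rL)
  have P0s: "nmon (Ymon s l) + nmon (m1 l) \<in> Ksub s" for l
    using pair_in_Ksub[of s "Ymon s l" l] mon sL by (simp add: m1_def rs lookup_Ymon)
  have T0L: "nmon (Ymon s l) \<in> Ksub L" for l
    using mon sL by (intro nmon_in_Ksub) (auto simp: trivial_at_def lookup_Ymon)
  have Q2s: "nmon (m2 l) + nmon (m3 l) + nmon (m4 l) \<in> Ksub s" for l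
    using triple_in_Ksub[of s "m2 l" "l + 4"] mon s sL by (simp add: m3_def m4_def rs)
  have P5s: "nmon (m5 l) + nmon (m6 l) \<in> Ksub s" for l
    using pair_in_Ksub[of s "m5 l" "l + 10"] mon s sL by (simp add: m6_def rs rL)
  have P1L: "nmon (m1 l) + nmon (m2 l) \<in> Ksub L" for l
    using pair_in_Ksub[of L "m1 l" "l + 1"] mon L sL by (simp add: m2_def rs rL)
  have T3L: "nmon (m3 l) \<in> Ksub L" for l
    using mon L sL by (intro nmon_in_Ksub) (auto simp: trivial_at_def)
  have P4L: "nmon (m4 l) + nmon (m5 l) \<in> Ksub L" for l
    using pair_in_Ksub[of L "m4 l" "l + 5"] mon L sL by (simp add: m5_def rs rL)
  have T6L: "nmon (m6 l) \<in> Ksub L" for l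
    using mon L sL by (intro nmon_in_Ksub) (auto simp: trivial_at_def)
  have mem: "nmon (Ymon s l) + R l \<in> Ksub i" if "i \<in> {s, L}" for i l
  proof -
    have "(nmon (Ymon s l) + nmon (m1 l)) + (nmon (m2 l) + nmon (m3 l) + nmon (m4 l))
        + (nmon (m5 l) + nmon (m6 l)) \<in> Ksub s"
      "nmon (Ymon s l) + (nmon (m1 l) + nmon (m2 l)) + nmon (m3 l) + (nmon (m4 l) + nmon (m5 l))
        + nmon (m6 l) \<in> Ksub L"
      by (simp_all only: Ksub_add P0s Q2s P5s T0L P1L T3L P4L T6L)
    then show ?thesis using that by (auto simp: R_def add.assoc)
  qed
  have lead: "leads (R l) (Ymon s l - Amon s (l + int (r s))) 1" for l
  proof -
    have "ht q < ht (m1 l)" if "q \<in> keys (nmon (m2 l) + nmon (m3 l) + nmon (m4 l) + nmon (m5 l) + nmon (m6 l))" for q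
    proof -
      have "q \<in> {m2 l, m3 l, m4 l, m5 l, m6 l}"
        using that keys_sum_nmon[of "[m2 l, m3 l, m4 l, m5 l, m6 l]"] by (auto simp: add.assoc)
      then show ?thesis using sL hA_pos by (auto simp: m1_def m2_def m3_def m4_def m5_def m6_def fund_simps)
    qed
    then have "leads (nmon (m1 l) + (nmon (m2 l) + nmon (m3 l) + nmon (m4 l) + nmon (m5 l) + nmon (m6 l))) (m1 l) 1"
      by (intro leads_add_lower[OF leads_nmon])
    then show ?thesis by (simp add: R_def m1_def rs add.assoc)
  qed
  have N: "N (Ymon s (l - 2 * int (r s))) q = N (Ymon s (l - 2 * int (r s))) (Ymon s l) \<and>
      N q (Ymon s (l - 2 * int (r s))) = N (Ymon s l) (Ymon s (l - 2 * int (r s)))"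
    if "q \<in> keys (R l)" for l q
  proof -
    have "q \<in> {m1 l, m2 l, m3 l, m4 l, m5 l, m6 l}"
      using that keys_sum_nmon[of "[m1 l, m2 l, m3 l, m4 l, m5 l, m6 l]"] by (auto simp: R_def add.assoc)
    then show ?thesis using sL by (auto simp: m1_def m2_def m3_def m4_def m5_def m6_def fund_simps rs rL)
  qed
  show "reach {s, L} (Ymon s l)" "reach {s, L} (Ymon L l)"
    by (rule reach_adjacent[OF sL(1-4) lead mem N]; assumption)+
qed

lemma reach_rank2:
  assumes ij: "i \<in> I" "j \<in> I" "i \<noteq> j" and m: "m \<in> B {i, j}"
  shows "reach {i, j} m"
proof -
  have adjacent: "reach {s, L} (Ymon s l) \<and> reach {s, L} (Ymon L l)"
    if sL: "s \<in> I" "L \<in> I" "s \<noteq> L" "C L s = -1" and C: "C s L \<in> {-1, -2, -3}" for s L l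
  proof -
    consider "C s L = -1" | "C s L = -2" | "C s L = -3" using C by blast
    then show ?thesis
      by cases (blast intro: reach_A2[OF sL] reach_B2[OF sL] reach_G2[OF sL])+
  qed
  have swap: "{j, i} = {i, j}" by blast
  have "reach {i, j} (Ymon i l) \<and> reach {i, j} (Ymon j l)" for l
  proof (cases "C j i = 0")
    case True
    then have "C i j = 0" using zero_sym ij by auto
    then show ?thesis
      using reach_A1_A1[OF ij True, of l] reach_A1_A1[OF ij(2,1) ij(3)[symmetric], of l] unfolding swap by blast
  next
    case False
    then consider "C j i = -1" "C i j \<in> {-1, -2, -3}" | "C i j = -1" "C j i \<in> {-1, -2, -3}"
      using C_cases[OF ij(2,1) ij(3)[symmetric]] by blast
    then show ?thesis
    proof cases
      case 1
      then show ?thesis using adjacent[OF ij 1] by blast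
    next
      case 2
      then show ?thesis
        using adjacent[OF ij(2,1) ij(3)[symmetric] 2, of l] unfolding swap by blast
    qed
  qed
  then have Y: "reach {i, j} (Ymon k l)" if "k \<in> {i, j}" for k l
    using that by blast
  have J: "{i, j} \<subseteq> I" using ij by blast
  show ?thesis by (rule reach_dominant[OF J Y m])
qed

end

section \<open>The algorithm\<close>

context finite_cartan_data
begin

lemma Et_in_Ksub: "p \<in> B {i} \<Longrightarrow> scal c (Et i p) \<in> Ksub i"
  unfolding Ksub_def by (intro tspan_gen) auto

lemma lookup_Et_above:
  assumes "i \<in> I" "p \<in> B {i}" "ht p \<le> ht q" "q \<noteq> p"
  shows "lookup (Et i p) q = 0"
  using leads_Et[OF assms(1,2)] assms(3,4) by (force simp: leads_def in_keys_iff)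

text \<open>Two partial solutions for the nodes $i$ and $j$ that agree above height $H$ also agree at
  height $H$ wherever both are forced: subtract common elements of rank two until nothing is left
  above $H$. Leading coefficients need only be nonzero, as the coefficient ring is a domain.\<close>

lemma Ksub_consistent:
  assumes ij: "i \<in> I" "j \<in> I" "i \<noteq> j" and x: "x \<in> Ksub i" and y: "y \<in> Ksub j"
    and eq: "\<And>q. H < ht q \<Longrightarrow> lookup x q = lookup y q"
    and m: "ht m = H" "m \<notin> B {i}" "m \<notin> B {j}"
  shows "lookup x m = lookup y m"
proof -
  have main: "lookup x m = lookup y m"
    if "x \<in> Ksub i" "y \<in> Ksub j" "\<And>q. H < ht q \<Longrightarrow> lookup x q = lookup y q"
      "\<And>q. H + int k < ht q \<Longrightarrow> lookup x q = 0" for k x y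
    using that
  proof (induction k arbitrary: x y)
    case 0
    \<comment> \<open>Nothing is left above height \<open>H\<close>, so a nonzero coefficient would
      make \<open>m\<close> a top monomial and hence i-dominant.\<close>
    have "lookup x m = 0"
      using Ksub_top_in_B[OF ij(1) 0(1)] 0(4) m by force
    moreover have "lookup y m = 0"
      using Ksub_top_in_B[OF ij(2) 0(2)] 0(3,4) m by force
    ultimately show ?case by simp
  next
    case (Suc k)
    define h where "h = H + int (Suc k)"
    have h: "H < h" by (simp add: h_def)
    define T where "T = {q \<in> keys x. ht q = h}"
    have T: "finite T" "\<And>q. q \<in> T \<Longrightarrow> ht q = h" "\<And>q. ht q = h \<Longrightarrow> lookup x q \<noteq> 0 \<Longrightarrow> q \<in> T"
      by (auto simp: T_def in_keys_iff)
    have "reach {i, j} q" if q: "q \<in> T" for q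
    proof -
      have xq: "lookup x q \<noteq> 0" "ht q = h" using q by (auto simp: T_def in_keys_iff)
      have "q \<in> B {i}"
        using Ksub_top_in_B[OF ij(1) Suc.prems(1) xq(1)] Suc.prems(4) xq(2) by (simp add: h_def)
      moreover have "q \<in> B {j}"
        using Ksub_top_in_B[OF ij(2) Suc.prems(2), of q] Suc.prems(3)[of q] Suc.prems(3,4) xq h
        by (auto simp: h_def)
      ultimately have "q \<in> B {i, j}" by (simp add: B_def)
      then show ?thesis by (rule reach_rank2[OF ij])
    qed
    then have "\<forall>q\<in>T. \<exists>p. fst p \<in> Ksub i \<and> fst p \<in> Ksub j \<and> leads (fst p) q (snd p) \<and> snd p \<noteq> 0"
      unfolding reach_def by auto
    from bchoice[OF this] obtain gc where gc: "\<And>q. q \<in> T \<Longrightarrow> fst (gc q) \<in> Ksub i \<and> fst (gc q) \<in> Ksub j \<and>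
        leads (fst (gc q)) q (snd (gc q)) \<and> snd (gc q) \<noteq> 0"
      by blast
    define g where "g q = fst (gc q)" for q
    define c where "c q = snd (gc q)" for q
    have g: "g q \<in> Ksub i" "g q \<in> Ksub j" "leads (g q) q (c q)" "c q \<noteq> 0" if "q \<in> T" for q
      using gc[OF that] by (auto simp: g_def c_def)
    \<comment> \<open>A common multiple of the leading coefficients, which need not be units:
      \<open>w\<close> is made to match c' x, and not x itself, from height \<open>h\<close>
      upwards.\<close>
    define c' where "c' = (\<Prod>q\<in>T. c q)"
    have c': "c' \<noteq> 0" using T(1) g(4) by (simp add: c'_def)
    define w where "w = (\<Sum>q\<in>T. scal (lookup x q * (\<Prod>p\<in>T - {q}. c p)) (g q))"
    have w_i: "w \<in> Ksub i" and w_j: "w \<in> Ksub j"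
      unfolding w_def Ksub_def using g(1,2) by (auto simp: Ksub_def intro!: tspan_sum tspan_scal)
    have w: "lookup w q = c' * lookup x q" if "h \<le> ht q" for q
    proof -
      have "lookup w q = (\<Sum>p\<in>T. lookup x p * (\<Prod>p\<in>T - {p}. c p) * lookup (g p) q)"
        by (simp add: w_def lookup_sum)
      also have "\<dots> = (\<Sum>p\<in>T. if p = q then lookup x q * (\<Prod>p\<in>T - {q}. c p) * c q else 0)"
      proof (intro sum.cong refl)
        fix p assume p: "p \<in> T"
        have "lookup (g p) q = (if p = q then c q else 0)"
          using g(3)[OF p] T(2)[OF p] that by (force simp: leads_def in_keys_iff)
        then show "lookup x p * (\<Prod>p\<in>T - {p}. c p) * lookup (g p) q
          = (if p = q then lookup x q * (\<Prod>p\<in>T - {q}. c p) * c q else 0)" by simp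
      qed
      also have "\<dots> = (if q \<in> T then lookup x q * c' else 0)"
        using T(1) by (simp add: c'_def prod.remove mult_ac)
      also have "\<dots> = c' * lookup x q"
        using T(3)[of q] Suc.prems(4)[of q] that by (cases "ht q = h") (auto simp: h_def)
      finally show ?thesis .
    qed
    have "lookup (scal c' x - w) m = lookup (scal c' y - w) m"
    proof (rule Suc.IH)
      show "scal c' x - w \<in> Ksub i" "scal c' y - w \<in> Ksub j"
        using Suc.prems(1,2) w_i w_j unfolding Ksub_def by (auto intro: tspan_diff tspan_scal)
      show "lookup (scal c' x - w) q = lookup (scal c' y - w) q"
        if "H < ht q" for q using Suc.prems(3)[OF that] by (simp add: lookup_minus)
      show "lookup (scal c' x - w) q = 0" if "H + int k < ht q" for q
        using w[of q] that by (simp add: lookup_minus h_def)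
    qed
    then show ?case using c' by (simp add: lookup_minus)
  qed
  define h where "h = Max (insert H (ht ` keys x))"
  define k where "k = nat (h - H)"
  have "lookup x q = 0" if "H + int k < ht q" for q
  proof (rule ccontr)
    assume "lookup x q \<noteq> 0"
    then have "ht q \<le> h"
      unfolding h_def by (intro Max_ge) (auto simp: in_keys_iff)
    then show False using that unfolding k_def by linarith
  qed
  from main[OF x y eq this] show ?thesis .
qed

text \<open>The monomials met when every i-dominant monomial found so far is expanded by
  \<open>Et i\<close>. Only finitely many lie above a given height, so families supported here
  automatically satisfy the finiteness conditions of the completions.\<close>

inductive_set reachable :: "mono \<Rightarrow> mono set" for m0 where
  start: "m0 \<in> reachable m0"
| expand: "p \<in> reachable m0 \<Longrightarrow> i \<in> I \<Longrightarrow> p \<in> B {i} \<Longrightarrow> q \<in> keys (Et i p) \<Longrightarrow> q \<in> reachable m0"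

lemma keys_Et_ht: "i \<in> I \<Longrightarrow> p \<in> B {i} \<Longrightarrow> q \<in> keys (Et i p) \<Longrightarrow> q = p \<or> ht q < ht p"
  using leads_Et[of i p] by (auto simp: leads_def)

text \<open>An expansion with q = p makes no progress; the induction discards such steps.\<close>

lemma reachable_cases:
  "q \<in> reachable m0 \<Longrightarrow> q = m0 \<or>
     (\<exists>p i. p \<in> reachable m0 \<and> i \<in> I \<and> p \<in> B {i} \<and> q \<in> keys (Et i p) \<and> ht q < ht p)"
proof (induction rule: reachable.induct)
  case (expand p i q)
  then show ?case using keys_Et_ht[of i p q] by blast
qed simp

lemma reachable_ht_le: "q \<in> reachable m0 \<Longrightarrow> ht q \<le> ht m0"
proof (induction rule: reachable.induct)
  case (expand p i q)
  then show ?case using keys_Et_ht[of i p q] by auto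
qed simp

definition upto_depth :: "mono \<Rightarrow> nat \<Rightarrow> mono set" where
  "upto_depth m0 t = {q \<in> reachable m0. ht m0 - int t < ht q}"

text \<open>A new monomial comes from a strictly higher one. As heights are integers, that one
  already occurs at the previous depth, and each \<open>Et i p\<close> has finitely many
  monomials.\<close>

lemma finite_upto_depth: "finite (upto_depth m0 t)"
proof (induction t)
  case 0
  have "upto_depth m0 0 = {}" using reachable_ht_le by (force simp: upto_depth_def)
  then show ?case by simp
next
  case (Suc t)
  have "upto_depth m0 (Suc t) \<subseteq> {m0} \<union> (\<Union>p\<in>upto_depth m0 t. \<Union>i\<in>I. keys (Et i p))"
  proof
    fix q assume q: "q \<in> upto_depth m0 (Suc t)"
    then have "q \<in> reachable m0" by (simp add: upto_depth_def)
    from reachable_cases[OF this] show "q \<in> {m0} \<union> (\<Union>p\<in>upto_depth m0 t. \<Union>i\<in>I. keys (Et i p))"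
      using q by (force simp: upto_depth_def)
  qed
  then show ?case by (rule finite_subset) (use Suc in auto)
qed

text \<open>Truncating to this depth is harmless for coefficients above height
  \<open>ht m0 - t\<close>, because \<open>Et i p\<close> has no monomial higher than
  \<open>p\<close>.\<close>

definition partial :: "mono \<Rightarrow> nat \<Rightarrow> (mono \<Rightarrow> tpoly) \<Rightarrow> nat \<Rightarrow> mono \<Rightarrow>\<^sub>0 tpoly" where
  "partial m0 t d i = (\<Sum>p\<in>upto_depth m0 t. scal (d p) (Et i p))"

text \<open>The invariant of the algorithm after all heights above \<open>ht m0 - t\<close> have been treated: \<open>F\<close>
  is the element under construction, and \<open>d i\<close> its coefficients in the $E_{i,t}(p)$.\<close>

definition stage :: "mono \<Rightarrow> nat \<Rightarrow> (mono \<Rightarrow> tpoly) \<times> (nat \<Rightarrow> mono \<Rightarrow> tpoly) \<Rightarrow> bool" where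
  "stage m0 t = (\<lambda>(F, d).
     (\<forall>q. F q \<noteq> 0 \<longrightarrow> q \<in> upto_depth m0 t) \<and>
     (\<forall>i\<in>I. \<forall>q. d i q \<noteq> 0 \<longrightarrow> q \<in> upto_depth m0 t \<and> q \<in> B {i}) \<and>
     (\<forall>i\<in>I. \<forall>q. ht m0 - int t < ht q \<longrightarrow> F q = lookup (partial m0 t (d i) i) q) \<and>
     (\<forall>q\<in>B I. ht m0 - int t < ht q \<longrightarrow> F q = of_bool (q = m0)))"

definition extends :: "mono \<Rightarrow> nat \<Rightarrow> (mono \<Rightarrow> tpoly) \<times> (nat \<Rightarrow> mono \<Rightarrow> tpoly) \<Rightarrow>
    (mono \<Rightarrow> tpoly) \<times> (nat \<Rightarrow> mono \<Rightarrow> tpoly) \<Rightarrow> bool" where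
  "extends m0 t = (\<lambda>(F, d) (F', d'). \<forall>q. ht m0 - int t < ht q \<longrightarrow> F' q = F q \<and> (\<forall>i\<in>I. d' i q = d i q))"

lemma partial_in_Ksub:
  assumes "\<And>q. d q \<noteq> 0 \<Longrightarrow> q \<in> B {i}"
  shows "partial m0 t d i \<in> Ksub i"
  unfolding partial_def Ksub_def
proof (rule tspan_sum)
  fix p
  show "scal (d p) (Et i p) \<in> tspan (Et i ` B {i})"
    using assms[of p] Et_in_Ksub[of p i "d p"] tspan.zero by (cases "d p = 0") (auto simp: Ksub_def)
qed

lemma stage_step:
  assumes "1 \<le> n" and st: "stage m0 t (F, d)"
  shows "\<exists>Fd'. stage m0 (Suc t) Fd' \<and> extends m0 t (F, d) Fd'"
proof -
  define H where "H = ht m0 - int t"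
  have F: "\<And>q. F q \<noteq> 0 \<Longrightarrow> q \<in> upto_depth m0 t"
    and d: "\<And>i q. i \<in> I \<Longrightarrow> d i q \<noteq> 0 \<Longrightarrow> q \<in> upto_depth m0 t \<and> q \<in> B {i}"
    and Fd: "\<And>i q. i \<in> I \<Longrightarrow> H < ht q \<Longrightarrow> F q = lookup (partial m0 t (d i) i) q"
    and dom: "\<And>q. q \<in> B I \<Longrightarrow> H < ht q \<Longrightarrow> F q = of_bool (q = m0)"
    using st unfolding stage_def H_def by auto
  define s where "s i q = lookup (partial m0 t (d i) i) q" for i q
  \<comment> \<open>All partial sums agree with \<open>F\<close> above \<open>H\<close>, hence with
    each other there; this is the hypothesis of \<open>Ksub_consistent\<close>.\<close>
  have cons: "s i q = s j q" if "i \<in> I" "j \<in> I" "ht q = H" "q \<notin> B {i}" "q \<notin> B {j}" for i j q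
  proof (cases "i = j")
    case False
    have "lookup (partial m0 t (d i) i) q' = lookup (partial m0 t (d j) j) q'" if "H < ht q'" for q'
      using Fd[OF \<open>i \<in> I\<close> that] Fd[OF \<open>j \<in> I\<close> that] by simp
    then show ?thesis
      unfolding s_def using d that
      by (intro Ksub_consistent[OF that(1,2) False _ _ _ that(3-5)] partial_in_Ksub) blast+
  qed simp
  \<comment> \<open>Dominant monomials receive the prescribed value; for the others the choice of
    the node is immaterial by \<open>cons\<close>.\<close>
  define F' where "F' q = (if ht q = H then if q \<in> B I then of_bool (q = m0)
      else s (SOME i. i \<in> I \<and> q \<notin> B {i}) q else F q)" for q
  \<comment> \<open>The leading coefficient of \<open>Et i q\<close> is a power of t, and
    \<open>SOME\<close> picks its inverse. The new coefficient makes up the difference between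
    \<open>F'\<close> and the contribution of the higher terms.\<close>
  define d' where "d' i q = (if ht q = H then if q \<in> B {i} then
      (SOME v. v * lookup (Et i q) q = 1) * (F' q - s i q) else 0 else d i q)" for i q
  have some: "(SOME i. i \<in> I \<and> q \<notin> B {i}) \<in> I \<and> q \<notin> B {SOME i. i \<in> I \<and> q \<notin> B {i}}" if "q \<notin> B I" for q
  proof -
    have "\<exists>i\<in>I. q \<notin> B {i}"
    proof (cases "q \<in> monomials")
      case True then show ?thesis using that by (auto simp: B_def)
    next
      \<comment> \<open>A family of exponents outside A belongs to no \<open>B {i}\<close>, so any
        node serves; 1 is a node because the rank is positive.\<close>
      case False then show ?thesis using assms(1) by (intro bexI[of _ 1]) (auto simp: B_def)
    qed
    then show ?thesis by (metis (mono_tags, lifting) someI_ex)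
  qed
  have s_reach: "q \<in> reachable m0" if "s i q \<noteq> 0" "i \<in> I" for i q
  proof -
    have "\<exists>p\<in>upto_depth m0 t. d i p * lookup (Et i p) q \<noteq> 0"
      using that(1) unfolding s_def partial_def lookup_sum lookup_scal by (meson sum.neutral)
    then obtain p where "p \<in> upto_depth m0 t" "d i p \<noteq> 0" "lookup (Et i p) q \<noteq> 0" by auto
    then show ?thesis
      using d[OF that(2), of p] that(2) by (auto simp: upto_depth_def in_keys_iff intro: reachable.expand)
  qed
  have F'_reach: "q \<in> reachable m0" if "F' q \<noteq> 0" for q
  proof (cases "ht q = H")
    case True
    then show ?thesis
      using that some[of q] s_reach[of "SOME i. i \<in> I \<and> q \<notin> B {i}" q] reachable.start[of m0]
      by (auto simp: F'_def split: if_splits)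
  next
    case False
    then show ?thesis using that F[of q] by (auto simp: F'_def upto_depth_def)
  qed
  have F's: "F' q = s i q" if "i \<in> I" "ht q = H" "q \<notin> B {i}" for i q
  proof -
    have "q \<notin> B I" using that by (auto simp: B_def)
    from some[OF this] show ?thesis
      using that cons[of i "SOME i. i \<in> I \<and> q \<notin> B {i}" q] \<open>q \<notin> B I\<close> by (simp add: F'_def)
  qed
  have upto: "q \<in> upto_depth m0 (Suc t) \<longleftrightarrow> q \<in> reachable m0 \<and> H \<le> ht q"
    "q \<in> upto_depth m0 t \<longleftrightarrow> q \<in> reachable m0 \<and> H < ht q" for q
    by (auto simp: upto_depth_def H_def)
  have d'B: "q \<in> upto_depth m0 (Suc t) \<and> q \<in> B {i}" if "i \<in> I" "d' i q \<noteq> 0" for i q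
  proof (cases "ht q = H")
    case True
    then have "q \<in> B {i}" "F' q \<noteq> 0 \<or> s i q \<noteq> 0" using that by (auto simp: d'_def split: if_splits)
    then show ?thesis using True F'_reach s_reach that(1) by (auto simp: upto)
  next
    case False
    then show ?thesis using that d[of i q] by (auto simp: d'_def upto)
  qed
  have Fd': "F' q = lookup (partial m0 (Suc t) (d' i) i) q" if i: "i \<in> I" and q: "H \<le> ht q" for i q
  proof -
    have split: "upto_depth m0 (Suc t) = upto_depth m0 t \<union> {p \<in> reachable m0. ht p = H}"
      "upto_depth m0 t \<inter> {p \<in> reachable m0. ht p = H} = {}"
      by (auto simp: upto)
    have fin: "finite {p \<in> reachable m0. ht p = H}"
      using finite_upto_depth[of m0 "Suc t"] unfolding split(1) by simp
    have "lookup (partial m0 (Suc t) (d' i) i) q = (\<Sum>p\<in>upto_depth m0 t. d' i p * lookup (Et i p) q)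
        + (\<Sum>p\<in>{p \<in> reachable m0. ht p = H}. d' i p * lookup (Et i p) q)"
      unfolding partial_def lookup_sum lookup_scal split(1)
      by (rule sum.union_disjoint[OF finite_upto_depth fin split(2)])
    also have "(\<Sum>p\<in>upto_depth m0 t. d' i p * lookup (Et i p) q) = s i q"
      unfolding s_def partial_def lookup_sum lookup_scal
      by (intro sum.cong refl) (auto simp: d'_def upto)
    also have "(\<Sum>p\<in>{p \<in> reachable m0. ht p = H}. d' i p * lookup (Et i p) q)
       = (\<Sum>p\<in>{p \<in> reachable m0. ht p = H}. if p = q then d' i q * lookup (Et i q) q else 0)"
    proof (intro sum.cong refl)
      fix p assume p: "p \<in> {p \<in> reachable m0. ht p = H}"
      show "d' i p * lookup (Et i p) q = (if p = q then d' i q * lookup (Et i q) q else 0)"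
      proof (cases "p = q \<or> d' i p = 0")
        case False
        then show ?thesis using lookup_Et_above[of i p q] d'B[OF i, of p] i p q by auto
      qed auto
    qed
    also have "\<dots> = (if q \<in> reachable m0 \<and> ht q = H then d' i q * lookup (Et i q) q else 0)"
      using fin by simp
    also have "s i q + \<dots> = F' q"
    proof (cases "ht q = H")
      case False
      then show ?thesis using q Fd[OF i, of q] by (simp add: F'_def s_def)
    next
      case H: True
      show ?thesis
      proof (cases "q \<in> B {i}")
        case False
        then show ?thesis using H F's[OF i H False] by (simp add: d'_def)
      next
        case B: True
        obtain c where c: "lookup (Et i q) q = tpow c" using leads_Et[OF i B] by (auto simp: leads_def)
        have "tpow (- c) * lookup (Et i q) q = 1" by (simp add: c tpow_add tpow_0)
        then have v: "(SOME v. v * lookup (Et i q) q = 1) * lookup (Et i q) q = 1" by (rule someI)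
        have "d' i q * lookup (Et i q) q = ((SOME v. v * lookup (Et i q) q = 1) * lookup (Et i q) q) * (F' q - s i q)"
          using H B by (simp add: d'_def mult_ac)
        also have "\<dots> = F' q - s i q" unfolding v by simp
        finally have "d' i q * lookup (Et i q) q = F' q - s i q" .
        moreover have "q \<notin> reachable m0 \<Longrightarrow> F' q = 0 \<and> s i q = 0"
          using F'_reach s_reach i by blast
        ultimately show ?thesis using H by auto
      qed
    qed
    finally show ?thesis ..
  qed
  have "stage m0 (Suc t) (F', d')"
    unfolding stage_def prod.case
  proof (intro conjI allI impI ballI)
    show "q \<in> upto_depth m0 (Suc t)" if "F' q \<noteq> 0" for q
      using that F'_reach[OF that] F[of q] by (auto simp: upto F'_def split: if_splits)
    show "q \<in> upto_depth m0 (Suc t)" "q \<in> B {i}" if "i \<in> I" "d' i q \<noteq> 0" for i q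
      using d'B[OF that] by auto
    show "F' q = lookup (partial m0 (Suc t) (d' i) i) q" if "i \<in> I" "ht m0 - int (Suc t) < ht q" for i q
      using that by (intro Fd') (auto simp: H_def)
    show "F' q = of_bool (q = m0)" if "q \<in> B I" "ht m0 - int (Suc t) < ht q" for q
      using that dom[of q] by (auto simp: F'_def H_def)
  qed
  moreover have "extends m0 t (F, d) (F', d')"
    by (auto simp: extends_def F'_def d'_def H_def)
  ultimately show ?thesis by blast
qed

lemma algorithm:
  assumes "1 \<le> n"
  shows "\<exists>F d. (\<forall>q. F q \<noteq> 0 \<longrightarrow> q \<in> reachable m0) \<and>
     (\<forall>i\<in>I. \<forall>q. d i q \<noteq> 0 \<longrightarrow> q \<in> reachable m0 \<and> q \<in> B {i}) \<and>
     (\<forall>i\<in>I. \<forall>q t. ht m0 - int t < ht q \<longrightarrow> F q = lookup (partial m0 t (d i) i) q) \<and>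
     (\<forall>q\<in>B I. F q = of_bool (q = m0))"
proof -
  have start: "stage m0 0 (\<lambda>_. 0, \<lambda>_ _. 0)"
    by (auto simp: stage_def partial_def)
  obtain f where f: "\<And>t. stage m0 t (f t)" "\<And>t. extends m0 t (f t) (f (Suc t))"
    using dependent_nat_choice[of "stage m0" "extends m0"] start stage_step[OF assms, of m0]
    by (metis surj_pair)
  have stable: "fst (f t) q = fst (f t0) q \<and> (\<forall>i\<in>I. snd (f t) i q = snd (f t0) i q)"
    if "t0 \<le> t" "ht m0 - int t0 < ht q" for t0 t q
    using that(1)
  proof (induction t rule: dec_induct)
    case (step t)
    then show ?case using f(2)[of t] that(2) by (auto simp: extends_def split_beta)
  qed simp
  \<comment> \<open>The first stage at which the height of \<open>q\<close> has been treated;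
    truncation makes it stage 0 for heights above \<open>ht m0\<close>.\<close>
  define tq where "tq q = nat (ht m0 - ht q + 1)" for q
  have tq: "ht m0 - int (tq q) < ht q" for q by (simp add: tq_def)
  define F where "F q = fst (f (tq q)) q" for q
  define d where "d i q = snd (f (tq q)) i q" for i q
  have eq: "fst (f t) q = F q" "i \<in> I \<Longrightarrow> snd (f t) i q = d i q" if "ht m0 - int t < ht q" for t q i
  proof -
    have "tq q \<le> t" using that by (simp add: tq_def)
    from stable[OF this tq] show "fst (f t) q = F q" "i \<in> I \<Longrightarrow> snd (f t) i q = d i q"
      by (auto simp: F_def d_def)
  qed
  have st: "\<And>q. fst (f t) q \<noteq> 0 \<Longrightarrow> q \<in> upto_depth m0 t"
    "\<And>i q. i \<in> I \<Longrightarrow> snd (f t) i q \<noteq> 0 \<Longrightarrow> q \<in> upto_depth m0 t \<and> q \<in> B {i}"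
    "\<And>i q. i \<in> I \<Longrightarrow> ht m0 - int t < ht q \<Longrightarrow> fst (f t) q = lookup (partial m0 t (snd (f t) i) i) q"
    "\<And>q. q \<in> B I \<Longrightarrow> ht m0 - int t < ht q \<Longrightarrow> fst (f t) q = of_bool (q = m0)" for t
    using f(1)[of t] unfolding stage_def split_beta by blast+
  show ?thesis
  proof (intro exI[of _ F] exI[of _ d] conjI allI impI ballI)
    show "q \<in> reachable m0" if "F q \<noteq> 0" for q
      using st(1)[of "tq q" q] that by (simp add: F_def upto_depth_def)
    show "q \<in> reachable m0" "q \<in> B {i}" if "i \<in> I" "d i q \<noteq> 0" for i q
      using st(2)[of i "tq q" q] that by (simp_all add: d_def upto_depth_def)
    show "F q = of_bool (q = m0)" if "q \<in> B I" for q
      using st(4)[OF that tq] by (simp add: F_def)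
    show "F q = lookup (partial m0 t (d i) i) q" if "i \<in> I" "ht m0 - int t < ht q" for i q t
    proof -
      have "partial m0 t (snd (f t) i) i = partial m0 t (d i) i"
        unfolding partial_def by (intro sum.cong refl) (use eq(2) that(1) in \<open>auto simp: upto_depth_def\<close>)
      then show ?thesis using st(3)[OF that] eq(1)[OF that(2)] by simp
    qed
  qed
qed

end

section \<open>The sets $D_m$\<close>

lemma mult_as_sum:
  fixes x y :: "'a :: monoid_add \<Rightarrow>\<^sub>0 'b :: semiring_0"
  shows "x * y = (\<Sum>a\<in>keys x. \<Sum>b\<in>keys y.
      Poly_Mapping.single (a + b) (lookup x a * lookup y b))"
proof -
  have s: "z = (\<Sum>p\<in>keys z. Poly_Mapping.single p (lookup z p))"
    for z :: "'a \<Rightarrow>\<^sub>0 'b"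
    by (intro poly_mapping_eqI) (auto simp: lookup_sum lookup_single when_def in_keys_iff)
  have "x * y = (\<Sum>p\<in>keys x. Poly_Mapping.single p (lookup x p)) *
      (\<Sum>p\<in>keys y. Poly_Mapping.single p (lookup y p))"
    using s[of x] s[of y] by simp
  then show ?thesis by (simp add: sum_product mult_single)
qed

lemma lookup_mult_sum:
  fixes x y :: "'a :: monoid_add \<Rightarrow>\<^sub>0 'b :: semiring_0"
  shows "lookup (x * y) q = (\<Sum>a\<in>keys x. \<Sum>b\<in>keys y.
      lookup x a * lookup y b when a + b = q)"
  by (subst mult_as_sum) (simp add: lookup_sum lookup_single)

text \<open>Without negative coefficients nothing cancels in a product, so each product of monomials
  of the factors survives. This is how monomials of \<open>E {i} m\<close> are exhibited.\<close>

definition nonneg_coeffs :: "('a \<Rightarrow>\<^sub>0 int) \<Rightarrow> bool" where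
  "nonneg_coeffs x \<longleftrightarrow> (\<forall>q. 0 \<le> lookup x q)"

lemma nonneg_coeffs_mult: "nonneg_coeffs x \<Longrightarrow> nonneg_coeffs y \<Longrightarrow> nonneg_coeffs (x * y)"
  unfolding nonneg_coeffs_def lookup_mult_sum by (auto intro!: sum_nonneg simp: when_def)

lemma keys_mult_nonneg:
  assumes "nonneg_coeffs x" "nonneg_coeffs y" "a \<in> keys x" "b \<in> keys y"
  shows "a + b \<in> keys (x * y)"
proof -
  let ?x = "lookup x" and ?y = "lookup y"
  let ?f = "\<lambda>a' b'. ?x a' * ?y b' when a' + b' = a + b"
  have nn: "0 \<le> ?f a' b'" for a' b' using assms(1,2) by (auto simp: nonneg_coeffs_def when_def)
  have "0 < ?x a" "0 < ?y b"
    using assms by (auto simp: nonneg_coeffs_def in_keys_iff order_less_le)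
  then have "0 < ?f a b" by simp
  also have "?f a b \<le> (\<Sum>b'\<in>keys y. ?f a b')"
    using assms(4) nn by (intro member_le_sum) auto
  also have "\<dots> \<le> (\<Sum>a'\<in>keys x. \<Sum>b'\<in>keys y. ?f a' b')"
    using assms(3) nn by (intro member_le_sum[of a _ "\<lambda>a'. \<Sum>b'\<in>keys y. ?f a' b'"] sum_nonneg) auto
  finally show ?thesis by (simp add: in_keys_iff lookup_mult_sum)
qed

context cartan_data
begin

lemma lmon_mult: "lmon a * lmon b = lmon (a + b)"
  by (simp add: lmon_def mult_single)

lemma nonneg_coeffs_lmon: "nonneg_coeffs (lmon m)"
  by (simp add: nonneg_coeffs_def lmon_def lookup_single when_def)

lemma keys_lmon: "keys (lmon m) = {m}"
  by (simp add: lmon_def)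

end

context finite_cartan_data
begin

section \<open>The commutative rings at t = 1\<close>

lemma leads_times:
  assumes "leads x m c" "leads y m' c'"
  shows "leads (x * y) (m + m') (c * c' :: 'a :: semiring_0)"
  unfolding leads_def
proof (intro conjI ballI)
  have le: "a = m \<and> b = m'" if "a \<in> keys x" "b \<in> keys y" "a + b = m + m'" for a b
  proof -
    have "a = m \<or> ht a < ht m" "b = m' \<or> ht b < ht m'"
      using assms that by (auto simp: leads_def)
    moreover have "ht a + ht b = ht m + ht m'"
      using that(3) by (metis ht_add)
    ultimately show ?thesis using that(3) by auto
  qed
  have "lookup (x * y) (m + m') =
      (\<Sum>a\<in>keys x. \<Sum>b\<in>keys y. if b = m' then if a = m then c * c' else 0 else 0)"
    unfolding lookup_mult_sum
    by (intro sum.cong refl) (use le assms in \<open>auto simp: when_def leads_def\<close>)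
  also have "\<dots> = c * c'"
    using assms by (cases "c = 0"; cases "c' = 0") (auto simp: in_keys_iff leads_def)
  finally show "lookup (x * y) (m + m') = c * c'" .
  fix q assume "q \<in> keys (x * y)"
  then obtain a b where ab: "a \<in> keys x" "b \<in> keys y" "q = a + b"
    using Poly_Mapping.keys_mult[of x y] by blast
  then have "a = m \<or> ht a < ht m" "b = m' \<or> ht b < ht m'"
    using assms by (auto simp: leads_def)
  then show "q = m + m' \<or> ht q < ht (m + m')"
    unfolding ab(3) ht_add by auto
qed

definition cgen :: "nat \<Rightarrow> int \<Rightarrow> mono \<Rightarrow>\<^sub>0 int" where
  "cgen i l = lmon (Ymon i l) + lmon (Ymon i l - Amon i (l + int (r i)))"

text \<open>At t = 1 the letters commute, so a multiset replaces the list used in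
  \<open>word\<close>. On \<open>cindex i\<close> the pair is determined by its leading monomial
  \<open>ctop\<close>.\<close>

definition cword :: "nat \<Rightarrow> mono \<times> int multiset \<Rightarrow> mono \<Rightarrow>\<^sub>0 int" where
  "cword i = (\<lambda>(z, M). lmon z * (\<Prod>l\<in>#M. cgen i l))"

definition ctop :: "nat \<Rightarrow> mono \<times> int multiset \<Rightarrow> mono" where
  "ctop i = (\<lambda>(z, M). z + (\<Sum>l\<in>#M. Ymon i l))"

definition cindex :: "nat \<Rightarrow> (mono \<times> int multiset) set" where
  "cindex i = {(z, M). trivial_at i z}"

lemma cgen_eq: "lmon (Ymon i l) * (1 + lmon (- Amon i (l + int (r i)))) = cgen i l"
  by (simp add: cgen_def distrib_left lmon_mult)

lemma keys_cgen:
  assumes "i \<in> I"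
  shows "keys (cgen i l) = {Ymon i l, Ymon i l - Amon i (l + int (r i))}"
proof -
  have "Ymon i l \<noteq> Ymon i l - Amon i (l + int (r i))"
    using Amon_nonzero[OF assms, of "l + int (r i)"] by simp
  then show ?thesis
    by (auto simp: cgen_def in_keys_iff lookup_add lmon_def lookup_single when_def split: if_splits)
qed

lemma nonneg_coeffs_cgen: "nonneg_coeffs (cgen i l)"
  by (simp add: cgen_def nonneg_coeffs_def lookup_add lmon_def lookup_single when_def)

lemma leads_cgen:
  assumes "i \<in> I"
  shows "leads (cgen i l) (Ymon i l) 1"
  unfolding leads_def keys_cgen[OF assms]
  using assms hA_pos Amon_nonzero[OF assms, of "l + int (r i)"]
  by (auto simp: cgen_def lookup_add lmon_def lookup_single when_def ht_diff ht_Amon)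

lemma leads_cword:
  assumes "i \<in> I"
  shows "leads (cword i p) (ctop i p) 1"
proof -
  obtain z M where p: "p = (z, M)" by (cases p)
  have "leads (\<Prod>l\<in>#M. cgen i l) (\<Sum>l\<in>#M. Ymon i l) 1"
  proof (induction M)
    case empty
    show ?case by (simp add: leads_def)
  next
    case (add l M)
    then show ?case using leads_times[OF leads_cgen[OF assms, of l]] by fastforce
  qed
  moreover have "leads (lmon z) z 1" by (simp add: leads_def lmon_def)
  ultimately show ?thesis
    unfolding p cword_def ctop_def using leads_times by fastforce
qed

lemma lookup_ctop:
  assumes "trivial_at i z"
  shows "lookup (ctop i (z, M)) (i, l) = int (count M l)"
proof -
  have "lookup (\<Sum>l\<in>#M. Ymon i l) (i, l) = int (count M l)"
    by (induction M) (auto simp: lookup_add lookup_Ymon)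
  then show ?thesis using assms by (simp add: ctop_def lookup_add trivial_at_def)
qed

lemma ctop_in_B:
  assumes "i \<in> I" "p \<in> cindex i"
  shows "ctop i p \<in> B {i}"
proof -
  obtain z M where p: "p = (z, M)" "trivial_at i z" using assms(2) by (auto simp: cindex_def)
  have "(\<Sum>l\<in>#M. Ymon i l) \<in> monomials"
    using assms(1) by (induction M) (auto intro: monomials_0 monomials_add[OF monomials_Ymon])
  then have "ctop i p \<in> monomials"
    using p by (auto simp: ctop_def trivial_at_def intro: monomials_add)
  then show ?thesis using p by (auto simp: B_def lookup_ctop)
qed

lemma ctop_inj: "inj_on (ctop i) (cindex i)"
proof (rule inj_onI)
  fix p q assume pq: "p \<in> cindex i" "q \<in> cindex i" "ctop i p = ctop i q"
  obtain z M z' M' where z: "p = (z, M)" "trivial_at i z" "q = (z', M')" "trivial_at i z'"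
    using pq by (auto simp: cindex_def)
  have "count M l = count M' l" for l
    using lookup_ctop[OF z(2), of M l] lookup_ctop[OF z(4), of M' l] pq(3) z by simp
  then have "M = M'" by (rule multiset_eqI)
  then show "p = q" using pq(3) z by (simp add: ctop_def)
qed

lemma cword_mult:
  assumes "p \<in> cindex i" "q \<in> cindex i"
  shows "\<exists>w\<in>cindex i. cword i p * cword i q = cword i w"
  using assms by (intro bexI[of _ "(fst p + fst q, snd p + snd q)"])
    (auto simp: cindex_def cword_def lmon_mult[symmetric] mult_ac split: prod.splits intro: trivial_at_add)

lemma tspan_cword_mult:
  assumes "x \<in> tspan (cword i ` cindex i)" "y \<in> tspan (cword i ` cindex i)"
  shows "x * y \<in> tspan (cword i ` cindex i)"
proof -
  have scal_mult: "scal c x * y = scal c (x * y)" "x * scal c y = scal c (x * y)" for c and x y :: "mono \<Rightarrow>\<^sub>0 int"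
  proof -
    have s: "scal c z = Poly_Mapping.single 0 c * z" for z :: "mono \<Rightarrow>\<^sub>0 int"
      by (simp add: scal_def mult_map_scale_conv_mult)
    show "scal c x * y = scal c (x * y)" "x * scal c y = scal c (x * y)"
      unfolding s by (simp_all only: mult_ac)
  qed
  have gen: "cword i p * cword i q \<in> tspan (cword i ` cindex i)" if "p \<in> cindex i" "q \<in> cindex i" for p q
    using cword_mult[OF that] tspan_gen[of _ "cword i ` cindex i" 1] by fastforce
  have left: "x * cword i q \<in> tspan (cword i ` cindex i)" if q: "q \<in> cindex i" for q
    using assms(1)
  proof (induction rule: tspan.induct)
    case (add x g c)
    then obtain p where "p \<in> cindex i" "g = cword i p" by blast
    with add gen[OF _ q] show ?case by (simp only: distrib_right scal_mult tspan_add tspan_scal)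
  qed (simp add: tspan.zero)
  show ?thesis
    using assms(2)
  proof (induction rule: tspan.induct)
    case (add y g c)
    then obtain q where "q \<in> cindex i" "g = cword i q" by blast
    with add left show ?case by (simp only: distrib_left scal_mult tspan_add tspan_scal)
  qed (simp add: tspan.zero)
qed

text \<open>The span of the commutative words contains the generators and is closed under products.
  Written in words, an element of the subring has leading monomials that can be inspected.\<close>

lemma K_at_subset:
  assumes "i \<in> I"
  shows "K_at i \<subseteq> tspan (cword i ` cindex i)"
proof
  have word: "cword i p \<in> tspan (cword i ` cindex i)" if "p \<in> cindex i" for p
    using tspan_gen[of "cword i p" "cword i ` cindex i" 1] that by simp
  fix x assume "x \<in> K_at i"
  then show "x \<in> tspan (cword i ` cindex i)"
    unfolding K_at_def
  proof (induction rule: subring_gen.induct)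
    case (gen x)
    then consider l where "x = cgen i l" | j l where "j \<in> I - {i}" "x = lmon (Ymon j l)"
      | j l where "j \<in> I - {i}" "x = lmon (- Ymon j l)"
      by (auto simp: cgen_eq)
    then show ?case
    proof cases
      case (1 l)
      have "lmon 0 = 1" by (simp add: lmon_def)
      then show ?thesis
        using word[of "(0, {#l#})"] 1
        by (simp add: cindex_def cword_def trivial_at_0)
    next
      case (2 j l)
      then have "trivial_at i (Ymon j l)" by (auto simp: trivial_at_def monomials_Ymon lookup_Ymon)
      then show ?thesis
        using word[of "(Ymon j l, {#})"] 2
        by (simp add: cindex_def cword_def)
    next
      case (3 j l)
      then have "trivial_at i (- Ymon j l)"
        by (intro trivial_at_uminus) (auto simp: trivial_at_def monomials_Ymon lookup_Ymon)
      then show ?thesis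
        using word[of "(- Ymon j l, {#})"] 3
        by (simp add: cindex_def cword_def)
    qed
  next
    case one
    have "lmon 0 = 1" by (simp add: lmon_def)
    then show ?case
      using word[of "(0, {#})"]
      by (simp add: cindex_def cword_def trivial_at_0)
  next
    case (diff x y)
    then show ?case by (intro tspan_diff)
  next
    case (mult x y)
    then show ?case by (intro tspan_cword_mult)
  qed
qed

text \<open>Different words have different leading monomials, all of them i-dominant; so among the
  words that occur, one of maximal height keeps its coefficient.\<close>

lemma tspan_cword_dominant:
  assumes i: "i \<in> I" and x: "x \<in> tspan (cword i ` cindex i)" "x \<noteq> 0"
  shows "\<exists>m\<in>B {i}. lookup x m \<noteq> 0"
proof -
  obtain S c where S: "finite S" "S \<subseteq> cindex i" "x = (\<Sum>p\<in>S. scal (c p) (cword i p))"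
    using tspan_image_sum[OF x(1)] by blast
  define S' where "S' = {p \<in> S. c p \<noteq> 0}"
  have S': "finite S'" "S' \<subseteq> cindex i" using S by (auto simp: S'_def)
  have x': "lookup x q = (\<Sum>p\<in>S'. c p * lookup (cword i p) q)" for q
    unfolding S(3) lookup_sum lookup_scal using S(1) by (intro sum.mono_neutral_right) (auto simp: S'_def)
  have "S' \<noteq> {}" using x(2) x' by (auto intro: poly_mapping_eqI)
  then have "finite (ht ` ctop i ` S')" "ht ` ctop i ` S' \<noteq> {}" using S'(1) by auto
  then obtain p where p: "p \<in> S'" "ht (ctop i p) = Max (ht ` ctop i ` S')"
    by (metis (no_types, lifting) Max_in imageE)
  have max: "ht (ctop i q) \<le> ht (ctop i p)" if "q \<in> S'" for q
    using that p(2) S'(1) by auto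
  have "lookup x (ctop i p) = (\<Sum>q\<in>S'. if q = p then c p else 0)"
    unfolding x'
  proof (intro sum.cong refl)
    fix q assume q: "q \<in> S'"
    have lead: "leads (cword i q) (ctop i q) 1" by (rule leads_cword[OF i])
    have "q \<noteq> p \<Longrightarrow> ctop i p \<noteq> ctop i q"
      using ctop_inj[of i] q p(1) S'(2) by (auto dest: inj_onD)
    then show "c q * lookup (cword i q) (ctop i p) = (if q = p then c p else 0)"
      using lead max[OF q] by (force simp: leads_def in_keys_iff)
  qed
  also have "\<dots> = c p" using S'(1) p(1) by simp
  finally have "lookup x (ctop i p) \<noteq> 0" using p(1) by (simp add: S'_def)
  then show ?thesis using ctop_in_B[OF i] p(1) S'(2) by blast
qed

text \<open>The second monomial of the generator has exponent -1 at (i, l + 2 r_i) and so is not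
  i-dominant. The difference of two candidates has no i-dominant monomial and hence vanishes, which
  resolves the definite description.\<close>

lemma EY_singleton:
  assumes i: "i \<in> I"
  shows "EY {i} i l = cgen i l"
  unfolding EY_def
proof (rule the_equality)
  have r: "r i > 0" using r_pos i by auto
  have "cgen i l \<in> K_on {i}"
    unfolding K_on_def K_at_def by (auto simp: cgen_eq intro: subring_gen.gen)
  moreover have "Ymon i l - Amon i (l + int (r i)) \<notin> B {i}"
  proof
    assume "Ymon i l - Amon i (l + int (r i)) \<in> B {i}"
    then have "0 \<le> lookup (Ymon i l - Amon i (l + int (r i))) (i, l + int (r i) + int (r i))"
      by (simp add: B_def)
    then show False using r i by (simp add: lookup_minus lookup_Ymon lookup_Amon_diag)
  qed
  moreover have "Ymon i l \<in> B {i}"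
    using i by (auto simp: B_def monomials_Ymon lookup_Ymon)
  ultimately show "cgen i l \<in> K_on {i} \<and> keys (cgen i l) \<inter> B {i} = {Ymon i l} \<and>
      lookup (cgen i l) (Ymon i l) = 1"
    using leads_cgen[OF i, of l] by (auto simp: keys_cgen[OF i] leads_def)
  fix x assume x: "x \<in> K_on {i} \<and> keys x \<inter> B {i} = {Ymon i l} \<and>
      lookup x (Ymon i l) = 1"
  have "x - cgen i l \<in> tspan (cword i ` cindex i)"
    using x \<open>cgen i l \<in> K_on {i}\<close> K_at_subset[OF i] by (intro tspan_diff) (auto simp: K_on_def)
  moreover have "lookup (x - cgen i l) m = 0" if "m \<in> B {i}" for m
  proof (cases "m = Ymon i l")
    case True
    then show ?thesis using x leads_cgen[OF i, of l] by (simp add: lookup_minus leads_def)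
  next
    case False
    then have "m \<notin> keys x" "m \<notin> keys (cgen i l)"
      using x that \<open>_ \<notin> B {i}\<close> by (auto simp: keys_cgen[OF i])
    then show ?thesis by (simp add: lookup_minus in_keys_iff)
  qed
  ultimately show "x = cgen i l"
    using tspan_cword_dominant[OF i, of "x - cgen i l"] by auto
qed

text \<open>For J = {i} the element is a monomial times powers of two-term factors with coefficients
  1. From the power that belongs to l, the second term is taken as often as l occurs in the multiset
  \<open>M\<close>.\<close>

lemma box_subset_E:
  assumes i: "i \<in> I" and m: "m \<in> B {i}"
  shows "box i m \<subseteq> keys (E {i} m)"
proof
  let ?A = "\<lambda>M. \<Sum>l\<in>#M. Amon i (l + int (r i))"
  fix q assume "q \<in> box i m"
  then obtain M where M: "\<And>l. int (count M l) \<le> lookup m (i, l)" "q = m - ?A M"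
    by (auto simp: box_def)
  have pow: "nonneg_coeffs (cgen i l ^ k) \<and>
      (j \<le> k \<longrightarrow> Poly_Mapping.single (i, l) (int k) - ?A (replicate_mset j l) \<in> keys (cgen i l ^ k))"
    for l j k
  proof (induction k arbitrary: j)
    case 0
    show ?case by (simp add: nonneg_coeffs_def lookup_one when_def)
  next
    case (Suc k)
    have nn: "nonneg_coeffs (cgen i l ^ Suc k)"
      using Suc nonneg_coeffs_cgen by (simp add: nonneg_coeffs_mult)
    have "Poly_Mapping.single (i, l) (int (Suc k)) - ?A (replicate_mset j l) \<in> keys (cgen i l ^ Suc k)"
      if j: "j \<le> Suc k"
    proof (cases j)
      case 0
      have "Ymon i l + (Poly_Mapping.single (i, l) (int k) - ?A (replicate_mset 0 l)) \<in> keys (cgen i l ^ Suc k)"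
        unfolding power_Suc using Suc[of 0] nonneg_coeffs_cgen keys_cgen[OF i]
        by (intro keys_mult_nonneg) auto
      then show ?thesis using 0 by (simp add: Ymon_def single_add)
    next
      case (Suc j')
      have "(Ymon i l - Amon i (l + int (r i))) + (Poly_Mapping.single (i, l) (int k) - ?A (replicate_mset j' l))
          \<in> keys (cgen i l ^ Suc k)"
        unfolding power_Suc using Suc.IH[of j'] Suc j nonneg_coeffs_cgen keys_cgen[OF i]
        by (intro keys_mult_nonneg) auto
      then show ?thesis using Suc by (simp add: Ymon_def single_add algebra_simps)
    qed
    then show ?case using nn by blast
  qed
  define P where "P = {p \<in> keys m. fst p \<in> {i}}"
  have P: "finite P" "\<And>p. p \<in> P \<Longrightarrow> p = (i, snd p)" by (auto simp: P_def)
  have prod: "nonneg_coeffs (\<Prod>p\<in>S. cgen i (snd p) ^ nat (lookup m p)) \<and>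
      (\<Sum>p\<in>S. Poly_Mapping.single p (lookup m p) - ?A (replicate_mset (count M (snd p)) (snd p)))
        \<in> keys (\<Prod>p\<in>S. cgen i (snd p) ^ nat (lookup m p))" if "finite S" "S \<subseteq> P" for S
    using that
  proof (induction S rule: finite_induct)
    case empty
    show ?case by (simp add: nonneg_coeffs_def lookup_one when_def)
  next
    case (insert p S)
    have p: "p = (i, snd p)" using insert.prems P(2) by blast
    have le: "int (count M (snd p)) \<le> lookup m p" using M(1)[of "snd p"] p by simp
    have "Poly_Mapping.single p (lookup m p) - ?A (replicate_mset (count M (snd p)) (snd p))
        \<in> keys (cgen i (snd p) ^ nat (lookup m p))"
      using pow[of "snd p" "nat (lookup m p)" "count M (snd p)"] le p by (simp flip: p)
    then show ?case
      using insert pow[of "snd p" "nat (lookup m p)"]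
      by (simp add: nonneg_coeffs_mult keys_mult_nonneg)
  qed
  \<comment> \<open>\<open>M\<close> is recovered from its parts: if (i, l) is not in
    \<open>P\<close>, then u_{i,l}(m) = 0 and l does not occur in \<open>M\<close>.\<close>
  have "(\<Sum>p\<in>P. replicate_mset (count M (snd p)) (snd p)) = M"
  proof (rule multiset_eqI)
    fix l
    have "count (\<Sum>p\<in>P. replicate_mset (count M (snd p)) (snd p)) l
        = (\<Sum>p\<in>P. if p = (i, l) then count M l else 0)"
      unfolding count_sum using P(2) by (intro sum.cong refl) (force split: if_splits)
    also have "\<dots> = (if (i, l) \<in> P then count M l else 0)" using P(1) by simp
    also have "\<dots> = count M l" using M(1)[of l] by (auto simp: P_def in_keys_iff)
    finally show "count (\<Sum>p\<in>P. replicate_mset (count M (snd p)) (snd p)) l = count M l" .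
  qed
  moreover have "(\<Sum>p\<in>P. ?A (replicate_mset (count M (snd p)) (snd p)))
      = ?A (\<Sum>p\<in>P. replicate_mset (count M (snd p)) (snd p))"
    using P(1) by (induction P rule: finite_induct) auto
  ultimately have A: "(\<Sum>p\<in>P. ?A (replicate_mset (count M (snd p)) (snd p))) = ?A M" by simp
  define z where "z = (\<Sum>p\<in>{p \<in> keys m. fst p \<notin> {i}}. Poly_Mapping.single p (lookup m p))"
  have mz: "m = z + (\<Sum>p\<in>P. Poly_Mapping.single p (lookup m p))"
  proof -
    have "m = (\<Sum>p\<in>{p \<in> keys m. fst p \<notin> {i}} \<union> P. Poly_Mapping.single p (lookup m p))"
      by (subst mono_as_sum) (intro sum.cong, auto simp: P_def)
    also have "\<dots> = z + (\<Sum>p\<in>P. Poly_Mapping.single p (lookup m p))"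
      unfolding z_def by (intro sum.union_disjoint) (auto simp: P_def)
    finally show ?thesis .
  qed
  have "E {i} m = lmon z * (\<Prod>p\<in>P. cgen i (snd p) ^ nat (lookup m p))"
    unfolding E_def z_def[symmetric] P_def[symmetric]
    by (intro arg_cong2[of _ _ _ _ "(*)"] prod.cong refl) (use P(2) EY_singleton[OF i] in \<open>metis fst_conv\<close>)
  moreover have "z + (\<Sum>p\<in>P. Poly_Mapping.single p (lookup m p) - ?A (replicate_mset (count M (snd p)) (snd p)))
      \<in> keys (lmon z * (\<Prod>p\<in>P. cgen i (snd p) ^ nat (lookup m p)))"
    using prod[OF P(1) order_refl] by (intro keys_mult_nonneg nonneg_coeffs_lmon) (auto simp: keys_lmon)
  moreover have "z + (\<Sum>p\<in>P. Poly_Mapping.single p (lookup m p) - ?A (replicate_mset (count M (snd p)) (snd p))) = q"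
    unfolding sum_subtractf A M(2) by (subst (2) mz) (simp add: add_diff_eq)
  ultimately show "q \<in> keys (E {i} m)" by simp
qed

section \<open>Chains in the sets D_m\<close>

definition D_step :: "(nat \<Rightarrow> mono) \<Rightarrow> nat \<Rightarrow> bool" where
  "D_step s k \<longleftrightarrow> (\<exists>k'<k. \<exists>J\<subseteq>I. s k' \<in> B J \<and>
        (\<forall>k''. k' < k'' \<and> k'' \<le> k \<longrightarrow>
           s k'' \<in> keys (E J (s k')) \<and>
           s k'' - s (k'' - 1) \<in> {- Amon j l | j l. j \<in> J}))"

lemma D_alt: "D m = {m' \<in> monomials. \<exists>(R :: nat) s. s 0 = m \<and> s R = m' \<and> (\<forall>k\<le>R. s k \<in> monomials) \<and>
     (\<forall>k\<in>{1..R}. D_step s k)}"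
  unfolding D_def D_step_def ..

lemma D_start: "m0 \<in> monomials \<Longrightarrow> m0 \<in> D m0"
  unfolding D_alt by (auto intro!: exI[of _ 0] exI[of _ "\<lambda>_. m0"])

text \<open>The chain that ends in \<open>m\<close> is prolonged by the factors A_{i,l+r_i}^{-1} one
  at a time, always with \<open>m\<close> as the earlier member and J = {i}. Each intermediate
  monomial belongs to a submultiset of \<open>M\<close>, hence to the box, hence to the monomials of
  \<open>E {i} m\<close>.\<close>

lemma D_expand:
  assumes i: "i \<in> I" and m: "m \<in> D m0" "m \<in> B {i}" and q: "q \<in> box i m"
  shows "q \<in> D m0"
proof -
  let ?A = "\<lambda>M. \<Sum>l\<in>#M. Amon i (l + int (r i))"
  obtain R s where s: "s 0 = m0" "s R = m" "\<forall>k\<le>R. s k \<in> monomials"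
    "\<forall>k\<in>{1..R}. D_step s k"
    using m(1) unfolding D_alt by blast
  obtain M where M: "\<And>l. int (count M l) \<le> lookup m (i, l)" "q = m - ?A M"
    using q by (auto simp: box_def)
  obtain ls where ls: "mset ls = M" using ex_mset by blast
  \<comment> \<open>Beyond index \<open>R\<close>, the sequence divides \<open>m\<close> by the
    first k - R factors; at k = R both clauses give \<open>m\<close>.\<close>
  define s' where "s' k = (if k \<le> R then s k else m - ?A (mset (take (k - R) ls)))" for k
  define R' where "R' = R + length ls"
  have A_mon: "?A N \<in> monomials" for N
    using i by (induction N) (auto intro: monomials_0 monomials_add[OF monomials_Amon])
  have m_mon: "m \<in> monomials" using m(2) by (simp add: B_def)
  have in_box: "m - ?A (mset (take k ls)) \<in> box i m" for k
  proof -
    have "count (mset (take k ls)) l \<le> count M l" for l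
      using mset_subset_eq_count[of "mset (take k ls)" "mset ls"] ls
      by (metis append_take_drop_id mset_append mset_subset_eq_add_left)
    then show ?thesis unfolding box_def using M(1) by (auto intro!: exI[of _ "mset (take k ls)"] order_trans[OF _ M(1)])
  qed
  have s'R: "s' R' = q" using s(2) ls M(2) by (auto simp: s'_def R'_def)
  have c1: "q \<in> monomials" unfolding M(2) using A_mon m_mon by (intro monomials_diff)
  have c2: "s' 0 = m0" using s(1) by (simp add: s'_def)
  have c3: "\<forall>k\<le>R'. s' k \<in> monomials"
    using s(3) m_mon A_mon by (auto simp: s'_def intro!: monomials_diff)
  have c4: "D_step s' k" if k: "k \<in> {1..R'}" for k
  proof (cases "k \<le> R")
    case True
    then have "k \<in> {1..R}" using k by auto
    then obtain k' J where k': "k' < k" "J \<subseteq> I" "s k' \<in> B J"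
      "\<forall>k''. k' < k'' \<and> k'' \<le> k \<longrightarrow> s k'' \<in> keys (E J (s k')) \<and>
           s k'' - s (k'' - 1) \<in> {- Amon j l | j l. j \<in> J}"
      using bspec[OF s(4) \<open>k \<in> {1..R}\<close>] unfolding D_step_def by auto
    show ?thesis
      unfolding D_step_def
    proof (intro exI[of _ k'] exI[of _ J] conjI allI impI)
      fix k'' assume "k' < k'' \<and> k'' \<le> k"
      moreover from this True k'(1) have "s' k'' = s k''" "s' (k'' - 1) = s (k'' - 1)" "s' k' = s k'"
        by (auto simp: s'_def)
      ultimately show "s' k'' \<in> keys (E J (s' k'))"
        "s' k'' - s' (k'' - 1) \<in> {- Amon j l | j l. j \<in> J}"
        using k'(4) by auto
    qed (use k' True in \<open>auto simp: s'_def\<close>)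
  next
    case False
    show ?thesis
      unfolding D_step_def
    proof (intro exI[of _ R] exI[of _ "{i}"] conjI allI impI)
      show "R < k" "{i} \<subseteq> I" "s' R \<in> B {i}" using False i m(2) s(2) by (auto simp: s'_def)
      fix k'' assume k'': "R < k'' \<and> k'' \<le> k"
      have eq: "s' j = m - ?A (mset (take (j - R) ls))" if "R \<le> j" for j
        using that s(2) by (cases "j = R") (auto simp: s'_def)
      show "s' k'' \<in> keys (E {i} (s' R))"
        using k'' eq[of k''] eq[of R] in_box box_subset_E[OF i m(2)] by auto
      define j where "j = k'' - R - 1"
      have j: "k'' - R = Suc j" "k'' - 1 - R = j" "j < length ls"
        using k'' k by (auto simp: j_def R'_def)
      have "s' k'' - s' (k'' - 1) = - Amon i (ls ! j + int (r i))"
        using k'' eq[of k''] eq[of "k'' - 1"] j by (simp add: take_Suc_conv_app_nth)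
      then show "s' k'' - s' (k'' - 1) \<in> {- Amon j l | j l. j \<in> {i}}" by auto
    qed
  qed
  show ?thesis
    unfolding D_alt
    by (intro CollectI conjI exI[of _ R'] exI[of _ s'] ballI c1 c2 c3 c4 s'R)
qed

lemma reachable_subset_D:
  assumes "m0 \<in> monomials"
  shows "reachable m0 \<subseteq> D m0"
proof
  fix q assume "q \<in> reachable m0"
  then show "q \<in> D m0"
  proof (induction rule: reachable.induct)
    case (expand p i q)
    then show ?case using D_expand keys_Et[of i p] by blast
  qed (rule D_start[OF assms])
qed

lemma Aprods_0: "0 \<in> Aprods 0"
  by (auto simp: Aprods_def)

lemma Aprods_Suc:
  assumes "a \<in> Aprods K" "j \<in> I"
  shows "a - Amon j l \<in> Aprods (Suc K)"
proof -
  obtain ps where "length ps = K" "set ps \<subseteq> I \<times> UNIV" "a = sum_list (map (\<lambda>(j, l). - Amon j l) ps)"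
    using assms(1) by (auto simp: Aprods_def)
  then show ?thesis
    unfolding Aprods_def using assms(2) by (auto intro!: exI[of _ "(j, l) # ps"])
qed

lemma ht_Aprods:
  assumes "a \<in> Aprods K"
  shows "ht a = - hA * int K"
proof -
  have "ht (sum_list (map (\<lambda>(j, l). - Amon j l) ps)) = - hA * int (length ps)" if "set ps \<subseteq> I \<times> UNIV" for ps
    using that by (induction ps) (auto simp: ht_simps ht_Amon algebra_simps)
  then show ?thesis using assms by (auto simp: Aprods_def)
qed

text \<open>Every index of a chain contributes exactly one factor A_{j,l}^{-1}, so the K is the
  length of the chain.\<close>

lemma D_subset_cone:
  assumes "q \<in> D m0"
  shows "\<exists>K. q - m0 \<in> Aprods K"
proof -
  obtain R s where s: "s 0 = m0" "s R = q"
    "\<forall>k\<in>{1..R}. D_step s k"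
    using assms unfolding D_alt by blast
  have "k \<le> R \<Longrightarrow> s k - m0 \<in> Aprods k" for k
  proof (induction k)
    case 0
    then show ?case using s(1) Aprods_0 by simp
  next
    case (Suc k)
    then have "Suc k \<in> {1..R}" by simp
    from bspec[OF s(3) this, unfolded D_step_def] obtain k' J where "k' < Suc k" "J \<subseteq> I"
      and step: "\<forall>k''. k' < k'' \<and> k'' \<le> Suc k \<longrightarrow>
           s k'' \<in> keys (E J (s k')) \<and>
           s k'' - s (k'' - 1) \<in> {- Amon j l | j l. j \<in> J}"
      by auto
    from step[rule_format, of "Suc k"] \<open>k' < Suc k\<close> have "s (Suc k) - s k \<in> {- Amon j l | j l. j \<in> J}"
      by simp
    then obtain j l where j: "j \<in> I" "s (Suc k) - s k = - Amon j l" using \<open>J \<subseteq> I\<close> by blast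
    have "s (Suc k) - m0 = (s (Suc k) - s k) + (s k - m0)" by simp
    also have "\<dots> = (s k - m0) - Amon j l" unfolding j(2) by simp
    finally have eq: "s (Suc k) - m0 = (s k - m0) - Amon j l" .
    show ?case unfolding eq using Suc j(1) by (intro Aprods_Suc) auto
  qed
  then show ?thesis using s(2) by blast
qed

end

section \<open>Existence and uniqueness\<close>

context finite_cartan_data
begin

text \<open>All of \<open>Aprods K\<close> lies at one height, so it meets only finitely many
  reachable monomials; the 1 in the depth admits this height in the strict bound of
  \<open>upto_depth\<close>. The factor \<open>u\<close> leaves room for the powers of t in
  \<open>lmult\<close>.\<close>

lemma A_graded_reachable:
  assumes "m0 \<in> monomials" "\<And>q. G q \<noteq> 0 \<Longrightarrow> q \<in> reachable m0"
  shows "A_graded (\<lambda>a. u a * G (m0 + a))"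
  unfolding A_graded_def
proof (intro conjI allI subsetI)
  fix a assume "a \<in> {a. u a * G (m0 + a) \<noteq> 0}"
  then have "m0 + a \<in> D m0" using assms(2)[of "m0 + a"] reachable_subset_D[OF assms(1)] by auto
  from D_subset_cone[OF this] show "a \<in> (\<Union>K. Aprods K)" by auto
next
  fix K
  have "{a. u a * G (m0 + a) \<noteq> 0} \<inter> Aprods K \<subseteq> (\<lambda>q. q - m0) ` upto_depth m0 (nat (hA * int K) + 1)"
  proof
    fix a assume a: "a \<in> {a. u a * G (m0 + a) \<noteq> 0} \<inter> Aprods K"
    have "m0 + a \<in> upto_depth m0 (nat (hA * int K) + 1)"
      using a assms(2)[of "m0 + a"] hA_pos by (auto simp: upto_depth_def ht_add ht_Aprods)
    then show "a \<in> (\<lambda>q. q - m0) ` upto_depth m0 (nat (hA * int K) + 1)"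
      by (intro image_eqI[of _ _ "m0 + a"]) auto
  qed
  then show "finite ({a. u a * G (m0 + a) \<noteq> 0} \<inter> Aprods K)"
    by (rule finite_subset) (intro finite_imageI finite_upto_depth)
qed

lemma in_Yt_inf:
  assumes "m0 \<in> monomials" "\<And>q. F q \<noteq> 0 \<Longrightarrow> q \<in> reachable m0"
  shows "F \<in> Yt_inf"
proof -
  \<comment> \<open>One summand M = m0 suffices; the power of t undoes the twist of
    \<open>lmult\<close>.\<close>
  have "lmult m0 (\<lambda>a. tpow (- N m0 a) * F (m0 + a)) = F"
    by (intro ext) (simp add: lmult_def tpow_inverse)
  then show ?thesis
    unfolding Yt_inf_def YtA_inf_def using A_graded_reachable[of m0 F "\<lambda>a. tpow (- N m0 a)"] assms
    by (intro CollectI exI[of _ "{m0}"] exI[of _ "\<lambda>_ a. tpow (- N m0 a) * F (m0 + a)"]) auto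
qed

lemma in_Kt_inf_at:
  assumes "m0 \<in> monomials" "i \<in> I" "\<And>q. F q \<noteq> 0 \<Longrightarrow> q \<in> reachable m0"
    and d: "\<And>q. d q \<noteq> 0 \<Longrightarrow> q \<in> reachable m0 \<and> q \<in> B {i}"
    and Fd: "\<And>q t. ht m0 - int t < ht q \<Longrightarrow> F q = lookup (partial m0 t d i) q"
  shows "F \<in> Kt_inf_at i"
proof -
  have "F m = Sum_any (\<lambda>a. d (m0 + a) * lookup (Et i (m0 + a)) m)" for m
  proof -
    \<comment> \<open>Deep enough to include every \<open>p\<close> at least as high as
      \<open>m\<close>; lower ones do not have \<open>m\<close> as a monomial.\<close>
    define t where "t = nat (ht m0 - ht m) + 1"
    let ?A = "(\<lambda>q. q - m0) ` upto_depth m0 t"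
    have "Sum_any (\<lambda>a. d (m0 + a) * lookup (Et i (m0 + a)) m) =
        (\<Sum>a\<in>?A. d (m0 + a) * lookup (Et i (m0 + a)) m)"
    proof (rule Sum_any.expand_superset)
      show "finite ?A" by (intro finite_imageI finite_upto_depth)
      show "{a. d (m0 + a) * lookup (Et i (m0 + a)) m \<noteq> 0} \<subseteq> ?A"
      proof
        fix a assume "a \<in> {a. d (m0 + a) * lookup (Et i (m0 + a)) m \<noteq> 0}"
        then have a: "d (m0 + a) \<noteq> 0" "m \<in> keys (Et i (m0 + a))" by (auto simp: in_keys_iff)
        have "m = m0 + a \<or> ht m < ht (m0 + a)"
          using keys_Et_ht[OF assms(2) _ a(2)] d[OF a(1)] by blast
        then have "m0 + a \<in> upto_depth m0 t"
          using d[OF a(1)] by (auto simp: upto_depth_def t_def)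
        then show "a \<in> ?A" by (intro image_eqI[of _ _ "m0 + a"]) auto
      qed
    qed
    also have "\<dots> = (\<Sum>p\<in>upto_depth m0 t. d p * lookup (Et i p) m)"
      by (subst sum.reindex) (auto simp: inj_on_def)
    also have "\<dots> = lookup (partial m0 t d i) m"
      by (simp add: partial_def lookup_sum)
    also have "\<dots> = F m" by (rule Fd[symmetric]) (simp add: t_def)
    finally show ?thesis ..
  qed
  moreover have "A_graded (\<lambda>a. d (m0 + a))"
    using A_graded_reachable[of m0 d "\<lambda>_. 1"] assms(1) d by simp
  ultimately show ?thesis
    unfolding Kt_inf_at_def using in_Yt_inf[of m0 F] assms(1,3) d
    by (intro CollectI conjI exI[of _ "{m0}"] exI[of _ "\<lambda>_ a. d (m0 + a)"]) auto
qed

lemma existence: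
  assumes "1 \<le> n" "m0 \<in> B I"
  shows "\<exists>F. F \<in> Kt_inf \<inter> D_tilde m0 \<and> {m' \<in> B I. F m' \<noteq> 0} = {m0} \<and> F m0 = 1"
proof -
  have m0: "m0 \<in> monomials" using assms(2) by (simp add: B_def)
  obtain F d where F: "\<And>q. F q \<noteq> 0 \<Longrightarrow> q \<in> reachable m0"
    "\<And>i q. i \<in> I \<Longrightarrow> d i q \<noteq> 0 \<Longrightarrow> q \<in> reachable m0 \<and> q \<in> B {i}"
    "\<And>i q t. i \<in> I \<Longrightarrow> ht m0 - int t < ht q \<Longrightarrow> F q = lookup (partial m0 t (d i) i) q"
    "\<And>q. q \<in> B I \<Longrightarrow> F q = of_bool (q = m0)"
    using algorithm[OF assms(1), of m0] by blast
  have "F \<in> Kt_inf"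
    unfolding Kt_inf_def
  proof (rule INT_I)
    fix i assume i: "i \<in> I"
    show "F \<in> Kt_inf_at i"
      by (rule in_Kt_inf_at[OF m0 i F(1) F(2)[OF i] F(3)[OF i]])
  qed
  moreover have "F \<in> D_tilde m0"
    unfolding D_tilde_def using in_Yt_inf[of m0 F] F(1) m0 reachable_subset_D[OF m0] by blast
  moreover have "{m' \<in> B I. F m' \<noteq> 0} = {m0}" "F m0 = 1"
    using F(4) assms(2) by auto
  ultimately show ?thesis by blast
qed

text \<open>A normal form for elements of the completed span: the sum over M and the graded sums
  over a are merged into one family, finite above each height. Coefficients of a difference can then
  be subtracted directly.\<close>

definition expansion :: "nat \<Rightarrow> (mono \<Rightarrow> tpoly) \<Rightarrow> (mono \<Rightarrow> tpoly) \<Rightarrow> bool" where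
  "expansion i d F \<longleftrightarrow> (\<forall>p. d p \<noteq> 0 \<longrightarrow> p \<in> B {i}) \<and> (\<forall>h. finite {p. d p \<noteq> 0 \<and> h \<le> ht p}) \<and>
     (\<forall>m. F m = (\<Sum>p\<in>{p. d p \<noteq> 0 \<and> ht m \<le> ht p}. d p * lookup (Et i p) m))"

lemma expansion_sum:
  assumes "expansion i d F" "finite P" "{p. d p \<noteq> 0 \<and> ht m \<le> ht p} \<subseteq> P" "\<And>p. p \<in> P \<Longrightarrow> ht m \<le> ht p"
  shows "F m = (\<Sum>p\<in>P. d p * lookup (Et i p) m)"
proof -
  have "F m = (\<Sum>p\<in>{p. d p \<noteq> 0 \<and> ht m \<le> ht p}. d p * lookup (Et i p) m)"
    using assms(1) unfolding expansion_def by blast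
  also have "\<dots> = (\<Sum>p\<in>P. d p * lookup (Et i p) m)"
    using assms(2-4) by (intro sum.mono_neutral_left) auto
  finally show ?thesis .
qed

lemma expansion_diff:
  assumes "expansion i d F" "expansion i d' F'"
  shows "expansion i (\<lambda>p. d p - d' p) (\<lambda>m. F m - F' m)"
proof -
  have fin: "finite {p. d p \<noteq> 0 \<and> h \<le> ht p}" "finite {p. d' p \<noteq> 0 \<and> h \<le> ht p}" for h
    using assms by (auto simp: expansion_def)
  have sub: "{p. d p - d' p \<noteq> 0 \<and> h \<le> ht p} \<subseteq> {p. d p \<noteq> 0 \<and> h \<le> ht p} \<union> {p. d' p \<noteq> 0 \<and> h \<le> ht p}" for h
    by auto
  have "F m - F' m = (\<Sum>p\<in>{p. d p - d' p \<noteq> 0 \<and> ht m \<le> ht p}. (d p - d' p) * lookup (Et i p) m)" for m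
  proof -
    define P where "P = {p. d p \<noteq> 0 \<and> ht m \<le> ht p} \<union> {p. d' p \<noteq> 0 \<and> ht m \<le> ht p}"
    have P: "finite P" unfolding P_def using fin by blast
    have "F m = (\<Sum>p\<in>P. d p * lookup (Et i p) m)"
      by (rule expansion_sum[OF assms(1) P]) (auto simp: P_def)
    moreover have "F' m = (\<Sum>p\<in>P. d' p * lookup (Et i p) m)"
      by (rule expansion_sum[OF assms(2) P]) (auto simp: P_def)
    ultimately have "F m - F' m = (\<Sum>p\<in>P. (d p - d' p) * lookup (Et i p) m)"
      by (simp add: left_diff_distrib sum_subtractf)
    also have "\<dots> = (\<Sum>p\<in>{p. d p - d' p \<noteq> 0 \<and> ht m \<le> ht p}. (d p - d' p) * lookup (Et i p) m)"
    proof (rule sum.mono_neutral_right[OF P])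
      show "{p. d p - d' p \<noteq> 0 \<and> ht m \<le> ht p} \<subseteq> P" unfolding P_def by (rule sub)
      show "\<forall>p\<in>P - {p. d p - d' p \<noteq> 0 \<and> ht m \<le> ht p}. (d p - d' p) * lookup (Et i p) m = 0"
        by (auto simp: P_def)
    qed
    finally show ?thesis .
  qed
  moreover have "p \<in> B {i}" if "d p - d' p \<noteq> 0" for p
    using assms that unfolding expansion_def by (cases "d p = 0") auto
  moreover have "finite {p. d p - d' p \<noteq> 0 \<and> h \<le> ht p}" for h
    by (rule finite_subset[OF sub]) (use fin in blast)
  ultimately show ?thesis unfolding expansion_def by (intro conjI allI impI)
qed

lemma Kt_inf_at_expansion:
  assumes i: "i \<in> I" and F: "F \<in> Kt_inf_at i"
  shows "\<exists>d. expansion i d F"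
proof -
  obtain S c where S: "finite S"
    "\<forall>M\<in>S. A_graded (c M) \<and> (\<forall>a. c M a \<noteq> 0 \<longrightarrow> M + a \<in> B {i})"
    "F = (\<lambda>m. \<Sum>M\<in>S. Sum_any (\<lambda>a. c M a * lookup (Et i (M + a)) m))"
    using F unfolding Kt_inf_at_def by blast
  \<comment> \<open>Several M may lead to the same monomial p = M a; their coefficients are added
    and may cancel.\<close>
  define d where "d p = (\<Sum>M\<in>S. c M (p - M))" for p
  have d_nonzero: "\<exists>M\<in>S. c M (p - M) \<noteq> 0" if "d p \<noteq> 0" for p
    using that unfolding d_def by (meson sum.neutral)
  define P where "P h = (\<Union>M\<in>S. (\<lambda>a. M + a) ` {a. c M a \<noteq> 0 \<and> h \<le> ht (M + a)})" for h
  have fin1: "finite {a. c M a \<noteq> 0 \<and> h \<le> ht (M + a)}" if "M \<in> S" for M h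
  proof -
    have gr: "{a. c M a \<noteq> 0} \<subseteq> (\<Union>K. Aprods K)" "\<And>K. finite ({a. c M a \<noteq> 0} \<inter> Aprods K)"
      using S(2) that by (auto simp: A_graded_def)
    have "{a. c M a \<noteq> 0 \<and> h \<le> ht (M + a)} \<subseteq> (\<Union>K\<in>{..nat (ht M - h)}. {a. c M a \<noteq> 0} \<inter> Aprods K)"
    proof
      fix a assume a: "a \<in> {a. c M a \<noteq> 0 \<and> h \<le> ht (M + a)}"
      then obtain K where K: "a \<in> Aprods K" using gr(1) by blast
      have "1 * int K \<le> hA * int K" using hA_pos by (intro mult_right_mono) auto
      then have "K \<le> nat (ht M - h)" using a ht_Aprods[OF K] by (auto simp: ht_add)
      then show "a \<in> (\<Union>K\<in>{..nat (ht M - h)}. {a. c M a \<noteq> 0} \<inter> Aprods K)" using a K by auto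
    qed
    then show ?thesis by (rule finite_subset) (intro finite_UN_I finite_atMost gr(2))
  qed
  have finP: "finite (P h)" for h unfolding P_def using S(1) fin1 by auto
  have sub: "{p. d p \<noteq> 0 \<and> h \<le> ht p} \<subseteq> P h" for h
  proof
    fix p assume p: "p \<in> {p. d p \<noteq> 0 \<and> h \<le> ht p}"
    then obtain M where "M \<in> S" "c M (p - M) \<noteq> 0" using d_nonzero[of p] by blast
    then show "p \<in> P h" using p unfolding P_def by (intro UN_I[of M] image_eqI[of _ _ "p - M"]) auto
  qed
  have "F m = (\<Sum>p\<in>{p. d p \<noteq> 0 \<and> ht m \<le> ht p}. d p * lookup (Et i p) m)" for m
  proof -
    have "Sum_any (\<lambda>a. c M a * lookup (Et i (M + a)) m) =
        (\<Sum>p\<in>P (ht m). c M (p - M) * lookup (Et i p) m)" if M: "M \<in> S" for M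
    proof -
      have "Sum_any (\<lambda>a. c M a * lookup (Et i (M + a)) m) =
          (\<Sum>a\<in>(\<lambda>p. p - M) ` P (ht m). c M a * lookup (Et i (M + a)) m)"
      proof (rule Sum_any.expand_superset)
        show "finite ((\<lambda>p. p - M) ` P (ht m))" using finP by simp
        show "{a. c M a * lookup (Et i (M + a)) m \<noteq> 0} \<subseteq> (\<lambda>p. p - M) ` P (ht m)"
        proof
          fix a assume "a \<in> {a. c M a * lookup (Et i (M + a)) m \<noteq> 0}"
          then have a: "c M a \<noteq> 0" "m \<in> keys (Et i (M + a))" by (auto simp: in_keys_iff)
          then have "m = M + a \<or> ht m < ht (M + a)"
            using keys_Et_ht[OF i _ a(2)] S(2) M by blast
          then have "M + a \<in> P (ht m)"
            using a(1) M unfolding P_def by (intro UN_I[of M] imageI) auto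
          then show "a \<in> (\<lambda>p. p - M) ` P (ht m)" by (intro image_eqI[of _ _ "M + a"]) auto
        qed
      qed
      also have "\<dots> = (\<Sum>p\<in>P (ht m). c M (p - M) * lookup (Et i p) m)"
        by (subst sum.reindex) (auto simp: inj_on_def)
      finally show ?thesis .
    qed
    then have "F m = (\<Sum>M\<in>S. \<Sum>p\<in>P (ht m). c M (p - M) * lookup (Et i p) m)"
      unfolding S(3) by (intro sum.cong refl)
    also have "\<dots> = (\<Sum>p\<in>P (ht m). d p * lookup (Et i p) m)"
      unfolding d_def sum_distrib_right by (rule sum.swap)
    also have "\<dots> = (\<Sum>p\<in>{p. d p \<noteq> 0 \<and> ht m \<le> ht p}. d p * lookup (Et i p) m)"
      using sub[of "ht m"] finP[of "ht m"]
      by (intro sum.mono_neutral_right) (auto simp: P_def)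
    finally show ?thesis .
  qed
  moreover have "p \<in> B {i}" if p: "d p \<noteq> 0" for p
  proof -
    obtain M where "M \<in> S" "c M (p - M) \<noteq> 0"
      using d_nonzero[OF p] by blast
    then have "M + (p - M) \<in> B {i}" using S(2) by blast
    then show ?thesis by simp
  qed
  moreover have "finite {p. d p \<noteq> 0 \<and> h \<le> ht p}" for h
    by (rule finite_subset[OF sub finP])
  ultimately have "expansion i d F" unfolding expansion_def by (intro conjI allI impI)
  then show ?thesis by (rule exI[of _ d])
qed

text \<open>A highest index of the family exists because only finitely many lie above a given
  height, and it is visible in \<open>F\<close>. Hence no index lies above \<open>m\<close>, and the
  coefficient of \<open>F\<close> at \<open>m\<close> can only come from the index \<open>m\<close>
  itself.\<close>

lemma expansion_top_in_B:
  assumes i: "i \<in> I" and exp: "expansion i d F" and m: "F m \<noteq> 0"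
    and top: "\<And>q. ht m < ht q \<Longrightarrow> F q = 0"
  shows "m \<in> B {i}"
proof -
  have B: "p \<in> B {i}" if "d p \<noteq> 0" for p using exp that by (auto simp: expansion_def)
  have fin: "finite {p. d p \<noteq> 0 \<and> h \<le> ht p}" for h using exp by (auto simp: expansion_def)
  have F_val: "F p = d p * lookup (Et i p) p" if "\<And>q. d q \<noteq> 0 \<Longrightarrow> ht q \<le> ht p" for p
  proof -
    have "F p = (\<Sum>q\<in>{q. d q \<noteq> 0 \<and> ht p \<le> ht q}. d q * lookup (Et i q) p)"
      using exp by (auto simp: expansion_def)
    also have "\<dots> = (\<Sum>q\<in>{q. d q \<noteq> 0 \<and> ht p \<le> ht q}. if q = p then d p * lookup (Et i p) p else 0)"
      using lookup_Et_above[OF i B, of _ p] that by (intro sum.cong) fastforce+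
    also have "\<dots> = d p * lookup (Et i p) p" using fin[of "ht p"] by auto
    finally show ?thesis .
  qed
  have low: "ht p \<le> ht m" if "d p \<noteq> 0" for p
  proof (rule ccontr)
    assume p: "\<not> ht p \<le> ht m"
    let ?P = "{q. d q \<noteq> 0 \<and> ht p \<le> ht q}"
    have "finite (ht ` ?P)" "ht ` ?P \<noteq> {}" using fin[of "ht p"] that by auto
    then obtain q where q: "q \<in> ?P" "ht q = Max (ht ` ?P)"
      by (metis (no_types, lifting) Max_in imageE)
    have "ht q' \<le> ht q" if "d q' \<noteq> 0" for q'
    proof (cases "ht p \<le> ht q'")
      case True
      then have "ht q' \<in> ht ` ?P" using that by blast
      then show ?thesis unfolding q(2) using \<open>finite (ht ` ?P)\<close> by (rule Max_ge[rotated])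
    next
      case False
      then show ?thesis using q(1) by auto
    qed
    from F_val[OF this] have "F q = d q * lookup (Et i q) q" .
    moreover obtain u where "lookup (Et i q) q = tpow u"
      using leads_Et[OF i B, of q] q(1) by (auto simp: leads_def)
    ultimately have "F q \<noteq> 0" using q(1) tpow_nonzero by auto
    then show False using top[of q] p q(1) by auto
  qed
  from F_val[OF low] m have "d m \<noteq> 0" by auto
  then show ?thesis by (rule B)
qed

lemma uniqueness:
  assumes "1 \<le> n"
    and F: "F \<in> Kt_inf \<inter> D_tilde m0" "{m' \<in> B I. F m' \<noteq> 0} = {m0}" "F m0 = 1"
    and F': "F' \<in> Kt_inf \<inter> D_tilde m0" "{m' \<in> B I. F' m' \<noteq> 0} = {m0}" "F' m0 = 1"
  shows "F = F'"
proof (rule ccontr)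
  assume "F \<noteq> F'"
  then obtain q0 where q0: "F q0 \<noteq> F' q0" by blast
  \<comment> \<open>A monomial of maximal height in the difference: heights there are bounded by
    \<open>ht m0\<close> because D_m lies in the cone below m0, so the least such natural number
    gives the greatest height.\<close>
  obtain m where m: "F m \<noteq> F' m" "\<And>q. F q \<noteq> F' q \<Longrightarrow> nat (ht m0 - ht m) \<le> nat (ht m0 - ht q)"
    using ex_has_least_nat[of "\<lambda>q. F q \<noteq> F' q" q0 "\<lambda>q. nat (ht m0 - ht q)"] q0 by blast
  have le: "ht q \<le> ht m0" if "F q \<noteq> F' q" for q
  proof -
    have "q \<in> D m0" using that F(1) F'(1) by (cases "F q = 0") (auto simp: D_tilde_def)
    then obtain K where "q - m0 \<in> Aprods K" using D_subset_cone by blast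
    from ht_Aprods[OF this] have "ht q = ht m0 - hA * int K" by (simp add: ht_diff)
    moreover have "0 \<le> hA * int K" using hA_pos by simp
    ultimately show ?thesis by linarith
  qed
  have dom: "m \<in> B {i}" if i: "i \<in> I" for i
  proof -
    have "F \<in> Kt_inf_at i" "F' \<in> Kt_inf_at i" using F(1) F'(1) i unfolding Kt_inf_def by blast+
    then obtain d d' where "expansion i d F" "expansion i d' F'"
      using Kt_inf_at_expansion[OF i] by blast
    from expansion_diff[OF this] show ?thesis
    proof (rule expansion_top_in_B[OF i])
      show "F m - F' m \<noteq> 0" using m(1) by simp
      show "F q - F' q = 0" if "ht m < ht q" for q
        using m(2)[of q] le[OF m(1)] le[of q] that by (cases "F q = F' q") auto
    qed
  qed
  have "1 \<in> I" using assms(1) by simp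
  have "m \<in> monomials" using dom[OF \<open>1 \<in> I\<close>] unfolding B_def by blast
  moreover have "0 \<le> lookup m (i, l)" if "i \<in> I" for i l
    using dom[OF that] unfolding B_def by blast
  ultimately have B: "m \<in> B I" unfolding B_def by blast
  have "F m \<noteq> 0 \<Longrightarrow> m = m0" "F' m \<noteq> 0 \<Longrightarrow> m = m0" using F(2) F'(2) B by blast+
  then have "F m = F' m" using F(3) F'(3) by metis
  then show False using m(1) by contradiction
qed

end

theorem theorem5p13:
  fixes n :: nat and C :: "nat \<Rightarrow> nat \<Rightarrow> int" and r :: "nat \<Rightarrow> nat" and m :: mono
  assumes "1 \<le> n"
    and "finite_cartan_data n C r"
    and "m \<in> cartan_data.B n {1..n}"
  shows "\<exists>!F. F \<in> cartan_data.Kt_inf n C r \<inter> cartan_data.D_tilde n C r m \<and>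
              {m' \<in> cartan_data.B n {1..n}. F m' \<noteq> 0} = {m} \<and> F m = 1"
proof -
  interpret finite_cartan_data n C r by (rule assms(2))
  obtain F where F: "F \<in> Kt_inf \<inter> D_tilde m \<and> {m' \<in> B I. F m' \<noteq> 0} = {m} \<and> F m = 1"
    using existence[OF assms(1,3)] by blast
  show ?thesis
  proof (rule ex1I[of _ F])
    fix F' assume F': "F' \<in> Kt_inf \<inter> D_tilde m \<and> {m' \<in> B I. F' m' \<noteq> 0} = {m} \<and> F' m = 1"
    from F F' show "F' = F" by (elim conjE) (rule uniqueness[OF assms(1)])
  qed (rule F)
qed

end
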